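(* Let $F(x,y,z)=c$ be a constant-rank elimination problem (CREP) with $F\colon\mathcal X\times\mathcal Y\times\mathcal Z\to\mathbb R^N$, where $\mathcal X$ and $\mathcal Y$ have a Riemannian metric. At any solution $(x_0,y_0,z_0)$, write the partial derivatives $\frac{\partial F}{\partial x},\frac{\partial F}{\partial y},\frac{\partial F}{\partial z}$ as matrices $J_x,J_y,J_z$ in coordinates with respect to bases of $T_{x_0}\mathcal X$ and $T_{y_0}\mathcal Y$ that are orthonormal in the chosen Riemannian metrics and an arbitrary basis of $T_{z_0}\mathcal Z$. Let $Q$ be a matrix whose column span is $(\operatorname{span}J_z)^\perp$, and let $U_y$ and $U_z$ be matrices that satisfy $J_yU_y+J_zU_z=0$ and $$\ker\begin{bmatrix} J_y & J_z \end{bmatrix}=\operatorname{span}\begin{bmatrix} U_y \\ U_z \end{bmatrix}.$$ Then the columns of the matrix $A:=\begin{bmatrix} Q^TJ_y \\ U_y^T \end{bmatrix}$ are linearly independent. Furthermore, $$\kappa_{x\mapsto y}[F](x_0,y_0,z_0)=\left\|A^+\begin{bmatrix} -Q^TJ_x \\ 0 \end{bmatrix}\right\|,$$ where $A^+$ is any left inverse of $A$ (such as the Moore–Penrose inverse) and $\|\cdot\|$ is the operator 2-norm.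
   Context: Constant-rank elimination problem (CREP): Let $F\colon\mathcal X\times\mathcal Y\times\mathcal Z\to\mathcal W$ be a smooth map, where $\mathcal X,\mathcal Y,\mathcal Z,\mathcal W$ are smooth manifolds, and let $c$ be a constant in the image of $F$. Let $DF$ be the total derivative of $F$. Suppose there are $r,k\in\mathbb N$ such that everywhere on $\mathcal X\times\mathcal Y\times\mathcal Z$ (i) $\operatorname{rank} DF(x,y,z)=\operatorname{rank}\frac{\partial}{\partial (y,z)}F(x,y,z)=r$, and (ii) $\operatorname{rank}\frac{\partial}{\partial z}F(x,y,z)=k$. Then the equation $F(x,y,z)=c$ is called a CREP. $\mathcal X,\mathcal Y,\mathcal Z$ are the input, output and latent space, respectively. Canonical solution map: Let $(x_0,y_0,z_0)$ be a solution of a CREP, where $\mathcal Y$ is Riemannian with distance $d_{\mathcal Y}$. For all sufficiently small neighbourhoods $\widehat{\mathcal Z}\subseteq\mathcal Z$ of $z_0$, the map $$H(x):=\operatorname*{arg\,min}_{y\,:\,\exists z\in\widehat{\mathcal Z},\ F(x,y,z)=c}d_{\mathcal Y}(y_0,y)$$ is well-defined and smooth for $x$ in a neighbourhood of $x_0$. Condition number: If $\mathcal X$ and $\mathcal Y$ are Riemannian with distances $d_{\mathcal X},d_{\mathcal Y}$, then $$\kappa_{x\mapsto y}[F](x_0,y_0,z_0):=\limsup_{x\to x_0}\frac{d_{\mathcal Y}(y_0,H(x))}{d_{\mathcal X}(x_0,x)}.$$ This does not depend on the choice of the (sufficiently small) $\widehat{\mathcal Z}$. For a matrix $M$, $\operatorname{span}M$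 is its column space; orthogonal complements in $\mathbb R^N$ are with respect to the standard inner product. *)

theory Defs
  imports "HOL-Analysis.Analysis" "Jordan_Normal_Form.DL_Rank" "Jordan_Normal_Form.Matrix_Kernel"
begin

text \<open>Vectors and matrices are those of \<^theory>\<open>Jordan_Normal_Form.Matrix\<close>, whose dimensions are
  natural numbers, possibly 0.\<close>

unbundle no vec_syntax
unbundle no inner_syntax

section \<open>Smooth functions\<close>

text \<open>Only meaningful on open subsets of finite-dimensional spaces: there \<open>Ck_on n S f\<close> says that
  the iterated directional derivatives of order up to \<open>n\<close> exist and are continuous on \<open>S\<close>.\<close>

primrec Ck_on :: "nat \<Rightarrow> 'a::real_normed_vector set \<Rightarrow> ('a \<Rightarrow> 'b::real_normed_vector) \<Rightarrow> bool" where
  "Ck_on 0 S f \<longleftrightarrow> continuous_on S f"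
| "Ck_on (Suc n) S f \<longleftrightarrow> (\<forall>t\<in>S. f differentiable (at t)) \<and>
     (\<forall>v. Ck_on n S (\<lambda>t. frechet_derivative f (at t) v))"

definition smooth_on :: "'a::real_normed_vector set \<Rightarrow> ('a \<Rightarrow> 'b::real_normed_vector) \<Rightarrow> bool" where
  "smooth_on S f \<longleftrightarrow> (\<forall>n. Ck_on n S f)"


section \<open>Smooth manifolds\<close>

text \<open>A chart is a pair of its domain and its coordinate map. A manifold is a whole type \<open>'m\<close>,
  with a (not necessarily maximal) smooth atlas. The model space \<open>'e\<close> is a finite-dimensional
  inner product space and not a \<^class>\<open>euclidean_space\<close>, since the latter excludes dimension 0.\<close>

type_synonym ('m, 'e) chart = "'m set \<times> ('m \<Rightarrow> 'e)"

definition chart_inv :: "('m, 'e) chart \<Rightarrow> 'e \<Rightarrow> 'm" where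
  "chart_inv c = inv_into (fst c) (snd c)"

definition charts_at :: "('m, 'e) chart set \<Rightarrow> 'm \<Rightarrow> ('m, 'e) chart set" where
  "charts_at A p = {c \<in> A. p \<in> fst c}"

definition is_chart :: "('m::topological_space, 'e::real_normed_vector) chart \<Rightarrow> bool" where
  "is_chart c \<longleftrightarrow> open (fst c) \<and> open (snd c ` fst c) \<and>
     homeomorphism (fst c) (snd c ` fst c) (snd c) (chart_inv c)"

definition smooth_manifold ::
    "('m::{t2_space, second_countable_topology}, 'e::real_inner) chart set \<Rightarrow> bool" where
  "smooth_manifold A \<longleftrightarrow>
     (\<exists>B. finite B \<and> span B = (UNIV :: 'e set)) \<and>
     (\<forall>c\<in>A. is_chart c) \<and>
     (\<Union>c\<in>A. fst c) = UNIV \<and>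
     (\<forall>c\<in>A. \<forall>d\<in>A. smooth_on (snd c ` (fst c \<inter> fst d)) (snd d \<circ> chart_inv c))"

definition prod_atlas ::
    "('m, 'e) chart set \<Rightarrow> ('n, 'f) chart set \<Rightarrow> ('m \<times> 'n, 'e \<times> 'f) chart set" where
  "prod_atlas A B = {(fst c \<times> fst d, map_prod (snd c) (snd d)) | c d. c \<in> A \<and> d \<in> B}"

definition smooth_function :: "('m, 'e::real_normed_vector) chart set \<Rightarrow> ('m \<Rightarrow> real) \<Rightarrow> bool" where
  "smooth_function A f \<longleftrightarrow> (\<forall>c\<in>A. smooth_on (snd c ` fst c) (f \<circ> chart_inv c))"

text \<open>A map to \<open>\<real>\<^sup>N\<close> is a function with values in \<^term>\<open>carrier_vec N :: real vec set\<close>.\<close>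

definition smooth_vec_map ::
    "('m, 'e::real_normed_vector) chart set \<Rightarrow> nat \<Rightarrow> ('m \<Rightarrow> real vec) \<Rightarrow> bool" where
  "smooth_vec_map A N f \<longleftrightarrow>
     (\<forall>p. f p \<in> carrier_vec N) \<and> (\<forall>i<N. smooth_function A (\<lambda>p. f p $ i))"


section \<open>Tangent spaces and differentials\<close>

text \<open>A chart \<open>c\<close> at \<open>p\<close> identifies the tangent space at \<open>p\<close> with the model space, and a basis of
  the tangent space with an ordered basis of the model space.\<close>

definition ordered_basis :: "'e::real_vector list \<Rightarrow> bool" where
  "ordered_basis E \<longleftrightarrow> distinct E \<and> independent (set E) \<and> span (set E) = UNIV"

definition jacobian_mat ::
    "nat \<Rightarrow> ('m, 'e::real_normed_vector) chart \<Rightarrow> 'e list \<Rightarrow> ('m \<Rightarrow> real vec) \<Rightarrow> 'm \<Rightarrow> real mat" where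
  "jacobian_mat N c E f p = mat N (length E)
     (\<lambda>(i, j). frechet_derivative (\<lambda>t. f (chart_inv c t) $ i) (at (snd c p)) (E ! j))"

definition differential_rank ::
    "('m, 'e::real_normed_vector) chart set \<Rightarrow> nat \<Rightarrow> ('m \<Rightarrow> real vec) \<Rightarrow> 'm \<Rightarrow> nat \<Rightarrow> bool" where
  "differential_rank A N f p r \<longleftrightarrow>
     (\<forall>c\<in>charts_at A p. \<forall>E. ordered_basis E \<longrightarrow> vec_space.rank N (jacobian_mat N c E f p) = r)"


section \<open>Constant-rank elimination problems\<close>

definition CREP ::
    "('x::{t2_space, second_countable_topology}, 'ex::real_inner) chart set \<Rightarrow>
     ('y::{t2_space, second_countable_topology}, 'ey::real_inner) chart set \<Rightarrow>
     ('z::{t2_space, second_countable_topology}, 'ez::real_inner) chart set \<Rightarrow>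
     nat \<Rightarrow> ('x \<times> 'y \<times> 'z \<Rightarrow> real vec) \<Rightarrow> real vec \<Rightarrow> bool" where
  "CREP AX AY AZ N F c \<longleftrightarrow>
     smooth_manifold AX \<and> smooth_manifold AY \<and> smooth_manifold AZ \<and>
     smooth_vec_map (prod_atlas AX (prod_atlas AY AZ)) N F \<and>
     c \<in> range F \<and>
     (\<exists>r k. \<forall>x y z.
        differential_rank (prod_atlas AX (prod_atlas AY AZ)) N F (x, y, z) r \<and>
        differential_rank (prod_atlas AY AZ) N (\<lambda>q. F (x, q)) (y, z) r \<and>
        differential_rank AZ N (\<lambda>z'. F (x, y, z')) z k)"


section \<open>Riemannian metrics\<close>

text \<open>\<open>g c p\<close> is the inner product on the tangent space at \<open>p\<close>, in the coordinates of the chart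
  \<open>c\<close>; the last conjunct says that these expressions agree under changes of charts.\<close>

type_synonym ('m, 'e) metric = "('m, 'e) chart \<Rightarrow> 'm \<Rightarrow> 'e \<Rightarrow> 'e \<Rightarrow> real"

definition riemannian_metric ::
    "('m, 'e::real_normed_vector) chart set \<Rightarrow> ('m, 'e) metric \<Rightarrow> bool" where
  "riemannian_metric A g \<longleftrightarrow>
     (\<forall>c\<in>A. \<forall>p\<in>fst c.
        bilinear (g c p) \<and> (\<forall>u v. g c p u v = g c p v u) \<and> (\<forall>u. u \<noteq> 0 \<longrightarrow> g c p u u > 0)) \<and>
     (\<forall>c\<in>A. \<forall>u v. smooth_on (snd c ` fst c) (\<lambda>t. g c (chart_inv c t) u v)) \<and>
     (\<forall>c\<in>A. \<forall>d\<in>A. \<forall>p \<in> fst c \<inter> fst d. \<forall>u v.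
        let D = frechet_derivative (snd d \<circ> chart_inv c) (at (snd c p))
        in g c p u v = g d p (D u) (D v))"

definition orthonormal_basis_at ::
    "('m, 'e::real_normed_vector) metric \<Rightarrow> ('m, 'e) chart \<Rightarrow> 'm \<Rightarrow> 'e list \<Rightarrow> bool" where
  "orthonormal_basis_at g c p E \<longleftrightarrow> ordered_basis E \<and>
     (\<forall>i<length E. \<forall>j<length E. g c p (E ! i) (E ! j) = (if i = j then 1 else 0))"

definition piecewise_C1_path ::
    "('m::topological_space, 'e::real_normed_vector) chart set \<Rightarrow> (real \<Rightarrow> 'm) \<Rightarrow> bool" where
  "piecewise_C1_path A \<gamma> \<longleftrightarrow> path \<gamma> \<and>
     (\<exists>S. finite S \<and> (\<forall>c\<in>A. (snd c \<circ> \<gamma>) C1_differentiable_on ({0<..<1} \<inter> \<gamma> -` fst c - S)))"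

text \<open>For a Riemannian metric the speed does not depend on the chosen chart.\<close>

definition speed ::
    "('m, 'e::real_normed_vector) chart set \<Rightarrow> ('m, 'e) metric \<Rightarrow> (real \<Rightarrow> 'm) \<Rightarrow> real \<Rightarrow> real" where
  "speed A g \<gamma> t =
     (let c = SOME c. c \<in> charts_at A (\<gamma> t); w = vector_derivative (snd c \<circ> \<gamma>) (at t)
      in sqrt (g c (\<gamma> t) w w))"

definition path_len ::
    "('m, 'e::real_normed_vector) chart set \<Rightarrow> ('m, 'e) metric \<Rightarrow> (real \<Rightarrow> 'm) \<Rightarrow> ennreal" where
  "path_len A g \<gamma> = (\<integral>\<^sup>+t\<in>{0..1}. ennreal (speed A g \<gamma> t) \<partial>lborel)"

text \<open>The distance between different connected components is infinite.\<close>

definition riemannian_dist ::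
    "('m::topological_space, 'e::real_normed_vector) chart set \<Rightarrow> ('m, 'e) metric \<Rightarrow>
     'm \<Rightarrow> 'm \<Rightarrow> ennreal" where
  "riemannian_dist A g p q =
     (INF \<gamma>\<in>{\<gamma>. piecewise_C1_path A \<gamma> \<and> pathstart \<gamma> = p \<and> pathfinish \<gamma> = q}. path_len A g \<gamma>)"


section \<open>Canonical solution map and condition number\<close>

definition canonical_solution ::
    "('y::topological_space, 'ey::real_normed_vector) chart set \<Rightarrow> ('y, 'ey) metric \<Rightarrow>
     ('x \<times> 'y \<times> 'z \<Rightarrow> real vec) \<Rightarrow> real vec \<Rightarrow> 'y \<Rightarrow> 'z set \<Rightarrow> 'x \<Rightarrow> 'y" where
  "canonical_solution AY gY F c y0 Zh x =
     arg_min (riemannian_dist AY gY y0) (\<lambda>y. \<exists>z\<in>Zh. F (x, y, z) = c)"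

text \<open>The common value of the limes superior for all sufficiently small neighbourhoods \<open>Zh\<close> of \<open>z0\<close>.
  The filter \<^term>\<open>at x0\<close> excludes the point \<open>x0\<close> itself.\<close>

definition condition_number ::
    "('x::topological_space, 'ex::real_normed_vector) chart set \<Rightarrow> ('x, 'ex) metric \<Rightarrow>
     ('y::topological_space, 'ey::real_normed_vector) chart set \<Rightarrow> ('y, 'ey) metric \<Rightarrow>
     ('x \<times> 'y \<times> 'z::topological_space \<Rightarrow> real vec) \<Rightarrow> real vec \<Rightarrow> 'x \<Rightarrow> 'y \<Rightarrow> 'z \<Rightarrow> ennreal" where
  "condition_number AX gX AY gY F c x0 y0 z0 =
     (THE \<kappa>. \<exists>Z0. open Z0 \<and> z0 \<in> Z0 \<and> (\<forall>Zh. Zh \<subseteq> Z0 \<and> z0 \<in> interior Zh \<longrightarrow>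
        Limsup (at x0) (\<lambda>x. riemannian_dist AY gY y0 (canonical_solution AY gY F c y0 Zh x)
                            / riemannian_dist AX gX x0 x) = \<kappa>))"


section \<open>Matrices\<close>

definition append_cols :: "real mat \<Rightarrow> real mat \<Rightarrow> real mat" (infixr \<open>@\<^sub>c\<close> 65) where
  "A @\<^sub>c B = four_block_mat A B (0\<^sub>m 0 (dim_col A)) (0\<^sub>m 0 (dim_col B))"

text \<open>The columns are considered as a family, so a repeated column makes them dependent.\<close>

definition lin_indpt_cols :: "real mat \<Rightarrow> bool" where
  "lin_indpt_cols M \<longleftrightarrow> distinct (cols M) \<and>
     \<not> module.lin_dep class_ring (module_vec TYPE(real) (dim_row M)) (set (cols M))"

text \<open>The supremum is taken over the unit ball, not the unit sphere, so that a matrix without columns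
  has norm 0.\<close>

definition mat_norm2 :: "real mat \<Rightarrow> real" where
  "mat_norm2 M = (SUP v\<in>{v \<in> carrier_vec (dim_col M). v \<bullet> v \<le> 1}. sqrt ((M *\<^sub>v v) \<bullet> (M *\<^sub>v v)))"

end

theory Submission
  imports Defs
begin

hide_const (open) VectorSpace.subspace Matrix.orthogonal Order.top
hide_fact (open) VectorSpace.subspace_def Matrix.orthogonal_def

text \<open>Write \<open>dx\<close>, \<open>dy\<close>, \<open>dz\<close> for coordinate increments at the given solution. Constant rank has two
  consequences near it: the latent variable of any solution can be moved back close to \<open>z0\<close>, and every
  solution of the linearised equation is followed by a true solution up to \<open>o(dx)\<close>. Up to this error, the
  outputs that solve the equation for a given input are those with \<open>Q\<^sup>T (J\<^sub>x dx + J\<^sub>y dy) = 0\<close>, because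
  \<open>span J\<^sub>z\<close> is the orthogonal complement of \<open>span Q\<close>. They form an affine space of direction \<open>span U\<^sub>y\<close>,
  whose element of least norm is the one orthogonal to \<open>span U\<^sub>y\<close>, the unique solution \<open>A\<^sup>+ B dx\<close> of
  \<open>A dy = B dx\<close>. Riemannian distances agree with coordinate norms up to a factor \<open>1 + o(1)\<close>, so the
  distance from \<open>y0\<close> to the canonical solution is \<open>\<bar>A\<^sup>+ B dx\<bar> + o(dx)\<close>, and the limes superior of the
  quotients is the operator norm of \<open>A\<^sup>+ B\<close>. The canonical solution need not be known to be smooth: it is
  enough that the minimum is attained, which follows from compactness.\<close>

section \<open>Finite-dimensional inner product spaces\<close>

text \<open>The \<open>N\<close> equations may be redundant, since \<open>r < N\<close> is allowed,
  and then the implicit function theorem does not apply to the system as it stands. The retraction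
  therefore solves only \<open>dim T\<close> combinations of the equations by contraction, and
  constant rank has to show that the others follow. It is used for two choices of \<open>V\<close>:
  for the latent directions, where the rank is \<open>k\<close>, and for the whole space, where it
  is \<open>r\<close>. In the second case \<open>T\<close> can be chosen without input component,
  because the derivative in outputs and latents has the rank of the total one; the corrections then
  leave the input alone. Moving latents back is what makes the linearisation usable: a competitor in
  the arg min has its latent variable somewhere in \<open>Zh\<close>, at a distance from
  \<open>z0\<close> that does not shrink with \<open>dx\<close>, where the derivative at the base
  point says nothing. A left inverse is determined only on the range of \<open>A\<close>; all of
  them give the same result because \<open>B dx\<close> lies in that range for every
  \<open>dx\<close>.\<close>

text \<open>The model spaces may have dimension 0 and hence are not of class \<^class>\<open>euclidean_space\<close>; finite
  dimension is expressed by a finite spanning set.\<close>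

lemma common_radius:
  assumes "finite I" and "\<And>i. i \<in> I \<Longrightarrow> \<exists>r>0. P i r"
    and "\<And>i r r'. i \<in> I \<Longrightarrow> P i r \<Longrightarrow> 0 < r' \<Longrightarrow> r' \<le> r \<Longrightarrow> P i r'"
  shows "\<exists>r>(0::real). \<forall>i\<in>I. P i r"
  using assms
proof (induction I rule: finite_induct)
  case empty
  then show ?case by (auto intro: exI[of _ 1])
next
  case (insert i I)
  have "\<exists>r>0. \<forall>i\<in>I. P i r"
    using insert.prems by (intro insert.IH) auto
  then obtain r where r: "r > 0" "\<forall>i\<in>I. P i r" by blast
  obtain s where s: "s > 0" "P i s" using insert.prems(1) by blast
  have "\<forall>j\<in>insert i I. P j (min r s)"
  proof
    fix j assume j: "j \<in> insert i I"
    show "P j (min r s)"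
    proof (cases "j = i")
      case True
      then show ?thesis using s r insert.prems(2)[of i s "min r s"] by auto
    next
      case False
      then show ?thesis using j s r insert.prems(2)[of j r "min r s"] by auto
    qed
  qed
  then show ?case using r(1) s(1) by (intro exI[of _ "min r s"]) auto
qed

text \<open>The difference of the two sides is orthogonal to all of \<open>C\<close>, hence to the
  whole space and to itself. An element 0 of \<open>C\<close> is harmless: its coefficient is 0
  because division by 0 gives 0.\<close>

lemma orthogonal_expansion:
  fixes C :: "'a::real_inner set"
  assumes "finite C" "span C = UNIV" "pairwise orthogonal C"
  shows "u = (\<Sum>b\<in>C. (inner u b / inner b b) *\<^sub>R b)"
proof -
  define w where "w = u - (\<Sum>b\<in>C. (inner u b / inner b b) *\<^sub>R b)"
  have "inner w c = 0" if c: "c \<in> C" for c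
  proof -
    have "(\<Sum>b\<in>C. inner u b / inner b b * inner b c) = (\<Sum>b\<in>C. if b = c then inner u c else 0)"
      using assms(3) c by (intro sum.cong) (auto simp: pairwise_def orthogonal_def)
    then show ?thesis using c assms(1)
      by (simp add: w_def inner_diff_left inner_sum_left)
  qed
  then have "orthogonal w w"
    by (intro orthogonal_to_span[of w C]) (auto simp: assms(2) orthogonal_def)
  then show ?thesis by (simp add: w_def orthogonal_def)
qed

lemma orthogonal_spanning_set:
  fixes B :: "'a::real_inner set"
  assumes "finite B" "span B = UNIV"
  obtains C where "finite C" "span C = (UNIV :: 'a set)" "pairwise orthogonal C"
  using basis_orthogonal[OF assms(1)] assms(2) by metis

lemma abs_orthogonal_coefficient_le:
  fixes u b :: "'a::real_inner"
  shows "\<bar>inner u b / inner b b\<bar> \<le> norm u * (1 / norm b)"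
proof (cases "b = 0")
  case False
  have "\<bar>inner u b\<bar> \<le> norm u * norm b" by (rule Cauchy_Schwarz_ineq2)
  then show ?thesis using False
    by (simp add: power2_norm_eq_inner[symmetric] power2_eq_square divide_simps)
qed simp

lemma linear_imp_bounded_linear:
  fixes f :: "'a::real_inner \<Rightarrow> 'b::real_normed_vector"
  assumes "finite B" "span B = (UNIV :: 'a set)" "linear f"
  shows "bounded_linear f"
proof -
  obtain C :: "'a set" where C: "finite C" "span C = UNIV" "pairwise orthogonal C"
    using orthogonal_spanning_set[OF assms(1,2)] by blast
  have "norm (f u) \<le> norm u * (\<Sum>b\<in>C. 1 / norm b * norm (f b))" for u
  proof -
    have "f u = f (\<Sum>b\<in>C. (inner u b / inner b b) *\<^sub>R b)"
      using orthogonal_expansion[OF C] by simp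
    also have "\<dots> = (\<Sum>b\<in>C. (inner u b / inner b b) *\<^sub>R f b)"
      by (simp only: linear_sum[OF assms(3)] linear_cmul[OF assms(3)])
    also have "norm \<dots> \<le> (\<Sum>b\<in>C. norm u * (1 / norm b) * norm (f b))"
      by (intro sum_norm_le)
         (metis abs_orthogonal_coefficient_le norm_scaleR mult_right_mono norm_ge_zero)
    finally show ?thesis by (simp add: sum_distrib_left mult.assoc)
  qed
  then show ?thesis using assms(3)
    by (intro bounded_linear.intro bounded_linear_axioms.intro) blast+
qed

text \<open>By induction the set is a sum of segments, one for each element of \<open>C\<close>;
  this replaces an identification with a power of the reals.\<close>

lemma compact_bounded_combinations:
  fixes C :: "'a::real_normed_vector set"
  assumes "finite C"
  shows "compact {\<Sum>b\<in>C. a b *\<^sub>R b | a. \<forall>b\<in>C. \<bar>a b\<bar> \<le> M}"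
  using assms
proof (induction C rule: finite_induct)
  case (insert b C)
  have eq: "{\<Sum>b\<in>insert b C. a b *\<^sub>R b | a. \<forall>b\<in>insert b C. \<bar>a b\<bar> \<le> M}
    = {x + y | x y. x \<in> (\<lambda>s. s *\<^sub>R b) ` {-M..M} \<and> y \<in> {\<Sum>b\<in>C. a b *\<^sub>R b | a. \<forall>b\<in>C. \<bar>a b\<bar> \<le> M}}"
    (is "?L = ?R")
  proof (intro equalityI subsetI)
    fix x assume "x \<in> ?L"
    then obtain a where "x = (\<Sum>b\<in>insert b C. a b *\<^sub>R b)" "\<forall>b\<in>insert b C. \<bar>a b\<bar> \<le> M" by blast
    then show "x \<in> ?R" using insert.hyps by (force simp: abs_le_iff)
  next
    fix x assume "x \<in> ?R"
    then obtain s a where sa: "x = s *\<^sub>R b + (\<Sum>b\<in>C. a b *\<^sub>R b)" "s \<in> {-M..M}"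
      "\<forall>b\<in>C. \<bar>a b\<bar> \<le> M" by blast
    have "x = (\<Sum>c\<in>insert b C. (a(b := s)) c *\<^sub>R c)"
      using insert.hyps sa(1) by (auto intro!: sum.cong)
    moreover have "\<forall>c\<in>insert b C. \<bar>(a(b := s)) c\<bar> \<le> M"
      using sa by auto
    ultimately show "x \<in> ?L" by blast
  qed
  have "compact ((\<lambda>s. s *\<^sub>R b) ` {-M..M})"
    by (intro compact_continuous_image continuous_intros compact_Icc)
  then show ?case unfolding eq by (intro compact_sums insert.IH)
qed simp

text \<open>The coefficients of an orthogonal expansion are bounded on the ball, which is therefore
  a closed subset of a compact set of combinations.\<close>

lemma compact_cball_finite_span:
  fixes a :: "'a::real_inner"
  assumes "finite B" "span B = (UNIV :: 'a set)"
  shows "compact (cball a r)"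
proof -
  obtain C :: "'a set" where C: "finite C" "span C = UNIV" "pairwise orthogonal C"
    using orthogonal_spanning_set[OF assms(1,2)] by blast
  define M where "M = \<bar>r\<bar> * (\<Sum>b\<in>C. 1 / norm b)"
  define K where "K = {\<Sum>b\<in>C. \<alpha> b *\<^sub>R b | \<alpha>. \<forall>b\<in>C. \<bar>\<alpha> b\<bar> \<le> M}"
  have "cball 0 r \<subseteq> K"
  proof
    fix u :: 'a assume "u \<in> cball 0 r"
    then have u: "norm u \<le> \<bar>r\<bar>" by simp
    have "\<bar>inner u b / inner b b\<bar> \<le> M" if "b \<in> C" for b
    proof -
      have "1 / norm b \<le> (\<Sum>b\<in>C. 1 / norm b)"
        using that C(1) by (intro member_le_sum) auto
      then have "norm u * (1 / norm b) \<le> M"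
        unfolding M_def using u by (intro mult_mono) auto
      then show ?thesis using abs_orthogonal_coefficient_le[of u b] by linarith
    qed
    then show "u \<in> K" unfolding K_def using orthogonal_expansion[OF C, of u]
      by (intro CollectI exI[of _ "\<lambda>b. inner u b / inner b b"]) blast
  qed
  moreover have "compact K" unfolding K_def by (rule compact_bounded_combinations[OF C(1)])
  ultimately have "compact (cball (0::'a) r)"
    using compact_Int_closed[of K "cball 0 r"] by (simp add: inf.absorb2)
  then have "compact ((\<lambda>u. a + u) ` cball 0 r)"
    by (intro compact_continuous_image continuous_intros)
  then show ?thesis by (simp add: cball_translation)
qed

lemma span_product_UNIV:
  fixes B :: "'a::real_vector set" and B' :: "'b::real_vector set"
  assumes "span B = UNIV" "span B' = UNIV"
  shows "span (B \<times> {0} \<union> {0} \<times> B') = UNIV"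
proof -
  have "span (B \<times> {0} \<union> {0} \<times> B') = span (((\<lambda>x. (x, 0)) ` B) \<union> ((\<lambda>y. (0, y)) ` B'))"
    by (rule arg_cong[of _ _ span]) auto
  also have "\<dots> = {x + y |x y. x \<in> (\<lambda>x. (x, 0)) ` span B \<and> y \<in> (\<lambda>y. (0, y)) ` span B'}"
    by (subst span_Un, subst (1 2) linear_span_image) (auto intro!: linearI)
  also have "\<dots> = UNIV" unfolding assms by force
  finally show ?thesis .
qed

section \<open>Coordinates with respect to an ordered basis, strict differentiability, left
  inverses\<close>

definition coord :: "'e::real_vector list \<Rightarrow> nat \<Rightarrow> 'e \<Rightarrow> real" where
  "coord E i u = representation (set E) u (E ! i)"

lemma linear_coord:
  assumes "ordered_basis E"
  shows "linear (coord E i)"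
  using assms unfolding ordered_basis_def coord_def
  by (intro linearI) (auto simp: representation_add representation_scale)

lemma coord_expansion:
  assumes "ordered_basis E"
  shows "(\<Sum>i<length E. coord E i u *\<^sub>R E ! i) = u"
proof -
  have "(\<Sum>i<length E. coord E i u *\<^sub>R E ! i) = (\<Sum>b\<in>set E. representation (set E) u b *\<^sub>R b)"
    using assms unfolding ordered_basis_def coord_def
    by (intro sum.reindex_bij_betw bij_betw_nth) auto
  also have "\<dots> = u"
    using assms unfolding ordered_basis_def by (intro sum_representation_eq) auto
  finally show ?thesis .
qed

lemma coord_basis:
  assumes "ordered_basis E" "i < length E" "j < length E"
  shows "coord E i (E ! j) = (if i = j then 1 else 0)"
  using assms unfolding ordered_basis_def coord_def
  by (subst representation_basis) (auto simp: nth_eq_iff_index_eq)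

lemma coord_lincomb:
  assumes "ordered_basis E" "i < length E"
  shows "coord E i (\<Sum>j<length E. a j *\<^sub>R E ! j) = a i"
proof -
  have "coord E i (\<Sum>j<length E. a j *\<^sub>R E ! j) = (\<Sum>j<length E. a j * coord E i (E ! j))"
    by (simp add: linear_sum[OF linear_coord[OF assms(1)]] linear_cmul[OF linear_coord[OF assms(1)]])
  also have "\<dots> = (\<Sum>j<length E. if j = i then a i else 0)"
    using assms by (intro sum.cong) (auto simp: coord_basis)
  finally show ?thesis using assms(2) by simp
qed

lemma ordered_basis_finite_span:
  assumes "ordered_basis E"
  shows "finite (set E)" "span (set E) = UNIV"
  using assms by (auto simp: ordered_basis_def)

text \<open>Continuity of the derivative is assumed for each direction separately. Expanding
  \<open>v\<close> along the finite set \<open>C\<close> makes it uniform in \<open>v\<close>, and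
  the mean value inequality for \<open>f\<close> minus its linearisation at \<open>q0\<close> then
  gives the second estimate.\<close>

lemma C1_strictly_differentiable:
  fixes f :: "'a::real_inner \<Rightarrow> real"
  assumes fin: "finite B" "span B = (UNIV :: 'a set)"
    and S: "open S" "q0 \<in> S"
    and deriv: "\<And>q. q \<in> S \<Longrightarrow> (f has_derivative D q) (at q)"
    and cont: "\<And>v. continuous_on S (\<lambda>q. D q v)"
    and e: "e > 0"
  shows "\<exists>r>0. ball q0 r \<subseteq> S \<and>
      (\<forall>q\<in>ball q0 r. \<forall>v. \<bar>D q v - D q0 v\<bar> \<le> e * norm v) \<and>
      (\<forall>q\<in>ball q0 r. \<forall>q'\<in>ball q0 r. \<bar>f q - f q' - D q0 (q - q')\<bar> \<le> e * norm (q - q'))"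
proof -
  obtain C :: "'a set" where C: "finite C" "span C = UNIV" "pairwise orthogonal C"
    using orthogonal_spanning_set[OF fin] by blast
  define K where "K = (\<Sum>b\<in>C. 1 / norm b)"
  have K: "K \<ge> 0" unfolding K_def by (intro sum_nonneg) auto
  \<comment> \<open>\<open>K\<close> bounds the sum of the absolute values of the coefficients of a
    unit vector; adding 1 keeps the divisor positive when \<open>K\<close> is 0.\<close>
  define e' where "e' = e / (K + 1)"
  have e': "e' > 0" "e' * K \<le> e"
    using e K by (auto simp: e'_def divide_simps)
  have lin: "linear (D q)" if "q \<in> S" for q
    using deriv[OF that] by (rule has_derivative_linear)
  obtain r0 where r0: "r0 > 0" "ball q0 r0 \<subseteq> S"
    using S open_contains_ball by blast
  have "\<exists>r>0. \<forall>b\<in>C. \<forall>q\<in>S. dist q q0 < r \<longrightarrow> \<bar>D q b - D q0 b\<bar> \<le> e'"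
  proof (rule common_radius[OF C(1)])
    fix b assume "b \<in> C"
    have "\<exists>d>0. \<forall>q\<in>S. dist q q0 < d \<longrightarrow> dist (D q b) (D q0 b) < e'"
      using cont[of b] S(2) e'(1) unfolding continuous_on_iff by blast
    then show "\<exists>r>0. \<forall>q\<in>S. dist q q0 < r \<longrightarrow> \<bar>D q b - D q0 b\<bar> \<le> e'"
      unfolding dist_real_def by (metis less_eq_real_def)
  qed auto
  then obtain r1 where r1: "r1 > 0"
    "\<And>b q. b \<in> C \<Longrightarrow> q \<in> S \<Longrightarrow> dist q q0 < r1 \<Longrightarrow> \<bar>D q b - D q0 b\<bar> \<le> e'" by blast
  define r where "r = min r0 r1"
  have r: "r > 0" "ball q0 r \<subseteq> S" using r0 r1 by (auto simp: r_def)
  have bound: "\<bar>D q v - D q0 v\<bar> \<le> e * norm v" if q: "q \<in> ball q0 r" for q v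
  proof -
    have qS: "q \<in> S" using q r by blast
    have *: "D p v = (\<Sum>b\<in>C. (inner v b / inner b b) * D p b)" if "p \<in> S" for p
    proof -
      have "D p v = D p (\<Sum>b\<in>C. (inner v b / inner b b) *\<^sub>R b)"
        using orthogonal_expansion[OF C] by simp
      then show ?thesis by (simp add: linear_sum[OF lin[OF that]] linear_cmul[OF lin[OF that]])
    qed
    have "D q v - D q0 v = (\<Sum>b\<in>C. (inner v b / inner b b) * (D q b - D q0 b))"
      using *[OF qS] *[OF S(2)] by (simp add: sum_subtractf right_diff_distrib)
    also have "\<bar>\<dots>\<bar> \<le> (\<Sum>b\<in>C. (norm v * (1 / norm b)) * e')"
    proof (rule order_trans[OF sum_abs], rule sum_mono)
      fix b assume b: "b \<in> C"
      have "\<bar>D q b - D q0 b\<bar> \<le> e'"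
        using q r1(2)[OF b qS] by (auto simp: r_def dist_commute)
      then show "\<bar>(inner v b / inner b b) * (D q b - D q0 b)\<bar> \<le> (norm v * (1 / norm b)) * e'"
        unfolding abs_mult by (intro mult_mono abs_orthogonal_coefficient_le) auto
    qed
    also have "\<dots> = (e' * K) * norm v"
      unfolding K_def by (simp add: sum_distrib_left sum_distrib_right mult_ac)
    also have "\<dots> \<le> e * norm v" using e' by (intro mult_right_mono) auto
    finally show ?thesis .
  qed
  have "\<bar>f q - f q' - D q0 (q - q')\<bar> \<le> e * norm (q - q')"
    if q: "q \<in> ball q0 r" "q' \<in> ball q0 r" for q q'
  proof -
    have bl: "bounded_linear (D q0)" using deriv[OF S(2)] by (rule has_derivative_bounded_linear)
    have "norm ((f q - D q0 q) - (f q' - D q0 q')) \<le> e * norm (q - q')"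
    proof (rule differentiable_bound[OF convex_ball _ _ q])
      fix p assume p: "p \<in> ball q0 r"
      then have "(f has_derivative D p) (at p within ball q0 r)"
        using deriv[of p] r has_derivative_at_withinI by blast
      then show "((\<lambda>p. f p - D q0 p) has_derivative (\<lambda>v. D p v - D q0 v)) (at p within ball q0 r)"
        by (intro has_derivative_diff bounded_linear_imp_has_derivative bl)
      show "onorm (\<lambda>v. D p v - D q0 v) \<le> e"
        using bound[OF p] e by (intro onorm_bound) auto
    qed
    then show ?thesis by (simp add: linear_diff[OF lin[OF S(2)]] algebra_simps)
  qed
  then show ?thesis using r bound by blast
qed

text \<open>Induction on \<open>N\<close>, applied to the kernel \<open>T'\<close> of the last
  functional. If that functional does not vanish on \<open>T\<close>, a vector \<open>w\<close> on
  which it is 1 complements \<open>T'\<close>, and \<open>pN\<close> is \<open>w\<close> minus what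
  the other \<open>p i\<close> already produce for it.\<close>

lemma linear_functionals_left_inverse:
  fixes \<phi> :: "nat \<Rightarrow> 'a::real_vector \<Rightarrow> real"
  assumes "\<And>i. i < N \<Longrightarrow> linear (\<phi> i)" "subspace T"
    and "\<And>t. t \<in> T \<Longrightarrow> (\<And>i. i < N \<Longrightarrow> \<phi> i t = 0) \<Longrightarrow> t = 0"
  shows "\<exists>p. (\<forall>i. p i \<in> T) \<and> (\<forall>t\<in>T. (\<Sum>i<N. \<phi> i t *\<^sub>R p i) = t)"
  using assms
proof (induction N arbitrary: T)
  case 0
  then have "T = {0}" using subspace_0 by blast
  then show ?case by (intro exI[of _ "\<lambda>_. 0"]) auto
next
  case (Suc N)
  have lin: "linear (\<phi> i)" if "i \<le> N" for i using Suc.prems(1)[of i] that by simp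
  define T' where "T' = {t\<in>T. \<phi> N t = 0}"
  have subT': "subspace T'"
    using Suc.prems(2) lin[of N]
    by (auto simp: T'_def subspace_def linear_0 linear_add linear_cmul)
  have "t = 0" if "t \<in> T'" "\<And>i. i < N \<Longrightarrow> \<phi> i t = 0" for t
    using that Suc.prems(3)[of t] by (auto simp: T'_def less_Suc_eq)
  from Suc.IH[OF lin[OF less_imp_le] subT' this] obtain p where p: "\<And>i. p i \<in> T'" "\<And>t. t \<in> T' \<Longrightarrow> (\<Sum>i<N. \<phi> i t *\<^sub>R p i) = t"
    by blast
  show ?case
  proof (cases "\<exists>w\<in>T. \<phi> N w \<noteq> 0")
    case False
    then have "T' = T" by (auto simp: T'_def)
    then show ?thesis using p False subspace_0[OF Suc.prems(2)]
      by (intro exI[of _ "p(N := 0)"]) (auto intro!: sum.cong)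
  next
    case True
    then obtain w0 where w0: "w0 \<in> T" "\<phi> N w0 \<noteq> 0" by blast
    define w where "w = (1 / \<phi> N w0) *\<^sub>R w0"
    have w: "w \<in> T" "\<phi> N w = 1"
      using w0 lin[of N] subspace_scale[OF Suc.prems(2)] by (auto simp: w_def linear_cmul)
    define pN where "pN = w - (\<Sum>i<N. \<phi> i w *\<^sub>R p i)"
    have pT: "p i \<in> T" for i using p(1) by (auto simp: T'_def)
    then have "pN \<in> T" unfolding pN_def
      by (intro subspace_diff subspace_sum subspace_scale Suc.prems(2) w) auto
    moreover have "(\<Sum>i<Suc N. \<phi> i t *\<^sub>R (p(N := pN)) i) = t" if t: "t \<in> T" for t
    proof -
      have "t - \<phi> N t *\<^sub>R w \<in> T'"
        using t w lin[of N] Suc.prems(2)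
        by (auto simp: T'_def subspace_diff subspace_scale linear_diff linear_cmul)
      then have "(\<Sum>i<N. \<phi> i (t - \<phi> N t *\<^sub>R w) *\<^sub>R p i) = t - \<phi> N t *\<^sub>R w" by (rule p(2))
      moreover have "(\<Sum>i<N. \<phi> i (t - \<phi> N t *\<^sub>R w) *\<^sub>R p i)
          = (\<Sum>i<N. \<phi> i t *\<^sub>R p i) - \<phi> N t *\<^sub>R (\<Sum>i<N. \<phi> i w *\<^sub>R p i)"
        unfolding scaleR_sum_right sum_subtractf[symmetric]
        using lin by (intro sum.cong) (auto simp: linear_diff linear_cmul algebra_simps)
      ultimately have "(\<Sum>i<N. \<phi> i t *\<^sub>R p i) + \<phi> N t *\<^sub>R pN = t"
        by (simp add: pN_def algebra_simps)
      then show ?thesis by simp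
    qed
    ultimately show ?thesis using pT by (intro exI[of _ "p(N := pN)"]) auto
  qed
qed

section \<open>Families of constant rank\<close>

text \<open>\<open>T\<close> is a subspace of \<open>V\<close> on which the derivative at \<open>q0\<close> is injective. Injectivity persists nearby,
  and if the derivative has constant rank \<open>dim T\<close> along \<open>V\<close>, then \<open>T\<close> has the same image as \<open>V\<close>;
  this consequence is all that the last assumption demands.\<close>

locale constant_rank_family =
  fixes f :: "nat \<Rightarrow> 'q::real_inner \<Rightarrow> real" and D :: "nat \<Rightarrow> 'q \<Rightarrow> 'q \<Rightarrow> real"
    and N :: nat and S T V B :: "'q set" and q0 :: 'q
  assumes fin: "finite B" "span B = UNIV"
    and S: "open S" "q0 \<in> S"
    and deriv: "i < N \<Longrightarrow> q \<in> S \<Longrightarrow> (f i has_derivative D i q) (at q)"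
    and cont: "i < N \<Longrightarrow> continuous_on S (\<lambda>q. D i q v)"
    and T: "subspace T" "T \<subseteq> V"
    and V: "subspace V"
    and inj: "t \<in> T \<Longrightarrow> (\<And>i. i < N \<Longrightarrow> D i q0 t = 0) \<Longrightarrow> t = 0"
    and rank: "q \<in> S \<Longrightarrow> (\<And>t. t \<in> T \<Longrightarrow> (\<And>i. i < N \<Longrightarrow> D i q t = 0) \<Longrightarrow> t = 0) \<Longrightarrow>
      v \<in> V \<Longrightarrow> \<exists>t\<in>T. \<forall>i<N. D i q v = D i q t"
begin

lemma linear_D: "i < N \<Longrightarrow> q \<in> S \<Longrightarrow> linear (D i q)"
  using deriv has_derivative_linear by blast

lemma bounded_linear_D: "i < N \<Longrightarrow> q \<in> S \<Longrightarrow> bounded_linear (D i q)"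
  using deriv has_derivative_bounded_linear by blast

text \<open>A left inverse \<open>p\<close> of the derivative on \<open>T\<close> turns \<open>f = f q0\<close> into the square system \<open>G (q + t) = 0\<close> for
  \<open>t \<in> T\<close>, solved by contraction. Along \<open>s \<mapsto> q + s v + \<tau> (q + s v)\<close> the derivative of \<open>f\<close> lies in the
  image of \<open>T\<close> and is annihilated by \<open>p\<close>, so it vanishes.\<close>

theorem retraction:
  obtains \<sigma> C \<tau> where "\<sigma> > 0" "C \<ge> 0"
    "\<And>q. q \<in> ball q0 \<sigma> \<Longrightarrow> \<tau> q \<in> T \<and> norm (\<tau> q) \<le> C * (\<Sum>i<N. \<bar>f i q - f i q0\<bar>)"
    "\<And>q v i. q \<in> ball q0 \<sigma> \<Longrightarrow> q + v \<in> ball q0 \<sigma> \<Longrightarrow> v \<in> V \<Longrightarrow> i < N \<Longrightarrow>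
       f i (q + v + \<tau> (q + v)) = f i (q + \<tau> q)"
proof -
  obtain p where p: "\<And>i. p i \<in> T" "\<And>t. t \<in> T \<Longrightarrow> (\<Sum>i<N. D i q0 t *\<^sub>R p i) = t"
  proof -
    have "\<exists>p. (\<forall>i. p i \<in> T) \<and> (\<forall>t\<in>T. (\<Sum>i<N. D i q0 t *\<^sub>R p i) = t)"
      using linear_functionals_left_inverse[of N "\<lambda>i. D i q0" T, OF linear_D[OF _ S(2)] T(1) inj] .
    then show ?thesis using that by blast
  qed
  define M where "M = (\<Sum>i<N. norm (p i))"
  have M: "M \<ge> 0" unfolding M_def by (intro sum_nonneg) auto
  \<comment> \<open>Errors of size \<open>e\<close> in the single functions become at most 1/2 after
    combination with the \<open>p i\<close>; this is the contraction factor.\<close>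
  define e where "e = 1 / (2 * (M + 1))"
  have e: "e > 0" "e * M \<le> 1 / 2" using M by (auto simp: e_def divide_simps)
  define P where "P i r \<longleftrightarrow> ball q0 r \<subseteq> S \<and>
      (\<forall>q\<in>ball q0 r. \<forall>v. \<bar>D i q v - D i q0 v\<bar> \<le> e * norm v) \<and>
      (\<forall>q\<in>ball q0 r. \<forall>q'\<in>ball q0 r. \<bar>f i q - f i q' - D i q0 (q - q')\<bar> \<le> e * norm (q - q'))" for i r
  have "\<exists>r>0. \<forall>i\<in>{..<N}. P i r"
  proof (rule common_radius)
    fix i assume "i \<in> {..<N}"
    then have i: "i < N" by simp
    show "\<exists>r>0. P i r" unfolding P_def
      by (rule C1_strictly_differentiable[OF fin S deriv[OF i] cont[OF i] e(1)])
  next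
    fix i r r' assume "P i r" "r' \<le> r"
    moreover from this have "ball q0 r' \<subseteq> ball q0 r" by (intro subset_ball)
    ultimately show "P i r'" unfolding P_def by blast
  qed simp
  then obtain r1 where r1: "r1 > 0" "\<And>i. i < N \<Longrightarrow> P i r1" by blast
  obtain r0 where r0: "r0 > 0" "ball q0 r0 \<subseteq> S"
    using S open_contains_ball by blast
  define r where "r = min r0 r1"
  have r: "r > 0" "ball q0 r \<subseteq> S" "ball q0 r \<subseteq> ball q0 r1" using r0 r1(1) by (auto simp: r_def)
  have est1: "\<bar>D i q v - D i q0 v\<bar> \<le> e * norm v" if "i < N" "q \<in> ball q0 r" for i q v
    using r1(2)[OF that(1)] r(3) that(2) unfolding P_def by blast
  have est2: "\<bar>f i q - f i q' - D i q0 (q - q')\<bar> \<le> e * norm (q - q')"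
    if "i < N" "q \<in> ball q0 r" "q' \<in> ball q0 r" for i q q'
    using r1(2)[OF that(1)] r(3) that(2,3) unfolding P_def by blast
  have sum_bound: "norm (\<Sum>i<N. a i *\<^sub>R p i) \<le> c * M" if "\<And>i. i < N \<Longrightarrow> \<bar>a i\<bar> \<le> c" for a c
    unfolding M_def sum_distrib_left
    by (rule sum_norm_le) (auto intro!: mult_right_mono that)
  \<comment> \<open>\<open>PD\<close> and \<open>G\<close> are the derivative and the increment of
    \<open>f\<close>, compressed to \<open>T\<close> by \<open>p\<close>. \<open>PD q0\<close> is a
    projection onto \<open>T\<close>, so that \<open>t \<mapsto> G (q + t)\<close> has nearly the
    increments of the identity on \<open>T\<close>.\<close>
  define PD where "PD q v = (\<Sum>i<N. D i q v *\<^sub>R p i)" for q v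
  define G where "G q = (\<Sum>i<N. (f i q - f i q0) *\<^sub>R p i)" for q
  have G_T: "G q \<in> T" for q
    unfolding G_def by (intro subspace_sum subspace_scale T(1) p(1))
  have PD0: "PD q0 t = t" if "t \<in> T" for t using p(2)[OF that] by (simp add: PD_def)
  have PD_near: "norm (PD q v - PD q0 v) \<le> norm v / 2" if "q \<in> ball q0 r" for q v
  proof -
    have "PD q v - PD q0 v = (\<Sum>i<N. (D i q v - D i q0 v) *\<^sub>R p i)"
      by (simp add: PD_def sum_subtractf scaleR_diff_left)
    then have "norm (PD q v - PD q0 v) \<le> (e * norm v) * M"
      using sum_bound[of "\<lambda>i. D i q v - D i q0 v"] est1 that by auto
    also have "\<dots> = (e * M) * norm v" by simp
    also have "\<dots> \<le> (1 / 2) * norm v" by (intro mult_right_mono e) auto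
    finally show ?thesis by simp
  qed
  have G_near: "norm (G q - G q' - PD q0 (q - q')) \<le> norm (q - q') / 2"
    if "q \<in> ball q0 r" "q' \<in> ball q0 r" for q q'
  proof -
    have "G q - G q' - PD q0 (q - q') = (\<Sum>i<N. (f i q - f i q' - D i q0 (q - q')) *\<^sub>R p i)"
      by (simp add: PD_def G_def sum_subtractf[symmetric] scaleR_diff_left[symmetric])
    then have "norm (G q - G q' - PD q0 (q - q')) \<le> (e * norm (q - q')) * M"
      using sum_bound[of "\<lambda>i. f i q - f i q' - D i q0 (q - q')"] est2 that by auto
    also have "\<dots> = (e * M) * norm (q - q')" by simp
    also have "\<dots> \<le> (1 / 2) * norm (q - q')" by (intro mult_right_mono e) auto
    finally show ?thesis by simp
  qed
  have "bounded_linear (PD q0)" unfolding PD_def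
    by (intro bounded_linear_sum bounded_linear_scaleR_left bounded_linear_compose[OF bounded_linear_scaleR_left] bounded_linear_D S(2)) simp
  then obtain K where K: "K \<ge> 0" "\<And>v. norm (PD q0 v) \<le> norm v * K"
    using bounded_linear.nonneg_bounded by blast
  have G_lip: "norm (G q - G q') \<le> (K + 1) * norm (q - q')" if "q \<in> ball q0 r" "q' \<in> ball q0 r" for q q'
  proof -
    have "norm (G q - G q') \<le> norm (G q - G q' - PD q0 (q - q')) + norm (PD q0 (q - q'))"
      using norm_triangle_ineq[of "G q - G q' - PD q0 (q - q')" "PD q0 (q - q')"] by simp
    also have "\<dots> \<le> norm (q - q') / 2 + norm (q - q') * K"
      using G_near[OF that] K by (intro add_mono) auto
    also have "\<dots> \<le> (K + 1) * norm (q - q')" by (simp add: algebra_simps)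
    finally show ?thesis .
  qed
  have contr: "norm ((G (q + t) - G (q + t')) - (t - t')) \<le> norm (t - t') / 2"
    if "q + t \<in> ball q0 r" "q + t' \<in> ball q0 r" "t \<in> T" "t' \<in> T" for q t t'
    using G_near[OF that(1,2)] PD0[of "t - t'"] subspace_diff[OF T(1) that(3,4)] by simp
  have expand: "norm (t - t') \<le> 2 * norm (G (q + t) - G (q + t'))"
    if "q + t \<in> ball q0 r" "q + t' \<in> ball q0 r" "t \<in> T" "t' \<in> T" for q t t'
    using contr[OF that] norm_triangle_ineq4[of "G (q + t) - G (q + t')" "(G (q + t) - G (q + t')) - (t - t')"]
    by simp
  \<comment> \<open>By the Lipschitz bound on \<open>G\<close>, this radius gives
    \<open>norm (G q) \<le> r / 8\<close>, half of the radius of \<open>X\<close>; the contraction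
    contributes the other half.\<close>
  define \<sigma> where "\<sigma> = (r / 8) / (K + 1)"
  have \<sigma>: "\<sigma> > 0" "\<sigma> \<le> r / 8" "(K + 1) * \<sigma> = r / 8"
  proof -
    show "\<sigma> > 0" using r K by (simp add: \<sigma>_def)
    have "K + 1 \<noteq> 0" using K by linarith
    then show *: "(K + 1) * \<sigma> = r / 8"
      by (metis \<sigma>_def nonzero_mult_div_cancel_left times_divide_eq_right)
    have "1 * \<sigma> \<le> (K + 1) * \<sigma>" using \<open>\<sigma> > 0\<close> K by (intro mult_right_mono) auto
    then show "\<sigma> \<le> r / 8" using * by simp
  qed
  have shift: "q + t \<in> ball q0 r" if "q \<in> ball q0 \<sigma>" "norm t \<le> r / 4" for q t
  proof -
    have "dist q0 (q + t) \<le> dist q0 q + norm t"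
      using norm_triangle_ineq4[of "q0 - q" t] by (simp add: dist_norm algebra_simps)
    then show ?thesis using that \<sigma> r by simp
  qed
  have "closed T"
  proof -
    have "T = {v. PD q0 v = v}"
    proof (intro equalityI subsetI CollectI)
      fix v assume "v \<in> {v. PD q0 v = v}"
      then have "v = PD q0 v" by simp
      also have "\<dots> \<in> T" unfolding PD_def by (intro subspace_sum subspace_scale T(1) p(1))
      finally show "v \<in> T" .
    qed (rule PD0)
    moreover have "continuous_on UNIV (PD q0)"
      using \<open>bounded_linear (PD q0)\<close> by (intro linear_continuous_on)
    ultimately show ?thesis by (simp add: closed_Collect_eq continuous_on_id)
  qed
  define X where "X = cball 0 (r / 4) \<inter> T"
  have X: "complete X" "X \<noteq> {}"
  proof -
    \<comment> \<open>The class \<open>real_inner\<close> does not include completeness, which here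
      comes from compactness.\<close>
    show "complete X" unfolding X_def
      by (intro compact_imp_complete compact_Int_closed compact_cball_finite_span[OF fin] \<open>closed T\<close>)
    have "0 \<in> X" using subspace_0[OF T(1)] r by (simp add: X_def)
    then show "X \<noteq> {}" by blast
  qed
  have ex: "\<exists>t\<in>T. norm t \<le> r / 4 \<and> G (q + t) = 0 \<and> norm t \<le> 2 * norm (G q)"
    if q: "q \<in> ball q0 \<sigma>" for q
  proof -
    have qr: "q \<in> ball q0 r" using shift[OF q, of 0] r by simp
    have Gq: "norm (G q) \<le> r / 8"
    proof -
      have "norm (G q - G q0) \<le> (K + 1) * norm (q - q0)"
        using qr r by (intro G_lip) auto
      also have "\<dots> \<le> (K + 1) * \<sigma>" using q K by (intro mult_left_mono) (auto simp: dist_norm norm_minus_commute)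
      finally show ?thesis using \<sigma> by (simp add: G_def)
    qed
    \<comment> \<open>Newton's iteration with the derivative frozen at \<open>q0\<close>, where its
      compression is the identity on \<open>T\<close>.\<close>
    define \<Theta> where "\<Theta> t = t - G (q + t)" for t
    have "\<exists>!t\<in>X. \<Theta> t = t"
    proof (rule Banach_fix[OF X, of "1/2"])
      show "\<Theta> ` X \<subseteq> X"
      proof
        fix s assume "s \<in> \<Theta> ` X"
        then obtain t where t: "t \<in> X" "s = t - G (q + t)" by (auto simp: \<Theta>_def)
        have tr: "norm t \<le> r / 4" "t \<in> T" using t by (auto simp: X_def)
        have "norm (G (q + t) - G (q + 0) - (t - 0)) \<le> norm (t - 0) / 2"
          using shift[OF q] tr r qr subspace_0[OF T(1)] by (intro contr) auto
        then have "norm (t - (G (q + t) - G q)) \<le> r / 8"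
          using tr by (simp add: norm_minus_commute)
        moreover have "s = (t - (G (q + t) - G q)) - G q" using t by simp
        ultimately have "norm s \<le> r / 8 + r / 8"
          using Gq norm_triangle_ineq4[of "t - (G (q + t) - G q)" "G q"] by simp
        then show "s \<in> X" using t tr G_T subspace_diff[OF T(1)] by (auto simp: X_def)
      qed
      fix t t' assume tt: "t \<in> X" "t' \<in> X"
      have "norm (G (q + t) - G (q + t') - (t - t')) \<le> norm (t - t') / 2"
        using tt shift[OF q] by (intro contr) (auto simp: X_def)
      moreover have "norm (\<Theta> t - \<Theta> t') = norm (G (q + t) - G (q + t') - (t - t'))"
        unfolding \<Theta>_def by (subst norm_minus_commute) (simp add: algebra_simps)
      ultimately show "dist (\<Theta> t) (\<Theta> t') \<le> 1 / 2 * dist t t'"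
        by (simp add: dist_norm)
    qed auto
    then obtain t where t: "t \<in> X" "G (q + t) = 0" by (auto simp: \<Theta>_def)
    have "norm (t - 0) \<le> 2 * norm (G (q + t) - G (q + 0))"
      using t qr shift[OF q] subspace_0[OF T(1)] by (intro expand) (auto simp: X_def)
    then show ?thesis using t by (auto simp: X_def)
  qed
  then obtain \<tau> where \<tau>: "\<And>q. q \<in> ball q0 \<sigma> \<Longrightarrow> \<tau> q \<in> T" "\<And>q. q \<in> ball q0 \<sigma> \<Longrightarrow> norm (\<tau> q) \<le> r / 4"
    "\<And>q. q \<in> ball q0 \<sigma> \<Longrightarrow> G (q + \<tau> q) = 0" "\<And>q. q \<in> ball q0 \<sigma> \<Longrightarrow> norm (\<tau> q) \<le> 2 * norm (G q)"
    by metis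
  have \<tau>_ball: "q + \<tau> q \<in> ball q0 r" if "q \<in> ball q0 \<sigma>" for q using shift[OF that \<tau>(2)[OF that]] .
  have \<tau>_lip: "norm (\<tau> q - \<tau> q') \<le> 2 * (K + 1) * norm (q - q')"
    if q: "q \<in> ball q0 \<sigma>" "q' \<in> ball q0 \<sigma>" for q q'
  proof -
    have "norm (\<tau> q - \<tau> q') \<le> 2 * norm (G (q + \<tau> q) - G (q + \<tau> q'))"
      using q \<tau> shift by (intro expand) auto
    also have "\<dots> = 2 * norm (G (q' + \<tau> q') - G (q + \<tau> q'))" using \<tau> q by simp
    also have "\<dots> \<le> 2 * ((K + 1) * norm ((q' + \<tau> q') - (q + \<tau> q')))"
      using q \<tau> shift by (intro mult_left_mono G_lip) auto
    finally show ?thesis by (simp add: norm_minus_commute algebra_simps)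
  qed
  have inj_near: "norm t \<le> 2 * norm (PD q t)" if "q \<in> ball q0 r" "t \<in> T" for q t
    using PD_near[OF that(1), of t] PD0[OF that(2)] norm_triangle_ineq4[of "PD q t" "PD q t - t"] by simp
  have const: "f i (q + v + \<tau> (q + v)) = f i (q + \<tau> q)"
    if q: "q \<in> ball q0 \<sigma>" "q + v \<in> ball q0 \<sigma>" and v: "v \<in> V" and i: "i < N" for q v i
  proof -
    define h where "h s = q + s *\<^sub>R v + \<tau> (q + s *\<^sub>R v)" for s :: real
    define L where "L = norm v + 2 * (K + 1) * norm v"
    have L: "L \<ge> 0" using K by (simp add: L_def)
    have seg: "q + s *\<^sub>R v \<in> ball q0 \<sigma>" if "s \<in> {0..1}" for s
    proof -
      have "(1 - s) *\<^sub>R q + s *\<^sub>R (q + v) \<in> ball q0 \<sigma>"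
        using convexD[OF convex_ball q, of "1 - s" s] that by simp
      then show ?thesis by (simp add: algebra_simps)
    qed
    have h_lip: "norm (h s - h s') \<le> L * \<bar>s - s'\<bar>" if s: "s \<in> {0..1}" "s' \<in> {0..1}" for s s'
    proof -
      have "h s - h s' = (s - s') *\<^sub>R v + (\<tau> (q + s *\<^sub>R v) - \<tau> (q + s' *\<^sub>R v))"
        by (simp add: h_def algebra_simps)
      then have "norm (h s - h s') \<le> norm ((s - s') *\<^sub>R v) + norm (\<tau> (q + s *\<^sub>R v) - \<tau> (q + s' *\<^sub>R v))"
        by (metis norm_triangle_ineq)
      also have "\<dots> \<le> \<bar>s - s'\<bar> * norm v + 2 * (K + 1) * norm ((q + s *\<^sub>R v) - (q + s' *\<^sub>R v))"
        using \<tau>_lip[OF seg[OF s(1)] seg[OF s(2)]] by simp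
      also have "norm ((q + s *\<^sub>R v) - (q + s' *\<^sub>R v)) = \<bar>s - s'\<bar> * norm v"
        by (simp flip: scaleR_left_diff_distrib)
      finally show ?thesis by (simp add: L_def algebra_simps)
    qed
    \<comment> \<open>\<open>\<tau>\<close> and therefore \<open>h\<close> is only known to be
      Lipschitz, so there is no chain rule to invoke. The increment \<open>\<Delta>\<close> of
      \<open>h\<close> lies in \<open>V\<close> and has the same image under the derivative as some
      \<open>t\<close> in \<open>T\<close>. Since \<open>G\<close> vanishes at both ends, the
      compressed image of \<open>t\<close> is as small as the Taylor remainder, and hence so is
      \<open>t\<close>.\<close>
    have "((\<lambda>s. f i (h s)) has_derivative (\<lambda>_. 0)) (at s within {0..1})" if s: "s \<in> {0..1}" for s
    proof -
      have hs: "h s \<in> ball q0 r" unfolding h_def by (rule \<tau>_ball[OF seg[OF s]])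
      then have hsS: "h s \<in> S" using r by blast
      obtain Bd where Bd: "Bd \<ge> 0" "\<And>w. \<bar>D i (h s) w\<bar> \<le> norm w * Bd"
        using bounded_linear.nonneg_bounded[OF bounded_linear_D[OF i hsS]] by auto
      have "\<exists>d>0. \<forall>s'\<in>{0..1}. norm (s' - s) < d \<longrightarrow> norm (f i (h s') - f i (h s) - 0) \<le> \<epsilon> * norm (s' - s)"
        if \<epsilon>: "\<epsilon> > 0" for \<epsilon>
      proof -
        \<comment> \<open>The factor that \<open>\<epsilon>'\<close> acquires: one remainder for
          \<open>f i\<close>, another one through \<open>t\<close> with factor
          \<open>2 * M * Bd\<close>, and all this times the Lipschitz constant of
          \<open>h\<close>.\<close>
        define c where "c = (2 * M * Bd + 1) * (L + 1)"
        have "c > 0" unfolding c_def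
          using M L Bd by (intro mult_pos_pos add_nonneg_pos mult_nonneg_nonneg) auto
        define \<epsilon>' where "\<epsilon>' = \<epsilon> / c"
        have \<epsilon>': "\<epsilon>' > 0" "(2 * M * Bd + 1) * (L + 1) * \<epsilon>' = \<epsilon>"
          unfolding c_def[symmetric] \<epsilon>'_def using \<epsilon> \<open>c > 0\<close> by auto
        have "\<exists>d>0. \<forall>j\<in>{..<N}. \<forall>y. norm (y - h s) < d \<longrightarrow>
            \<bar>f j y - f j (h s) - D j (h s) (y - h s)\<bar> \<le> \<epsilon>' * norm (y - h s)"
        proof (rule common_radius)
          fix j assume "j \<in> {..<N}"
          then have "(f j has_derivative D j (h s)) (at (h s))" using deriv hsS by auto
          then show "\<exists>d>0. \<forall>y. norm (y - h s) < d \<longrightarrow>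
            \<bar>f j y - f j (h s) - D j (h s) (y - h s)\<bar> \<le> \<epsilon>' * norm (y - h s)"
            unfolding has_derivative_at_alt using \<epsilon>'(1) by auto
        qed auto
        then obtain d where d: "d > 0" "\<And>j y. j < N \<Longrightarrow> norm (y - h s) < d \<Longrightarrow>
            \<bar>f j y - f j (h s) - D j (h s) (y - h s)\<bar> \<le> \<epsilon>' * norm (y - h s)" by auto
        have "norm (f i (h s') - f i (h s) - 0) \<le> \<epsilon> * norm (s' - s)"
          if s': "s' \<in> {0..1}" and close: "norm (s' - s) < d / (L + 1)" for s'
        proof -
          define \<Delta> where "\<Delta> = h s' - h s"
          have \<Delta>L: "norm \<Delta> \<le> L * \<bar>s' - s\<bar>" unfolding \<Delta>_def by (rule h_lip[OF s' s])
          also have "\<dots> \<le> (L + 1) * \<bar>s' - s\<bar>" by (intro mult_right_mono) auto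
          also have "\<dots> < d" using close L by (simp add: pos_less_divide_eq mult.commute)
          finally have \<Delta>d: "norm (h s' - h s) < d" by (simp add: \<Delta>_def)
          have "\<Delta> = (s' - s) *\<^sub>R v + (\<tau> (q + s' *\<^sub>R v) - \<tau> (q + s *\<^sub>R v))"
            by (simp add: \<Delta>_def h_def algebra_simps)
          then have "\<Delta> \<in> V"
            using v \<tau>(1)[OF seg[OF s]] \<tau>(1)[OF seg[OF s']] T(2)
            by (auto intro!: subspace_add subspace_diff subspace_scale V)
          moreover have "t = 0" if "t \<in> T" "\<And>j. j < N \<Longrightarrow> D j (h s) t = 0" for t
            using inj_near[OF hs that(1)] that(2) by (simp add: PD_def)
          ultimately obtain t where t: "t \<in> T" "\<And>j. j < N \<Longrightarrow> D j (h s) \<Delta> = D j (h s) t"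
            using rank[OF hsS] by metis
          have "G (h s') = 0" "G (h s) = 0"
            unfolding h_def using \<tau>(3) seg s s' by auto
          then have "PD (h s) t = (\<Sum>j<N. - (f j (h s') - f j (h s) - D j (h s) \<Delta>) *\<^sub>R p j)"
            using t(2) by (simp add: PD_def G_def sum_subtractf scaleR_diff_left)
          also have "norm \<dots> \<le> (\<epsilon>' * norm \<Delta>) * M"
            by (rule sum_bound) (metis \<Delta>_def \<Delta>d abs_minus_cancel d(2))
          finally have nt: "norm t \<le> 2 * ((\<epsilon>' * norm \<Delta>) * M)"
            using inj_near[OF hs t(1)] by linarith
          have "\<bar>f i (h s') - f i (h s)\<bar> \<le> \<epsilon>' * norm \<Delta> + \<bar>D i (h s) t\<bar>"
            using d(2)[OF i \<Delta>d] t(2)[OF i] by (simp add: \<Delta>_def)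
          also have "\<dots> \<le> \<epsilon>' * norm \<Delta> + (2 * ((\<epsilon>' * norm \<Delta>) * M)) * Bd"
            using Bd(2)[of t] mult_right_mono[OF nt Bd(1)] by linarith
          also have "\<dots> = (2 * M * Bd + 1) * \<epsilon>' * norm \<Delta>" by (simp add: algebra_simps)
          also have "\<dots> \<le> (2 * M * Bd + 1) * \<epsilon>' * ((L + 1) * \<bar>s' - s\<bar>)"
            using \<epsilon>' M Bd \<Delta>L \<open>L * \<bar>s' - s\<bar> \<le> (L + 1) * \<bar>s' - s\<bar>\<close>
            by (intro mult_left_mono) auto
          also have "\<dots> = ((2 * M * Bd + 1) * (L + 1) * \<epsilon>') * \<bar>s' - s\<bar>" by (simp only: mult_ac)
          finally show ?thesis unfolding \<epsilon>'(2) by simp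
        qed
        then show ?thesis using d(1) L by (intro exI[of _ "d / (L + 1)"]) auto
      qed
      then show ?thesis unfolding has_derivative_within_alt
        by (auto simp: bounded_linear_zero)
    qed
    then have "f i (h 0) = f i (h 1)"
      using has_derivative_zero_unique[of "{0..1}" "\<lambda>s. f i (h s)" 0 1] by force
    then show ?thesis by (simp add: h_def)
  qed
  show ?thesis
  proof (rule that[of \<sigma> "2 * M" \<tau>])
    fix q assume q: "q \<in> ball q0 \<sigma>"
    have "norm (G q) \<le> (\<Sum>i<N. M * \<bar>f i q - f i q0\<bar>)"
      unfolding G_def
    proof (rule sum_norm_le)
      fix i assume "i \<in> {..<N}"
      then have "norm (p i) \<le> M" unfolding M_def by (intro member_le_sum) auto
      then show "norm ((f i q - f i q0) *\<^sub>R p i) \<le> M * \<bar>f i q - f i q0\<bar>"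
        by (simp add: mult.commute mult_right_mono)
    qed
    then show "\<tau> q \<in> T \<and> norm (\<tau> q) \<le> 2 * M * (\<Sum>i<N. \<bar>f i q - f i q0\<bar>)"
      using \<tau>(1)[OF q] \<tau>(4)[OF q] by (simp add: sum_distrib_left[symmetric] mult.assoc)
  qed (use \<sigma> M const in auto)
qed

end

section \<open>Ranks of matrices of linear functionals\<close>

definition functional_matrix :: "nat \<Rightarrow> 'e list \<Rightarrow> (nat \<Rightarrow> 'e \<Rightarrow> real) \<Rightarrow> real mat" where
  "functional_matrix N E \<phi> = mat N (length E) (\<lambda>(i, j). \<phi> i (E ! j))"

definition of_coords :: "'e::real_vector list \<Rightarrow> real vec \<Rightarrow> 'e" where
  "of_coords E a = (\<Sum>j<length E. a $ j *\<^sub>R E ! j)"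

definition coord_vec :: "'e::real_vector list \<Rightarrow> 'e \<Rightarrow> real vec" where
  "coord_vec E u = vec (length E) (\<lambda>i. coord E i u)"

lemma functional_matrix_carrier [simp]: "functional_matrix N E \<phi> \<in> carrier_mat N (length E)"
  by (simp add: functional_matrix_def)

lemma coord_vec_carrier [simp]: "coord_vec E u \<in> carrier_vec (length E)"
  by (simp add: coord_vec_def)

lemma of_coords_coord_vec: "ordered_basis E \<Longrightarrow> of_coords E (coord_vec E u) = u"
  using coord_expansion[of E u] by (simp add: of_coords_def coord_vec_def)

lemma coord_vec_of_coords: "ordered_basis E \<Longrightarrow> a \<in> carrier_vec (length E) \<Longrightarrow> coord_vec E (of_coords E a) = a"
  by (intro eq_vecI) (auto simp: of_coords_def coord_vec_def coord_lincomb)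

lemma functional_matrix_mult_vec:
  assumes "\<And>i. i < N \<Longrightarrow> linear (\<phi> i)" "a \<in> carrier_vec (length E)"
  shows "functional_matrix N E \<phi> *\<^sub>v a = vec N (\<lambda>i. \<phi> i (of_coords E a))"
  using assms
  by (intro eq_vecI)
     (auto simp: functional_matrix_def of_coords_def scalar_prod_def linear_sum linear_cmul
       lessThan_atLeast0 mult.commute)

lemma functional_matrix_mult_coord_vec:
  assumes "\<And>i. i < N \<Longrightarrow> linear (\<phi> i)" "ordered_basis E"
  shows "functional_matrix N E \<phi> *\<^sub>v coord_vec E u = vec N (\<lambda>i. \<phi> i u)"
  using assms by (simp add: functional_matrix_mult_vec of_coords_coord_vec)

text \<open>A bridge between independence in \<open>carrier_vec N\<close>, on which
  \<open>rank\<close> rests, and independence in the model space. Linear combinations of the images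
  have their coefficients indexed by the images, so injectivity is what lets the coefficients be
  transported.\<close>

lemma functional_independent_iff:
  fixes \<phi> :: "nat \<Rightarrow> 'e::real_vector \<Rightarrow> real"
  assumes "\<And>i. i < N \<Longrightarrow> linear (\<phi> i)" "finite B" "inj_on (\<lambda>u. vec N (\<lambda>i. \<phi> i u)) B"
  shows "\<not> module.lin_dep class_ring (module_vec TYPE(real) N) ((\<lambda>u. vec N (\<lambda>i. \<phi> i u)) ` B) \<longleftrightarrow>
    (\<forall>a. (\<forall>i<N. \<phi> i (\<Sum>b\<in>B. a b *\<^sub>R b) = 0) \<longrightarrow> (\<forall>b\<in>B. a b = 0))"
proof -
  interpret V: vec_space "TYPE(real)" N .
  let ?v = "\<lambda>u. vec N (\<lambda>i. \<phi> i u)"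
  have car: "?v ` B \<subseteq> carrier_vec N" by auto
  have lincomb: "V.lincomb c (?v ` B) = 0\<^sub>v N \<longleftrightarrow> (\<forall>i<N. \<phi> i (\<Sum>b\<in>B. c (?v b) *\<^sub>R b) = 0)" for c
  proof -
    have "V.lincomb c (?v ` B) $ i = \<phi> i (\<Sum>b\<in>B. c (?v b) *\<^sub>R b)" if "i < N" for i
      using that assms(3)
      by (simp add: V.lincomb_index[OF that car] sum.reindex linear_sum[OF assms(1)] linear_cmul[OF assms(1)])
    then show ?thesis
      by (auto simp: vec_eq_iff V.lincomb_dim[OF finite_imageI[OF assms(2)] car])
  qed
  show ?thesis
  proof
    assume indep: "V.lin_indpt (?v ` B)"
    show "\<forall>a. (\<forall>i<N. \<phi> i (\<Sum>b\<in>B. a b *\<^sub>R b) = 0) \<longrightarrow> (\<forall>b\<in>B. a b = 0)"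
    proof (intro allI impI ballI)
      fix a b assume a: "\<forall>i<N. \<phi> i (\<Sum>b\<in>B. a b *\<^sub>R b) = 0" and b: "b \<in> B"
      define c where "c = a \<circ> the_inv_into B ?v"
      have c: "c (?v b) = a b" if "b \<in> B" for b
        by (simp only: c_def o_apply the_inv_into_f_f[OF assms(3) that])
      have l0: "V.lincomb c (?v ` B) = 0\<^sub>v N"
        unfolding lincomb using a c by (simp cong: sum.cong)
      show "a b = 0"
        using V.lin_dep_crit[OF finite_imageI[OF assms(2)] subset_refl _ imageI[OF b] _ l0] indep b c by auto
    qed
  next
    assume *: "\<forall>a. (\<forall>i<N. \<phi> i (\<Sum>b\<in>B. a b *\<^sub>R b) = 0) \<longrightarrow> (\<forall>b\<in>B. a b = 0)"
    show "V.lin_indpt (?v ` B)"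
    proof (rule V.finite_lin_indpt2, goal_cases)
      case (3 c)
      then have "\<forall>i<N. \<phi> i (\<Sum>b\<in>B. c (?v b) *\<^sub>R b) = 0"
        using lincomb by (simp add: module_vec_simps)
      then have "\<forall>b\<in>B. c (?v b) = 0" using *[rule_format, of "\<lambda>b. c (?v b)"] by blast
      then show ?case by auto
    qed (use assms(2) in auto)
  qed
qed

lemma functional_image_in_span_cols:
  fixes \<phi> :: "nat \<Rightarrow> 'e::real_vector \<Rightarrow> real"
  assumes "\<And>i. i < N \<Longrightarrow> linear (\<phi> i)" "ordered_basis E"
  shows "vec N (\<lambda>i. \<phi> i u) \<in> vec_space.col_space N (functional_matrix N E \<phi>)"
  unfolding vec_space.col_space_eq[OF functional_matrix_carrier]
  using functional_matrix_mult_coord_vec[OF assms, where u = u]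
  by (auto simp: functional_matrix_def coord_vec_def intro!: bexI[of _ "coord_vec E u"])

lemma col_functional_matrix:
  assumes "j < length E"
  shows "col (functional_matrix N E \<phi>) j = vec N (\<lambda>i. \<phi> i (E ! j))"
  using assms by (intro eq_vecI) (auto simp: functional_matrix_def)

text \<open>Preimages of a maximal independent set of columns span \<open>T\<close>. There are as
  many of them as the rank, and the independence of their images amounts to injectivity on
  \<open>T\<close>.\<close>

lemma rank_functional_matrix_complement:
  fixes \<phi> :: "nat \<Rightarrow> 'e::real_vector \<Rightarrow> real"
  assumes lin: "\<And>i. i < N \<Longrightarrow> linear (\<phi> i)" and E: "ordered_basis E"
  obtains T where "subspace T" "dim T = vec_space.rank N (functional_matrix N E \<phi>)"
    "\<And>t. t \<in> T \<Longrightarrow> (\<And>i. i < N \<Longrightarrow> \<phi> i t = 0) \<Longrightarrow> t = 0"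
proof -
  interpret V: vec_space "TYPE(real)" N .
  let ?v = "\<lambda>u. vec N (\<lambda>i. \<phi> i u)" and ?M = "functional_matrix N E \<phi>"
  let ?P = "\<lambda>T. T \<subseteq> set (cols ?M) \<and> V.lin_indpt T"
  have "V.lin_indpt {}" by (rule V.finite_lin_indpt2) auto
  then obtain U where U: "finite U" "maximal U ?P"
    using maximal_exists_superset[of "set (cols ?M)" ?P "{}"] by auto
  have Ucols: "U \<subseteq> set (cols ?M)" "V.lin_indpt U" using U(2) by (auto simp: maximal_def)
  have rank: "V.rank ?M = card U"
    by (rule V.rank_card_indpt[OF functional_matrix_carrier U(2)])
  have "\<exists>e. ?v e = w" if "w \<in> U" for w
  proof -
    have "w \<in> set (cols ?M)" using that Ucols by blast
    then obtain j where "j < length E" "w = col ?M j"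
      by (auto simp: cols_def functional_matrix_def)
    then show ?thesis using col_functional_matrix by metis
  qed
  then obtain e where e: "\<And>w. w \<in> U \<Longrightarrow> ?v (e w) = w" by metis
  define B where "B = e ` U"
  have B: "finite B" "?v ` B = U" using U(1) e by (simp_all add: B_def image_image)
  have inj: "inj_on ?v B"
  proof (rule inj_onI)
    fix x y assume "x \<in> B" "y \<in> B" "?v x = ?v y"
    then obtain a b where "x = e a" "y = e b" "a \<in> U" "b \<in> U" "?v (e a) = ?v (e b)"
      unfolding B_def by blast
    then show "x = y" using e by metis
  qed
  have cardB: "card B = card U" using card_image[OF inj] B(2) by simp
  have zero: "\<forall>b\<in>B. a b = 0" if "\<forall>i<N. \<phi> i (\<Sum>b\<in>B. a b *\<^sub>R b) = 0" for a
    using functional_independent_iff[OF lin B(1) inj] Ucols(2) that unfolding B(2) by blast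
  have indep: "independent B"
    unfolding dependent_finite[OF B(1)] using zero lin by (auto simp: linear_0)
  show ?thesis
  proof (rule that[of "span B"])
    show "dim (span B) = V.rank ?M"
      using dim_span_eq_card_independent[OF indep] rank cardB by simp
    fix t assume "t \<in> span B" and t: "\<And>i. i < N \<Longrightarrow> \<phi> i t = 0"
    then obtain a where "t = (\<Sum>b\<in>B. a b *\<^sub>R b)" unfolding span_finite[OF B(1)] by auto
    then show "t = 0" using zero[of a] t by simp
  qed simp
qed

text \<open>The image of a basis of \<open>T\<close> is an independent subset of the column space
  with as many elements as the rank, hence it spans the column space.\<close>

lemma rank_functional_matrix_covers:
  fixes \<phi> :: "nat \<Rightarrow> 'e::real_vector \<Rightarrow> real"
  assumes lin: "\<And>i. i < N \<Longrightarrow> linear (\<phi> i)" and E: "ordered_basis E"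
    and T: "subspace T" "dim T = vec_space.rank N (functional_matrix N E \<phi>)"
    and inj: "\<And>t. t \<in> T \<Longrightarrow> (\<And>i. i < N \<Longrightarrow> \<phi> i t = 0) \<Longrightarrow> t = 0"
  shows "\<exists>t\<in>T. \<forall>i<N. \<phi> i u = \<phi> i t"
proof -
  interpret V: vec_space "TYPE(real)" N .
  let ?v = "\<lambda>u. vec N (\<lambda>i. \<phi> i u)" and ?M = "functional_matrix N E \<phi>"
  obtain B where B: "B \<subseteq> T" "independent B" "T \<subseteq> span B" "card B = dim T"
    using basis_exists by blast
  have spanB: "span B = T" using B(1,3) T(1) by (metis span_minimal subset_antisym)
  have finB: "finite B"
    using independent_span_bound[OF _ B(2), of "set E"] ordered_basis_finite_span[OF E] by auto
  have injv: "inj_on ?v B"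
  proof (rule inj_onI)
    fix x y assume xy: "x \<in> B" "y \<in> B" "?v x = ?v y"
    have "\<phi> i (x - y) = 0" if "i < N" for i
      using arg_cong[OF xy(3), of "\<lambda>w. w $ i"] that by (simp add: linear_diff[OF lin])
    then show "x = y" using inj[of "x - y"] subspace_diff[OF T(1)] B(1) xy(1,2) by auto
  qed
  have indep: "V.lin_indpt (?v ` B)"
  proof -
    have "\<forall>a. (\<forall>i<N. \<phi> i (\<Sum>b\<in>B. a b *\<^sub>R b) = 0) \<longrightarrow> (\<forall>b\<in>B. a b = 0)"
  proof (intro allI impI ballI)
    fix a b assume "\<forall>i<N. \<phi> i (\<Sum>b\<in>B. a b *\<^sub>R b) = 0" and b: "b \<in> B"
    moreover have "(\<Sum>b\<in>B. a b *\<^sub>R b) \<in> T"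
      using B(1) by (intro subspace_sum subspace_scale T(1)) auto
    ultimately have "(\<Sum>b\<in>B. a b *\<^sub>R b) = 0" using inj by blast
    then show "a b = 0" using B(2) finB b unfolding dependent_finite[OF finB] by blast
  qed
  then show ?thesis using functional_independent_iff[OF lin finB injv] by blast
  qed
  define C where "C = set (cols ?M)"
  have C: "finite C" "C \<subseteq> carrier_vec N" using cols_dim[of ?M] by (auto simp: C_def functional_matrix_def)
  have colsp: "V.col_space ?M = V.span C" by (simp add: V.col_space_def C_def)
  have vB: "?v ` B \<subseteq> V.span C"
    using functional_image_in_span_cols[where N = N and \<phi> = \<phi>, OF lin E] unfolding colsp by auto
  \<comment> \<open>Joining the images to the columns leaves the span unchanged and gives a finite
    set in which the images extend to a maximal independent set \<open>U\<close>; counting shows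
    that the extension adds nothing.\<close>
  define S where "S = ?v ` B \<union> C"
  have S: "finite S" "S \<subseteq> carrier_vec N" using finB C by (auto simp: S_def)
  have spanS: "V.span S = V.span C"
  proof (intro equalityI)
    have "S \<subseteq> V.span C" using vB V.in_own_span[of C] C by (auto simp: S_def)
    then show "V.span S \<subseteq> V.span C" using V.span_is_submodule[of C] C by (intro V.span_is_subset) auto
    show "V.span C \<subseteq> V.span S" by (rule V.span_is_monotone) (auto simp: S_def)
  qed
  let ?P = "\<lambda>T. T \<subseteq> S \<and> V.lin_indpt T"
  obtain U where U: "finite U" "maximal U ?P" "?v ` B \<subseteq> U"
    using maximal_exists_superset[of S ?P "?v ` B"] S(1) indep by (auto simp: S_def)
  have "card U = vectorspace.dim class_ring (V.span_vs S)"
    using V.dim_span[OF _ S(1) U(2)] S(2) by simp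
  also have "\<dots> = V.rank ?M" by (simp add: V.rank_def spanS C_def)
  also have "\<dots> = card (?v ` B)" using card_image[OF injv] B(4) T(2) by simp
  finally have "U = ?v ` B" using card_subset_eq[OF U(1,3)] by simp
  then have max: "maximal (?v ` B) ?P" using U(2) by simp
  have vBc: "?v ` B \<subseteq> carrier_vec N" by auto
  have "s \<in> V.span (?v ` B)" if s: "s \<in> S" for s
  proof (rule ccontr)
    assume ns: "s \<notin> V.span (?v ` B)"
    have sc: "s \<in> carrier_vec N" using s S(2) by blast
    have sB: "s \<notin> ?v ` B" using ns V.in_own_span[of "?v ` B"] vBc by auto
    have "V.lin_indpt (?v ` B \<union> {s})"
      using V.lin_dep_iff_in_span[OF _ indep _ sB] sc ns vBc by auto
    then have "?P (?v ` B \<union> {s})" using s by (auto simp: S_def)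
    then show False using max sB unfolding maximal_def by blast
  qed
  then have "V.span S \<subseteq> V.span (?v ` B)"
    using V.span_is_submodule[of "?v ` B"] vBc by (intro V.span_is_subset) auto
  then have "?v u \<in> V.span (?v ` B)"
    using functional_image_in_span_cols[where N = N and \<phi> = \<phi> and u = u, OF lin E] unfolding colsp spanS by blast
  then obtain a where a: "?v u = V.lincomb a (?v ` B)"
    using V.finite_span[of "?v ` B"] finB vBc by auto
  define t where "t = (\<Sum>b\<in>B. a (?v b) *\<^sub>R b)"
  have "\<phi> i u = \<phi> i t" if i: "i < N" for i
  proof -
    have "\<phi> i u = V.lincomb a (?v ` B) $ i" using arg_cong[OF a, of "\<lambda>w. w $ i"] i by simp
    also have "\<dots> = \<phi> i t"
      using i injv by (simp add: V.lincomb_index[OF i vBc] sum.reindex t_def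
          linear_sum[OF lin] linear_cmul[OF lin])
    finally show ?thesis .
  qed
  moreover have "t \<in> T" unfolding t_def using B(1)
    by (intro subspace_sum subspace_scale T(1)) auto
  ultimately show ?thesis by blast
qed

section \<open>Orthogonal projections and the matrix A\<close>

definition vnorm :: "real vec \<Rightarrow> real" where "vnorm v = sqrt (v \<bullet> v)"

lemma vnorm_eq_L2_set: "vnorm v = L2_set (\<lambda>i. v $ i) {..<dim_vec v}"
  by (simp add: vnorm_def L2_set_def scalar_prod_def lessThan_atLeast0 power2_eq_square)

lemma vnorm_nonneg [simp]: "vnorm v \<ge> 0" by (simp add: vnorm_eq_L2_set)

lemma vnorm_zero [simp]: "vnorm (0\<^sub>v n) = 0" by (simp add: vnorm_def)

lemma vnorm_smult: "vnorm (c \<cdot>\<^sub>v v) = \<bar>c\<bar> * vnorm v"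
proof -
  have "(c \<cdot>\<^sub>v v) \<bullet> (c \<cdot>\<^sub>v v) = c\<^sup>2 * (v \<bullet> v)"
    by (simp add: scalar_prod_def sum_distrib_left power2_eq_square algebra_simps)
  then show ?thesis by (simp add: vnorm_def real_sqrt_mult)
qed

lemma vnorm_triangle: "dim_vec v = dim_vec w \<Longrightarrow> vnorm (v + w) \<le> vnorm v + vnorm w"
  using L2_set_triangle_ineq[of "\<lambda>i. v $ i" "\<lambda>i. w $ i" "{..<dim_vec w}"]
  by (simp add: vnorm_eq_L2_set L2_set_def)

lemma scalar_prod_self_nonneg: "(v :: real vec) \<bullet> v \<ge> 0"
  by (simp add: scalar_prod_def sum_nonneg)

lemma scalar_prod_self_eq_0: "v \<in> carrier_vec n \<Longrightarrow> (v :: real vec) \<bullet> v = 0 \<longleftrightarrow> v = 0\<^sub>v n"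
  by (auto simp: scalar_prod_def sum_nonneg_eq_0_iff)

text \<open>Gram-Schmidt, one generator at a time. The induction hypothesis serves twice: for
  \<open>b\<close>, and for the new generator \<open>v\<close>, whose part \<open>v'\<close>
  orthogonal to the old generators then corrects the projection of \<open>b\<close>. The generators
  may be dependent, hence the case in which \<open>v'\<close> vanishes.\<close>

lemma projection_onto_span:
  fixes b :: "real vec"
  assumes "set vs \<subseteq> carrier_vec n" "b \<in> carrier_vec n"
  shows "\<exists>p \<in> LinearCombinations.module.span class_ring (module_vec TYPE(real) n) (set vs).
    \<forall>v\<in>set vs. v \<bullet> (b - p) = 0"
  using assms
proof (induction vs arbitrary: b)
  case Nil
  interpret V: vec_space "TYPE(real)" n .
  show ?case using V.span_zero by auto
next
  case (Cons v vs)
  interpret V: vec_space "TYPE(real)" n .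
  have vs: "set vs \<subseteq> carrier_vec n" and v: "v \<in> carrier_vec n" using Cons.prems by auto
  have spc: "w \<in> carrier_vec n" if "w \<in> V.span (set vs)" for w
    using that V.span_is_subset2[OF vs[folded V.carrier_vs_is_self]] by auto
  have mono: "V.span (set vs) \<subseteq> V.span (set (v # vs))" by (rule V.span_is_monotone) auto
  have sp: "w \<bullet> x = 0" if "\<forall>u\<in>set vs. u \<bullet> x = 0" "x \<in> carrier_vec n" "w \<in> V.span (set vs)" for w x
  proof -
    have "x \<in> V.orthogonal_complement (set vs)"
      using that vs by (auto simp: V.orthogonal_complement_def comm_scalar_prod[of x n])
    then have "x \<in> V.orthogonal_complement (V.span (set vs))" by (simp add: vs)
    then show ?thesis using that spc by (auto simp: V.orthogonal_complement_def comm_scalar_prod[of w n])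
  qed
  obtain p1 where p1: "p1 \<in> V.span (set vs)" "\<forall>u\<in>set vs. u \<bullet> (b - p1) = 0"
    using Cons.IH[OF vs Cons.prems(2)] by blast
  obtain pv where pv: "pv \<in> V.span (set vs)" "\<forall>u\<in>set vs. u \<bullet> (v - pv) = 0"
    using Cons.IH[OF vs v] by blast
  note c = spc[OF p1(1)] spc[OF pv(1)] v Cons.prems(2)
  define v' where "v' = v - pv"
  have v'c: "v' \<in> carrier_vec n" using c by (simp add: v'_def)
  have v_eq: "v = v' + pv" using c by (auto simp: v'_def)
  show ?case
  proof (cases "v' = 0\<^sub>v n")
    case True
    then have "v = pv" using v_eq c by simp
    then have "v \<bullet> (b - p1) = 0" using sp[OF p1(2), of v] pv(1) c by simp
    then show ?thesis using p1 mono by (intro bexI[of _ p1]) auto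
  next
    case False
    then have nz: "v' \<bullet> v' \<noteq> 0" using scalar_prod_self_eq_0[OF v'c] by simp
    define \<alpha> where "\<alpha> = (v' \<bullet> (b - p1)) / (v' \<bullet> v')"
    define p where "p = p1 + \<alpha> \<cdot>\<^sub>v v'"
    have pc: "p \<in> carrier_vec n" using c v'c by (simp add: p_def)
    have bp: "b - p = (b - p1) - \<alpha> \<cdot>\<^sub>v v'" using c v'c by (auto simp: p_def)
    have prod: "x \<bullet> (b - p) = x \<bullet> (b - p1) - \<alpha> * (x \<bullet> v')" if "x \<in> carrier_vec n" for x
      unfolding bp using that c v'c by (simp add: scalar_prod_minus_distrib)
    have orth: "\<forall>u\<in>set vs. u \<bullet> (b - p) = 0"
    proof
      fix u assume u: "u \<in> set vs"
      then have "u \<in> carrier_vec n" using vs by blast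
      then show "u \<bullet> (b - p) = 0" using prod[of u] p1(2) pv(2) u by (simp add: v'_def)
    qed
    have "v' \<bullet> (b - p) = 0" using prod[OF v'c] nz by (simp add: \<alpha>_def)
    moreover have "pv \<bullet> (b - p) = 0" using sp[OF orth _ pv(1)] c pc by simp
    ultimately have "v \<bullet> (b - p) = 0"
      unfolding v_eq using c v'c pc by (subst add_scalar_prod_distrib[of _ n]) auto
    moreover have "p \<in> V.span (set (v # vs))"
    proof -
      have vvs: "set (v # vs) \<subseteq> carrier_vec n" using vs v by simp
      have s1: "p1 \<in> V.span (set (v # vs))" "pv \<in> V.span (set (v # vs))" using p1 pv mono by auto
      have s2: "v \<in> V.span (set (v # vs))" using V.in_own_span[of "set (v # vs)"] vvs by auto
      have "v' = v + (- 1) \<cdot>\<^sub>v pv" unfolding v'_def using c by auto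
      then have "v' \<in> V.span (set (v # vs))"
        using V.span_add1[OF _ s2] V.smult_in_span[OF _ s1(2)] vvs by simp
      then show ?thesis unfolding p_def
        using V.span_add1[OF _ s1(1)] V.smult_in_span vvs by simp
    qed
    ultimately show ?thesis using orth by (intro bexI[of _ p]) auto
  qed
qed

text \<open>Existence of least squares solutions: \<open>M *\<^sub>v w\<close> is the orthogonal
  projection of \<open>b\<close> onto the column space.\<close>

lemma normal_equation_solvable:
  fixes M :: "real mat"
  assumes M: "M \<in> carrier_mat n m" and b: "b \<in> carrier_vec n"
  obtains w where "w \<in> carrier_vec m" "transpose_mat M *\<^sub>v (b - M *\<^sub>v w) = 0\<^sub>v m"
proof -
  interpret V: vec_space "TYPE(real)" n .
  have "set (cols M) \<subseteq> carrier_vec n" using cols_dim[of M] M by auto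
  from projection_onto_span[OF this b] obtain p where
    p: "p \<in> V.span (set (cols M))" "\<forall>v\<in>set (cols M). v \<bullet> (b - p) = 0" by blast
  from p(1) have "p \<in> V.col_space M" by (simp add: V.col_space_def)
  then obtain w where w: "w \<in> carrier_vec m" "M *\<^sub>v w = p"
    using V.col_space_eq[OF M] M by auto
  have "col M j \<bullet> (b - p) = 0" if "j < m" for j
    using p(2) that M by (auto simp: cols_def)
  then have "transpose_mat M *\<^sub>v (b - M *\<^sub>v w) = 0\<^sub>v m"
    using M w by (intro eq_vecI) auto
  then show ?thesis using w(1) that by blast
qed

text \<open>Residuals are estimated entry by entry later, hence the sum of absolute values. A crude
  constant suffices, because it multiplies only error terms or shows that a supremum is
  finite.\<close>

lemma vnorm_mult_mat_vec_le:
  assumes P: "P \<in> carrier_mat n m"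
  shows "\<exists>K\<ge>0. \<forall>v\<in>carrier_vec m. vnorm (P *\<^sub>v v) \<le> K * (\<Sum>j<m. \<bar>v $ j\<bar>)"
proof (intro exI conjI ballI)
  define K where "K = (\<Sum>j<m. \<Sum>i<n. \<bar>P $$ (i, j)\<bar>)"
  show "K \<ge> 0" unfolding K_def by (intro sum_nonneg) auto
  fix v :: "real vec" assume v: "v \<in> carrier_vec m"
  have "vnorm (P *\<^sub>v v) \<le> (\<Sum>i<n. \<bar>(P *\<^sub>v v) $ i\<bar>)"
    using L2_set_le_sum_abs[of "\<lambda>i. (P *\<^sub>v v) $ i" "{..<n}"] P by (simp add: vnorm_eq_L2_set)
  also have "\<dots> \<le> (\<Sum>i<n. \<Sum>j<m. \<bar>P $$ (i, j)\<bar> * \<bar>v $ j\<bar>)"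
  proof (rule sum_mono)
    fix i assume "i \<in> {..<n}"
    then have "(P *\<^sub>v v) $ i = (\<Sum>j<m. P $$ (i, j) * v $ j)"
      using P v by (auto simp: scalar_prod_def lessThan_atLeast0)
    also have "\<bar>\<dots>\<bar> \<le> (\<Sum>j<m. \<bar>P $$ (i, j)\<bar> * \<bar>v $ j\<bar>)"
      by (rule order_trans[OF sum_abs]) (simp add: abs_mult)
    finally show "\<bar>(P *\<^sub>v v) $ i\<bar> \<le> (\<Sum>j<m. \<bar>P $$ (i, j)\<bar> * \<bar>v $ j\<bar>)" .
  qed
  also have "\<dots> = (\<Sum>j<m. (\<Sum>i<n. \<bar>P $$ (i, j)\<bar>) * \<bar>v $ j\<bar>)"
    by (subst sum.swap) (simp add: sum_distrib_right)
  also have "\<dots> \<le> (\<Sum>j<m. K * \<bar>v $ j\<bar>)"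
  proof (rule sum_mono)
    fix j assume "j \<in> {..<m}"
    then have "(\<Sum>i<n. \<bar>P $$ (i, j)\<bar>) \<le> K"
      unfolding K_def by (intro member_le_sum[of j "{..<m}"] sum_nonneg) auto
    then show "(\<Sum>i<n. \<bar>P $$ (i, j)\<bar>) * \<bar>v $ j\<bar> \<le> K * \<bar>v $ j\<bar>" by (intro mult_right_mono) auto
  qed
  finally show "vnorm (P *\<^sub>v v) \<le> K * (\<Sum>j<m. \<bar>v $ j\<bar>)" by (simp add: sum_distrib_left)
qed

lemma abs_index_le_vnorm:
  assumes "v \<in> carrier_vec n" "j < n"
  shows "\<bar>v $ j\<bar> \<le> vnorm v"
  using member_le_L2_set[of "{..<n}" j "\<lambda>j. \<bar>v $ j\<bar>"] assms
  by (simp add: vnorm_eq_L2_set L2_set_def)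

section \<open>The operator norm\<close>

lemma bdd_above_mat_norm2:
  "bdd_above ((\<lambda>v. vnorm (M *\<^sub>v v)) ` {v \<in> carrier_vec (dim_col M). v \<bullet> v \<le> 1})"
proof -
  obtain K where K: "K \<ge> 0" "\<And>v. v \<in> carrier_vec (dim_col M) \<Longrightarrow>
      vnorm (M *\<^sub>v v) \<le> K * (\<Sum>j<dim_col M. \<bar>v $ j\<bar>)"
    using vnorm_mult_mat_vec_le[of M "dim_row M" "dim_col M"] by auto
  have "vnorm (M *\<^sub>v v) \<le> K * real (dim_col M)"
    if v: "v \<in> carrier_vec (dim_col M)" "v \<bullet> v \<le> 1" for v
  proof -
    have "vnorm v \<le> 1" using v by (simp add: vnorm_def)
    then have "(\<Sum>j<dim_col M. \<bar>v $ j\<bar>) \<le> (\<Sum>j<dim_col M. 1)"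
      using abs_index_le_vnorm[OF v(1)] by (intro sum_mono) force
    then have "K * (\<Sum>j<dim_col M. \<bar>v $ j\<bar>) \<le> K * real (dim_col M)"
      using K(1) by (intro mult_left_mono) auto
    then show ?thesis using K(2)[OF v(1)] by linarith
  qed
  then show ?thesis by (auto intro!: bdd_aboveI)
qed

lemma mat_norm2_eq:
  "mat_norm2 M = (SUP v\<in>{v \<in> carrier_vec (dim_col M). v \<bullet> v \<le> 1}. vnorm (M *\<^sub>v v))"
  by (simp add: mat_norm2_def vnorm_def)

lemma vnorm_mult_le_mat_norm2:
  assumes M: "M \<in> carrier_mat n m" and v: "v \<in> carrier_vec m"
  shows "vnorm (M *\<^sub>v v) \<le> mat_norm2 M * vnorm v"
proof (cases "v = 0\<^sub>v m")
  case True
  then have "M *\<^sub>v v = 0\<^sub>v n" using M by (intro eq_vecI) auto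
  then show ?thesis using True by simp
next
  case False
  then have "v \<bullet> v > 0" using scalar_prod_self_eq_0[OF v] scalar_prod_self_nonneg[of v] by linarith
  then have pos: "vnorm v > 0" by (simp add: vnorm_def)
  define w where "w = (1 / vnorm v) \<cdot>\<^sub>v v"
  have w: "w \<in> carrier_vec m" using v by (simp add: w_def)
  have "vnorm w = 1" using pos by (simp add: w_def vnorm_smult)
  then have "w \<bullet> w \<le> 1" by (simp add: vnorm_def)
  then have "vnorm (M *\<^sub>v w) \<le> mat_norm2 M"
    unfolding mat_norm2_eq using w M by (intro cSUP_upper bdd_above_mat_norm2) auto
  moreover have "vnorm (M *\<^sub>v w) = vnorm (M *\<^sub>v v) / vnorm v"
    using pos by (simp add: w_def mult_mat_vec[OF M v] vnorm_smult)
  ultimately show ?thesis using pos by (simp add: pos_divide_le_eq)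
qed

lemma mat_norm2_nonneg: "mat_norm2 M \<ge> 0"
proof -
  have "vnorm (M *\<^sub>v 0\<^sub>v (dim_col M)) \<le> mat_norm2 M"
    unfolding mat_norm2_eq by (intro cSUP_upper bdd_above_mat_norm2) auto
  then show ?thesis using vnorm_nonneg order_trans by blast
qed

lemma mat_norm2_approx:
  assumes "c < mat_norm2 M"
  obtains v where "v \<in> carrier_vec (dim_col M)" "vnorm v \<le> 1" "c < vnorm (M *\<^sub>v v)"
proof -
  have "0\<^sub>v (dim_col M) \<in> {v \<in> carrier_vec (dim_col M). v \<bullet> v \<le> (1::real)}" by simp
  then have "{v \<in> carrier_vec (dim_col M). v \<bullet> v \<le> (1::real)} \<noteq> {}" by blast
  then obtain v where "v \<in> carrier_vec (dim_col M)" "v \<bullet> v \<le> 1" "c < vnorm (M *\<^sub>v v)"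
    using assms unfolding mat_norm2_eq by (auto simp: less_cSUP_iff[OF _ bdd_above_mat_norm2])
  then show ?thesis using that[of v] by (simp add: vnorm_def)
qed

lemma mult_mat_vec_neg:
  fixes A :: "real mat"
  shows "A \<in> carrier_mat n m \<Longrightarrow> v \<in> carrier_vec m \<Longrightarrow> A *\<^sub>v (- v) = - (A *\<^sub>v v)"
  by (intro eq_vecI) auto

lemma mult_mat_unit_vec:
  fixes A :: "real mat"
  shows "A \<in> carrier_mat n m \<Longrightarrow> i < m \<Longrightarrow> A *\<^sub>v unit_vec m i = col A i"
  by (intro eq_vecI) auto

lemma append_cols_carrier:
  "A \<in> carrier_mat n m \<Longrightarrow> B \<in> carrier_mat n k \<Longrightarrow> A @\<^sub>c B \<in> carrier_mat n (m + k)"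
  using four_block_carrier_mat[of A n m "0\<^sub>m 0 k" 0 k B "0\<^sub>m 0 m"] by (simp add: append_cols_def)

lemma append_cols_mult_vec:
  assumes A: "A \<in> carrier_mat n m" and B: "B \<in> carrier_mat n k"
    and "a \<in> carrier_vec m" "b \<in> carrier_vec k"
  shows "(A @\<^sub>c B) *\<^sub>v (a @\<^sub>v b) = A *\<^sub>v a + B *\<^sub>v b"
proof -
  have "(A @\<^sub>c B) *\<^sub>v (a @\<^sub>v b) = (A *\<^sub>v a + B *\<^sub>v b) @\<^sub>v (0\<^sub>m 0 m *\<^sub>v a + 0\<^sub>m 0 k *\<^sub>v b)"
    unfolding append_cols_def using assms
    by (subst four_block_mat_mult_vec[of A n m B k "0\<^sub>m 0 (dim_col A)" 0 "0\<^sub>m 0 (dim_col B)"]) auto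
  also have "\<dots> = A *\<^sub>v a + B *\<^sub>v b" using assms by (intro eq_vecI) auto
  finally show ?thesis .
qed

lemma lin_indpt_colsI:
  fixes A :: "real mat"
  assumes A: "A \<in> carrier_mat n m"
    and inj: "\<And>a. a \<in> carrier_vec m \<Longrightarrow> A *\<^sub>v a = 0\<^sub>v n \<Longrightarrow> a = 0\<^sub>v m"
  shows "lin_indpt_cols A"
proof -
  interpret V: vec_space "TYPE(real)" n .
  have dist: "distinct (cols A)"
    unfolding distinct_conv_nth
  proof (intro allI impI)
    fix i j assume ij: "i < length (cols A)" "j < length (cols A)" "i \<noteq> j"
    then have ij': "i < m" "j < m" using A by auto
    show "cols A ! i \<noteq> cols A ! j"
    proof
      assume "cols A ! i = cols A ! j"
      then have eq: "col A i = col A j" using ij by simp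
      have "A *\<^sub>v (unit_vec m i - unit_vec m j) = 0\<^sub>v n"
        using A ij' eq by (simp add: mult_minus_distrib_mat_vec[OF A] mult_mat_unit_vec[OF A])
      then have "unit_vec m i - unit_vec m j = (0\<^sub>v m :: real vec)" by (intro inj) auto
      from arg_cong[OF this, of "\<lambda>v. v $ i"] show False using ij ij' by simp
    qed
  qed
  moreover have "V.lin_indpt (set (cols A))"
  proof
    assume "V.lin_dep (set (cols A))"
    from V.lin_depE[OF A this dist] inj show False by metis
  qed
  ultimately show ?thesis using A by (simp add: lin_indpt_cols_def)
qed

section \<open>Linear algebra of the elimination at the base point\<close>

locale linear_elimination =
  fixes Jx Jy Jz Q Uy Uz :: "real mat" and N nx ny nz q u :: nat
  assumes Jx: "Jx \<in> carrier_mat N nx" and Jy: "Jy \<in> carrier_mat N ny" and Jz: "Jz \<in> carrier_mat N nz"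
    and Q: "Q \<in> carrier_mat N q" and Uy: "Uy \<in> carrier_mat ny u" and Uz: "Uz \<in> carrier_mat nz u"
    and colQ: "vec_space.col_space N Q = vec_module.orthogonal_complement N (vec_space.col_space N Jz)"
    and JU: "Jy * Uy + Jz * Uz = 0\<^sub>m N u"
    and ker: "mat_kernel (Jy @\<^sub>c Jz) = vec_space.col_space (ny + nz) (Uy @\<^sub>r Uz)"
begin

definition A where "A = (transpose_mat Q * Jy) @\<^sub>r transpose_mat Uy"
definition B where "B = (- (transpose_mat Q * Jx)) @\<^sub>r 0\<^sub>m u nx"

lemma A_carrier: "A \<in> carrier_mat (q + u) ny"
  using Q Jy Uy by (auto simp: A_def)

lemma B_carrier: "B \<in> carrier_mat (q + u) nx"
  using Q Jx by (auto simp: B_def)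

lemma col_spaceD: "M \<in> carrier_mat n m \<Longrightarrow> (x \<in> vec_space.col_space n M) = (\<exists>w\<in>carrier_vec m. M *\<^sub>v w = x)"
  for M :: "real mat"
  by (auto simp: vec_space.col_space_eq)

lemma Q_Jz: assumes "w \<in> carrier_vec nz" shows "transpose_mat Q *\<^sub>v (Jz *\<^sub>v w) = 0\<^sub>v q"
proof (rule eq_vecI)
  fix i assume "i < dim_vec (0\<^sub>v q :: real vec)"
  then have i: "i < q" by simp
  have "Q *\<^sub>v unit_vec q i \<in> vec_space.col_space N Q"
    using Q by (subst col_spaceD[OF Q]) auto
  then have "Q *\<^sub>v unit_vec q i \<in> vec_module.orthogonal_complement N (vec_space.col_space N Jz)"
    by (simp add: colQ)
  then have "(Q *\<^sub>v unit_vec q i) \<bullet> (Jz *\<^sub>v w) = 0"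
    using assms bexI[of _ w] by (auto simp: vec_module.orthogonal_complement_def col_spaceD[OF Jz])
  then show "(transpose_mat Q *\<^sub>v (Jz *\<^sub>v w)) $ i = 0\<^sub>v q $ i"
    using i Q Jz by (simp add: mult_mat_unit_vec[OF Q])
qed (use Q in auto)

text \<open>The residual \<open>r\<close> of the least squares problem for \<open>Jz\<close> is
  orthogonal to the span of \<open>Jz\<close>, hence in the span of \<open>Q\<close>. So it is
  orthogonal both to \<open>b\<close> and to \<open>Jz *\<^sub>v w\<close>, whose difference it
  is.\<close>

lemma Q_kernel:
  assumes b: "b \<in> carrier_vec N" and Qb: "transpose_mat Q *\<^sub>v b = 0\<^sub>v q"
  obtains w where "w \<in> carrier_vec nz" "b = Jz *\<^sub>v w"
proof -
  obtain w where w: "w \<in> carrier_vec nz" "transpose_mat Jz *\<^sub>v (b - Jz *\<^sub>v w) = 0\<^sub>v nz"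
    using normal_equation_solvable[OF Jz b] .
  define r where "r = b - Jz *\<^sub>v w"
  have rc: "r \<in> carrier_vec N" using b Jz w by (auto simp: r_def)
  have orth: "r \<bullet> (Jz *\<^sub>v x) = 0" if "x \<in> carrier_vec nz" for x
    using transpose_vec_mult_scalar[OF Jz that rc] w(2) that by (simp add: r_def)
  then have "r \<in> vec_space.col_space N Q"
    unfolding colQ vec_module.orthogonal_complement_def using rc by (auto simp: col_spaceD[OF Jz])
  then obtain s where s: "s \<in> carrier_vec q" "Q *\<^sub>v s = r" by (auto simp: col_spaceD[OF Q])
  have "b \<bullet> r = (transpose_mat Q *\<^sub>v b) \<bullet> s"
    using transpose_vec_mult_scalar[OF Q s(1) b] s(2) by simp
  then have "r \<bullet> b = 0" using s Qb comm_scalar_prod[OF b rc] by simp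
  then have "r \<bullet> r = 0" using orth[OF w(1)] rc b Jz w(1)
    by (subst (2) r_def) (simp add: scalar_prod_minus_distrib[of _ N])
  then have "r = 0\<^sub>v N" using scalar_prod_self_eq_0[OF rc] by simp
  then have "b = Jz *\<^sub>v w" using b Jz w(1) by (auto simp: r_def vec_eq_iff)
  then show ?thesis using w(1) that by blast
qed

lemma JU_vec: assumes s: "s \<in> carrier_vec u" shows "Jy *\<^sub>v (Uy *\<^sub>v s) + Jz *\<^sub>v (Uz *\<^sub>v s) = 0\<^sub>v N"
proof -
  have "(Jy * Uy + Jz * Uz) *\<^sub>v s = 0\<^sub>v N" unfolding JU using s by (intro eq_vecI) auto
  moreover have "(Jy * Uy + Jz * Uz) *\<^sub>v s = (Jy * Uy) *\<^sub>v s + (Jz * Uz) *\<^sub>v s"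
    using Jy Jz Uy Uz s by (intro add_mult_distrib_mat_vec) auto
  ultimately show ?thesis using Jy Jz Uy Uz s by simp
qed

lemma kernel_JyJz:
  assumes a: "a \<in> carrier_vec ny" and b: "b \<in> carrier_vec nz" and 0: "Jy *\<^sub>v a + Jz *\<^sub>v b = 0\<^sub>v N"
  obtains s where "s \<in> carrier_vec u" "a = Uy *\<^sub>v s"
proof -
  have "a @\<^sub>v b \<in> mat_kernel (Jy @\<^sub>c Jz)"
    using 0 a b append_cols_mult_vec[OF Jy Jz a b]
    by (intro mat_kernelI[OF append_cols_carrier[OF Jy Jz]]) auto
  then obtain s where s: "s \<in> carrier_vec u" "(Uy @\<^sub>r Uz) *\<^sub>v s = a @\<^sub>v b"
    unfolding ker by (auto simp: col_spaceD[OF carrier_append_rows[OF Uy Uz]])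
  then have "(Uy *\<^sub>v s) @\<^sub>v (Uz *\<^sub>v s) = a @\<^sub>v b" using mat_mult_append[OF Uy Uz s(1)] by simp
  then have "Uy *\<^sub>v s = a" using iffD1[OF append_vec_eq[of "Uy *\<^sub>v s" ny a]] Uy s(1) a by auto
  then show ?thesis using s(1) that by blast
qed

lemma A_mult:
  assumes a: "a \<in> carrier_vec ny"
  shows "A *\<^sub>v a = (transpose_mat Q *\<^sub>v (Jy *\<^sub>v a)) @\<^sub>v (transpose_mat Uy *\<^sub>v a)"
  unfolding A_def using Q Jy Uy a by (subst mat_mult_append[of _ q ny _ u]) auto

lemma B_mult:
  assumes d: "d \<in> carrier_vec nx"
  shows "B *\<^sub>v d = (- (transpose_mat Q *\<^sub>v (Jx *\<^sub>v d))) @\<^sub>v 0\<^sub>v u"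
proof -
  have "0\<^sub>m u nx *\<^sub>v d = 0\<^sub>v u" using d by (intro eq_vecI) auto
  then show ?thesis
    unfolding B_def using Q Jx d by (subst mat_mult_append[of _ q nx _ u]) auto
qed

text \<open>If \<open>A *\<^sub>v a\<close> is 0, the first block puts \<open>Jy *\<^sub>v a\<close>
  in the span of \<open>Jz\<close> and thereby \<open>a\<close> in the span of \<open>Uy\<close>,
  while the second block makes \<open>a\<close> orthogonal to that span.\<close>

lemma lin_indpt_cols_A: "lin_indpt_cols A"
proof (rule lin_indpt_colsI[OF A_carrier])
  fix a assume a: "a \<in> carrier_vec ny" and "A *\<^sub>v a = 0\<^sub>v (q + u)"
  moreover have "0\<^sub>v (q + u) = 0\<^sub>v q @\<^sub>v (0\<^sub>v u :: real vec)" by (intro eq_vecI) auto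
  ultimately have "(transpose_mat Q *\<^sub>v (Jy *\<^sub>v a)) @\<^sub>v (transpose_mat Uy *\<^sub>v a) = 0\<^sub>v q @\<^sub>v 0\<^sub>v u"
    using A_mult[OF a] by simp
  then have 1: "transpose_mat Q *\<^sub>v (Jy *\<^sub>v a) = 0\<^sub>v q" and 2: "transpose_mat Uy *\<^sub>v a = 0\<^sub>v u"
    using append_vec_eq[of "transpose_mat Q *\<^sub>v (Jy *\<^sub>v a)" q "0\<^sub>v q"] Q Jy a by auto
  obtain w where w: "w \<in> carrier_vec nz" "Jy *\<^sub>v a = Jz *\<^sub>v w"
    using Q_kernel[OF _ 1] Jy a by auto
  have "Jy *\<^sub>v a + Jz *\<^sub>v (- w) = 0\<^sub>v N"
    using w Jz by (simp add: mult_mat_vec_neg)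
  then obtain s where s: "s \<in> carrier_vec u" "a = Uy *\<^sub>v s"
    using kernel_JyJz[OF a, of "- w"] w by auto
  have "a \<bullet> a = (transpose_mat Uy *\<^sub>v a) \<bullet> s"
    using transpose_vec_mult_scalar[OF Uy s(1) a] s(2) by simp
  then have "a \<bullet> a = 0" using 2 s(1) by simp
  then show "a = 0\<^sub>v ny" using scalar_prod_self_eq_0[OF a] by simp
qed

text \<open>Subtracting the orthogonal projection onto the span of \<open>Uy\<close> does not
  lengthen \<open>a\<close> and annihilates the second block of \<open>A\<close>. The first block is
  not affected, because \<open>Jy\<close> maps the span of \<open>Uy\<close> into that of
  \<open>Jz\<close>, on which the transpose of \<open>Q\<close> vanishes.\<close>

lemma Uy_projection:
  assumes a: "a \<in> carrier_vec ny"
  obtains p s where "p \<in> carrier_vec ny" "s \<in> carrier_vec u" "p = a - Uy *\<^sub>v s"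
    "A *\<^sub>v p = (transpose_mat Q *\<^sub>v (Jy *\<^sub>v a)) @\<^sub>v 0\<^sub>v u" "vnorm p \<le> vnorm a"
proof -
  obtain s where s: "s \<in> carrier_vec u" "transpose_mat Uy *\<^sub>v (a - Uy *\<^sub>v s) = 0\<^sub>v u"
    using normal_equation_solvable[OF Uy a] .
  define p where "p = a - Uy *\<^sub>v s"
  have Us: "Uy *\<^sub>v s \<in> carrier_vec ny" and Uzs: "Uz *\<^sub>v s \<in> carrier_vec nz" using Uy Uz s by auto
  have pc: "p \<in> carrier_vec ny" using a Us by (simp add: p_def)
  have "Jy *\<^sub>v (Uy *\<^sub>v s) = Jz *\<^sub>v (- (Uz *\<^sub>v s))"
  proof -
    have "Jy *\<^sub>v (Uy *\<^sub>v s) = - (Jz *\<^sub>v (Uz *\<^sub>v s))"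
    proof (rule eq_vecI)
      fix i assume "i < dim_vec (- (Jz *\<^sub>v (Uz *\<^sub>v s)))"
      then show "(Jy *\<^sub>v (Uy *\<^sub>v s)) $ i = (- (Jz *\<^sub>v (Uz *\<^sub>v s))) $ i"
        using arg_cong[OF JU_vec[OF s(1)], of "\<lambda>v. v $ i"] Jy Jz
        by (simp del: index_mult_mat_vec)
    qed (use Jy Jz in auto)
    then show ?thesis using Jz Uzs by (simp add: mult_mat_vec_neg)
  qed
  then have "transpose_mat Q *\<^sub>v (Jy *\<^sub>v (Uy *\<^sub>v s)) = 0\<^sub>v q"
    using Q_Jz[of "- (Uz *\<^sub>v s)"] Uzs by simp
  then have "transpose_mat Q *\<^sub>v (Jy *\<^sub>v p) = transpose_mat Q *\<^sub>v (Jy *\<^sub>v a)"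
    unfolding p_def using Q Jy a Us
    by (simp add: mult_minus_distrib_mat_vec[OF Jy] mult_minus_distrib_mat_vec[of _ q N])
  then have Ap: "A *\<^sub>v p = (transpose_mat Q *\<^sub>v (Jy *\<^sub>v a)) @\<^sub>v 0\<^sub>v u"
    using A_mult[OF pc] s(2) by (simp add: p_def)
  have orth: "p \<bullet> (Uy *\<^sub>v s) = 0"
    using transpose_vec_mult_scalar[OF Uy s(1) pc] s by (simp add: p_def)
  have "a = p + Uy *\<^sub>v s"
    using a Us Uy by (intro eq_vecI) (auto simp: p_def simp del: index_mult_mat_vec)
  then have "a \<bullet> a = p \<bullet> p + (Uy *\<^sub>v s) \<bullet> (Uy *\<^sub>v s)"
    using pc Us orth comm_scalar_prod[OF pc Us]
    by (simp add: add_scalar_prod_distrib[of _ ny] scalar_prod_add_distrib[of _ ny])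
  then have "vnorm p \<le> vnorm a" using scalar_prod_self_nonneg[of "Uy *\<^sub>v s"] by (simp add: vnorm_def)
  then show ?thesis using that pc s(1) Ap p_def by blast
qed

text \<open>The given solution shows that \<open>B *\<^sub>v d\<close> lies in the range of
  \<open>A\<close>: it is the image of the part \<open>p\<close> of \<open>a\<close> orthogonal to
  the span of \<open>Uy\<close>. Hence \<open>(A' * B) *\<^sub>v d\<close> is \<open>p\<close>,
  whichever left inverse \<open>A'\<close> is, and \<open>p\<close> solves the equation after a
  change of the latent part.\<close>

lemma left_inverse_solves:
  assumes A': "A' \<in> carrier_mat ny (q + u)" "A' * A = 1\<^sub>m ny"
    and d: "d \<in> carrier_vec nx" and a: "a \<in> carrier_vec ny" and b: "b \<in> carrier_vec nz"
    and 0: "Jx *\<^sub>v d + Jy *\<^sub>v a + Jz *\<^sub>v b = 0\<^sub>v N"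
  shows "\<exists>b\<in>carrier_vec nz. Jx *\<^sub>v d + Jy *\<^sub>v ((A' * B) *\<^sub>v d) + Jz *\<^sub>v b = 0\<^sub>v N"
proof -
  obtain p s where p: "p \<in> carrier_vec ny" "s \<in> carrier_vec u" "p = a - Uy *\<^sub>v s"
    "A *\<^sub>v p = (transpose_mat Q *\<^sub>v (Jy *\<^sub>v a)) @\<^sub>v 0\<^sub>v u"
    using Uy_projection[OF a] by metis
  have c: "Jx *\<^sub>v d \<in> carrier_vec N" "Jy *\<^sub>v a \<in> carrier_vec N" "Jz *\<^sub>v b \<in> carrier_vec N"
    "Uy *\<^sub>v s \<in> carrier_vec ny" "Uz *\<^sub>v s \<in> carrier_vec nz"
    using Jx Jy Jz Uy Uz d a b p by auto
  have QT: "transpose_mat Q \<in> carrier_mat q N" using Q by simp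
  have Q0: "transpose_mat Q *\<^sub>v (Jx *\<^sub>v d) + transpose_mat Q *\<^sub>v (Jy *\<^sub>v a) = 0\<^sub>v q"
  proof -
    have "transpose_mat Q *\<^sub>v (Jx *\<^sub>v d + Jy *\<^sub>v a + Jz *\<^sub>v b) = 0\<^sub>v q"
      unfolding 0 using QT by (intro eq_vecI) auto
    then show ?thesis using QT c Q_Jz[OF b]
      by (simp add: mult_add_distrib_mat_vec[OF QT])
  qed
  have "transpose_mat Q *\<^sub>v (Jy *\<^sub>v a) = - (transpose_mat Q *\<^sub>v (Jx *\<^sub>v d))"
  proof (rule eq_vecI)
    fix i assume "i < dim_vec (- (transpose_mat Q *\<^sub>v (Jx *\<^sub>v d)))"
    then show "(transpose_mat Q *\<^sub>v (Jy *\<^sub>v a)) $ i = (- (transpose_mat Q *\<^sub>v (Jx *\<^sub>v d))) $ i"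
      using arg_cong[OF Q0, of "\<lambda>v. v $ i"] QT by (simp del: index_mult_mat_vec)
  qed (use QT in auto)
  then have "A *\<^sub>v p = B *\<^sub>v d" using p(4) B_mult[OF d] by simp
  then have "(A' * B) *\<^sub>v d = A' *\<^sub>v (A *\<^sub>v p)" using A' B_carrier d by simp
  also have "\<dots> = p"
    using assoc_mult_mat_vec[OF A'(1) A_carrier p(1)] A'(2) p(1) by simp
  finally have L: "(A' * B) *\<^sub>v d = p" .
  have "Jx *\<^sub>v d + Jy *\<^sub>v p + Jz *\<^sub>v (b - Uz *\<^sub>v s) = 0\<^sub>v N"
  proof (rule eq_vecI)
    fix i assume "i < dim_vec (0\<^sub>v N :: real vec)"
    then have i: "i < N" by simp
    show "(Jx *\<^sub>v d + Jy *\<^sub>v p + Jz *\<^sub>v (b - Uz *\<^sub>v s)) $ i = 0\<^sub>v N $ i"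
      using arg_cong[OF 0, of "\<lambda>v. v $ i"] arg_cong[OF JU_vec[OF p(2)], of "\<lambda>v. v $ i"] i Jx Jy Jz
      by (simp del: index_mult_mat_vec add: p(3) mult_minus_distrib_mat_vec[OF Jy a c(4)] mult_minus_distrib_mat_vec[OF Jz b c(5)])
  qed (use Jz in auto)
  then show ?thesis unfolding L using b c by (intro bexI[of _ "b - Uz *\<^sub>v s"]) auto
qed

text \<open>Minimality of the norm in quantitative form. If \<open>a\<close> solves the equation
  only up to a residual \<open>r\<close>, then \<open>p\<close> differs from
  \<open>(A' * B) *\<^sub>v d\<close> by \<open>P *\<^sub>v r\<close>. The constant \<open>K\<close>
  depends on the choice of \<open>A'\<close> but multiplies only the residual.\<close>

lemma left_inverse_lower_bound:
  assumes A': "A' \<in> carrier_mat ny (q + u)" "A' * A = 1\<^sub>m ny"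
  shows "\<exists>K\<ge>0. \<forall>d\<in>carrier_vec nx. \<forall>a\<in>carrier_vec ny. \<forall>b\<in>carrier_vec nz.
    vnorm ((A' * B) *\<^sub>v d) \<le> vnorm a + K * (\<Sum>i<N. \<bar>(Jx *\<^sub>v d + Jy *\<^sub>v a + Jz *\<^sub>v b) $ i\<bar>)"
proof -
  have QT: "transpose_mat Q \<in> carrier_mat q N" using Q by simp
  define P where "P = A' * (transpose_mat Q @\<^sub>r 0\<^sub>m u N)"
  have P: "P \<in> carrier_mat ny N" unfolding P_def using A' QT by auto
  obtain K where K: "K \<ge> 0" "\<And>v. v \<in> carrier_vec N \<Longrightarrow> vnorm (P *\<^sub>v v) \<le> K * (\<Sum>i<N. \<bar>v $ i\<bar>)"
    using vnorm_mult_mat_vec_le[OF P] by blast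
  have "vnorm ((A' * B) *\<^sub>v d) \<le> vnorm a + K * (\<Sum>i<N. \<bar>(Jx *\<^sub>v d + Jy *\<^sub>v a + Jz *\<^sub>v b) $ i\<bar>)"
    if d: "d \<in> carrier_vec nx" and a: "a \<in> carrier_vec ny" and b: "b \<in> carrier_vec nz" for d a b
  proof -
    obtain p s where p: "p \<in> carrier_vec ny" "s \<in> carrier_vec u" "p = a - Uy *\<^sub>v s"
      "A *\<^sub>v p = (transpose_mat Q *\<^sub>v (Jy *\<^sub>v a)) @\<^sub>v 0\<^sub>v u" "vnorm p \<le> vnorm a"
      using Uy_projection[OF a] by metis
    define r where "r = Jx *\<^sub>v d + Jy *\<^sub>v a + Jz *\<^sub>v b"
    have c: "Jx *\<^sub>v d \<in> carrier_vec N" "Jy *\<^sub>v a \<in> carrier_vec N" "Jz *\<^sub>v b \<in> carrier_vec N"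
      using Jx Jy Jz d a b by auto
    have rc: "r \<in> carrier_vec N" using c by (simp add: r_def)
    have z: "0\<^sub>m u N *\<^sub>v r = 0\<^sub>v u" using rc by (intro eq_vecI) auto
    have Qr: "transpose_mat Q *\<^sub>v r = transpose_mat Q *\<^sub>v (Jx *\<^sub>v d) + transpose_mat Q *\<^sub>v (Jy *\<^sub>v a)"
      unfolding r_def using QT c Q_Jz[OF b] by (simp add: mult_add_distrib_mat_vec[OF QT])
    have "A *\<^sub>v p = B *\<^sub>v d + ((transpose_mat Q *\<^sub>v r) @\<^sub>v 0\<^sub>v u)"
      unfolding p(4) B_mult[OF d] Qr using QT by (intro eq_vecI) auto
    also have "(transpose_mat Q *\<^sub>v r) @\<^sub>v 0\<^sub>v u = (transpose_mat Q @\<^sub>r 0\<^sub>m u N) *\<^sub>v r"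
      using mat_mult_append[OF QT _ rc, of "0\<^sub>m u N" u] z by simp
    finally have Ap: "A *\<^sub>v p = B *\<^sub>v d + (transpose_mat Q @\<^sub>r 0\<^sub>m u N) *\<^sub>v r" .
    have QN: "transpose_mat Q @\<^sub>r 0\<^sub>m u N \<in> carrier_mat (q + u) N" using QT by auto
    have "p = A' *\<^sub>v (A *\<^sub>v p)"
      using assoc_mult_mat_vec[OF A'(1) A_carrier p(1)] A'(2) p(1) by simp
    also have "\<dots> = A' *\<^sub>v (B *\<^sub>v d) + A' *\<^sub>v ((transpose_mat Q @\<^sub>r 0\<^sub>m u N) *\<^sub>v r)"
      unfolding Ap using B_carrier d QN rc by (intro mult_add_distrib_mat_vec[OF A'(1)]) auto
    also have "\<dots> = (A' * B) *\<^sub>v d + P *\<^sub>v r"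
      unfolding P_def using assoc_mult_mat_vec[OF A'(1) B_carrier d] assoc_mult_mat_vec[OF A'(1) QN rc] by simp
    finally have pe: "p = (A' * B) *\<^sub>v d + P *\<^sub>v r" .
    have Lc: "(A' * B) *\<^sub>v d \<in> carrier_vec ny" "P *\<^sub>v r \<in> carrier_vec ny"
      using A' B_carrier d P rc by auto
    have "(A' * B) *\<^sub>v d = p + (- 1) \<cdot>\<^sub>v (P *\<^sub>v r)" unfolding pe using Lc P A' by (intro eq_vecI) auto
    then have "vnorm ((A' * B) *\<^sub>v d) \<le> vnorm p + vnorm ((- 1) \<cdot>\<^sub>v (P *\<^sub>v r))"
      using vnorm_triangle[of p "(- 1) \<cdot>\<^sub>v (P *\<^sub>v r)"] p(1) P by simp
    also have "\<dots> \<le> vnorm a + K * (\<Sum>i<N. \<bar>r $ i\<bar>)"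
      unfolding vnorm_smult using p(5) K(2)[OF rc] by simp
    finally show ?thesis by (simp add: r_def)
  qed
  then show ?thesis using K(1) by blast
qed

end

section \<open>Constant-rank elimination in coordinates\<close>

definition prod_basis :: "'a::real_vector list \<Rightarrow> 'b::real_vector list \<Rightarrow> ('a \<times> 'b) list" where
  "prod_basis E E' = map (\<lambda>e. (e, 0)) E @ map (\<lambda>e. (0, e)) E'"

lemma ordered_basis_prod_basis:
  assumes E: "ordered_basis E" and E': "ordered_basis E'"
  shows "ordered_basis (prod_basis E E')"
proof -
  have n0: "0 \<notin> set E" "0 \<notin> set E'"
    using E E' dependent_zero unfolding ordered_basis_def by blast+
  have set_eq: "set (prod_basis E E') = set E \<times> {0} \<union> {0} \<times> set E'"
    by (auto simp: prod_basis_def)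
  have "distinct (prod_basis E E')"
    using E E' n0 unfolding ordered_basis_def prod_basis_def by (auto simp: distinct_map inj_on_def)
  moreover have "span (set (prod_basis E E')) = UNIV"
    unfolding set_eq using E E' by (intro span_product_UNIV) (auto simp: ordered_basis_def)
  moreover have "independent (set (prod_basis E E'))"
    unfolding dependent_finite[OF finite_set]
  proof
    assume "\<exists>a. (\<exists>v\<in>set (prod_basis E E'). a v \<noteq> 0) \<and> (\<Sum>v\<in>set (prod_basis E E'). a v *\<^sub>R v) = 0"
    then obtain a v where a: "v \<in> set (prod_basis E E')" "a v \<noteq> 0"
      "(\<Sum>v\<in>set (prod_basis E E'). a v *\<^sub>R v) = 0" by blast
    have "(\<Sum>v\<in>set (prod_basis E E'). a v *\<^sub>R v)
        = (\<Sum>v\<in>set E \<times> {0}. a v *\<^sub>R v) + (\<Sum>v\<in>{0} \<times> set E'. a v *\<^sub>R v)"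
      unfolding set_eq using n0 by (intro sum.union_disjoint) auto
    also have "(\<Sum>v\<in>set E \<times> {0}. a v *\<^sub>R v) = (\<Sum>e\<in>set E. a (e, 0) *\<^sub>R (e, 0::'b))"
      by (rule sum.reindex_bij_witness[of _ "\<lambda>e. (e, 0)" fst]) auto
    also have "(\<Sum>v\<in>{0} \<times> set E'. a v *\<^sub>R v) = (\<Sum>e\<in>set E'. a (0, e) *\<^sub>R (0::'a, e))"
      by (rule sum.reindex_bij_witness[of _ "\<lambda>e. (0, e)" snd]) auto
    finally have s: "(\<Sum>e\<in>set E. a (e, 0) *\<^sub>R (e, 0::'b)) + (\<Sum>e\<in>set E'. a (0, e) *\<^sub>R (0::'a, e)) = 0"
      using a(3) by simp
    have "(\<Sum>e\<in>set E. a (e, 0) *\<^sub>R e) = 0" "(\<Sum>e\<in>set E'. a (0, e) *\<^sub>R e) = 0"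
      using arg_cong[OF s, of fst] arg_cong[OF s, of snd] by (simp_all add: fst_sum snd_sum)
    then have "\<forall>e\<in>set E. a (e, 0) = 0" "\<forall>e\<in>set E'. a (0, e) = 0"
      using independentD[of "set E" "set E" "\<lambda>e. a (e, 0)"] independentD[of "set E'" "set E'" "\<lambda>e. a (0, e)"]
        E E' by (auto simp: ordered_basis_def)
    then show False using a(1,2) unfolding set_eq by auto
  qed
  ultimately show ?thesis by (simp add: ordered_basis_def)
qed

lemma dim_injective_image:
  fixes h :: "'a::real_vector \<Rightarrow> 'b::real_vector"
  assumes h: "linear h" "inj h" and T: "subspace T"
  shows "dim (h ` T) = dim T"
proof -
  obtain B where B: "B \<subseteq> T" "independent B" "T \<subseteq> span B" "card B = dim T"
    using basis_exists by blast
  have "span B = T" using B(1,3) T by (metis span_minimal subset_antisym)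
  then have "span (h ` B) = span (h ` T)"
    using linear_span_image[OF h(1)] by (metis span_span)
  moreover have "independent (h ` B)"
    using linear_independent_injective_image[OF h(1) B(2)] inj_on_subset[OF h(2)] by blast
  ultimately have "dim (h ` T) = card (h ` B)" by (rule dim_eq_card)
  also have "\<dots> = dim T" using card_image[OF inj_on_subset[OF h(2)]] B(4) by force
  finally show ?thesis .
qed

lemma differentiable_locally_lipschitz:
  fixes f :: "'a::real_normed_vector \<Rightarrow> real"
  assumes "(f has_derivative D) (at a)"
  shows "\<exists>r>0. \<exists>K\<ge>0. \<forall>x\<in>ball a r. \<bar>f x - f a\<bar> \<le> K * norm (x - a)"
proof -
  obtain K where K: "K \<ge> 0" "\<And>v. norm (D v) \<le> norm v * K"
    using bounded_linear.nonneg_bounded[OF has_derivative_bounded_linear[OF assms]] by blast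
  obtain d where d: "d > 0" "\<And>y. norm (y - a) < d \<Longrightarrow> norm (f y - f a - D (y - a)) \<le> 1 * norm (y - a)"
    using conjunct2[OF assms[unfolded has_derivative_at_alt], rule_format, of 1] by auto
  have "\<bar>f x - f a\<bar> \<le> (K + 1) * norm (x - a)" if "x \<in> ball a d" for x
  proof -
    have "norm (x - a) < d" using that by (simp add: dist_norm norm_minus_commute)
    then have "\<bar>f x - f a - D (x - a)\<bar> \<le> norm (x - a)" using d(2) by simp
    then show ?thesis using K(2)[of "x - a"] by (simp add: algebra_simps)
  qed
  then show ?thesis using d(1) K(1) by (intro exI[of _ d] conjI exI[of _ "K + 1"]) auto
qed

locale constant_rank_elimination =
  fixes f :: "nat \<Rightarrow> 'x::real_inner \<times> 'y::real_inner \<times> 'z::real_inner \<Rightarrow> real"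
    and D :: "nat \<Rightarrow> 'x \<times> 'y \<times> 'z \<Rightarrow> 'x \<times> 'y \<times> 'z \<Rightarrow> real"
    and N r k :: nat and S :: "('x \<times> 'y \<times> 'z) set" and x0 :: 'x and y0 :: 'y and z0 :: 'z
    and Ex :: "'x list" and Ey :: "'y list" and Ez :: "'z list"
  assumes bases: "ordered_basis Ex" "ordered_basis Ey" "ordered_basis Ez"
    and S: "open S" "(x0, y0, z0) \<in> S"
    and deriv: "i < N \<Longrightarrow> q \<in> S \<Longrightarrow> (f i has_derivative D i q) (at q)"
    and cont: "i < N \<Longrightarrow> continuous_on S (\<lambda>q. D i q v)"
    and rank_xyz: "q \<in> S \<Longrightarrow> vec_space.rank N
      (functional_matrix N (prod_basis Ex (prod_basis Ey Ez)) (\<lambda>i. D i q)) = r"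
    and rank_yz: "vec_space.rank N
      (functional_matrix N (prod_basis Ey Ez) (\<lambda>i w. D i (x0, y0, z0) (0, w))) = r"
    and rank_z: "q \<in> S \<Longrightarrow> vec_space.rank N (functional_matrix N Ez (\<lambda>i w. D i q (0, 0, w))) = k"
begin

abbreviation "q0 \<equiv> (x0, y0, z0)"

lemma linear_D: "i < N \<Longrightarrow> q \<in> S \<Longrightarrow> linear (D i q)"
  using deriv has_derivative_linear by blast

lemma finite_span: "finite (set (prod_basis Ex (prod_basis Ey Ez)))"
    "span (set (prod_basis Ex (prod_basis Ey Ez))) = UNIV"
  using ordered_basis_finite_span[OF ordered_basis_prod_basis[OF bases(1) ordered_basis_prod_basis[OF bases(2,3)]]]
  by auto

lemma linear_D_z: "i < N \<Longrightarrow> q \<in> S \<Longrightarrow> linear (\<lambda>w. D i q (0, 0, w))"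
  using linear_compose[of "\<lambda>w. (0, 0, w)" "D i q"] linear_D
  by (simp add: o_def linear_iff)

lemma linear_D_yz: "i < N \<Longrightarrow> q \<in> S \<Longrightarrow> linear (\<lambda>w. D i q (0, w))"
  using linear_compose[of "\<lambda>w. (0, w)" "D i q"] linear_D
  by (simp add: o_def linear_iff)

lemma sum_locally_lipschitz:
  obtains \<rho> K where "\<rho> > 0" "K \<ge> 0"
    "\<And>q. q \<in> ball q0 \<rho> \<Longrightarrow> (\<Sum>i<N. \<bar>f i q - f i q0\<bar>) \<le> K * norm (q - q0)"
proof -
  have "\<exists>\<rho>>0. \<exists>K\<ge>0. \<forall>q\<in>ball q0 \<rho>. (\<Sum>i<M. \<bar>f i q - f i q0\<bar>) \<le> K * norm (q - q0)" if "M \<le> N" for M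
    using that
  proof (induction M)
    case 0
    show ?case by (intro exI[of _ 1] conjI exI[of _ 0]) auto
  next
    case (Suc M)
    then have "M \<le> N" by simp
    from Suc.IH[OF this] obtain \<rho> K where 1: "\<rho> > 0" "K \<ge> 0"
      "\<And>q. q \<in> ball q0 \<rho> \<Longrightarrow> (\<Sum>i<M. \<bar>f i q - f i q0\<bar>) \<le> K * norm (q - q0)" by blast
    have "M < N" using Suc.prems by simp
    from differentiable_locally_lipschitz[OF deriv[OF this S(2)]]
    obtain r' K' where 2: "r' > 0" "K' \<ge> 0"
      "\<And>q. q \<in> ball q0 r' \<Longrightarrow> \<bar>f M q - f M q0\<bar> \<le> K' * norm (q - q0)" by blast
    show ?case using 1(1,2) 2(1,2) add_mono[OF 1(3) 2(3)]
      by (intro exI[of _ "min \<rho> r'"] conjI exI[of _ "K + K'"]) (auto simp: algebra_simps)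
  qed
  then show ?thesis using that by blast
qed

text \<open>Moves the latent variable along the fibre back to \<open>z0\<close>; this makes the solutions near \<open>y0\<close>
  independent of the neighbourhood of \<open>z0\<close> that the latent variable is confined to.\<close>

theorem latent_near_z0:
  obtains \<rho> C where "\<rho> > 0" "C \<ge> 0" "ball q0 \<rho> \<subseteq> S"
    "\<And>x y z. (x, y, z) \<in> ball q0 \<rho> \<Longrightarrow> (\<And>i. i < N \<Longrightarrow> f i (x, y, z) = f i q0) \<Longrightarrow>
      \<exists>\<zeta>. norm (\<zeta> - z0) \<le> C * norm ((x, y) - (x0, y0)) \<and> (\<forall>i<N. f i (x, y, \<zeta>) = f i q0)"
proof -
  obtain T' where T': "subspace T'"
    "dim T' = vec_space.rank N (functional_matrix N Ez (\<lambda>i w. D i q0 (0, 0, w)))"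
    "\<And>t. t \<in> T' \<Longrightarrow> (\<And>i. i < N \<Longrightarrow> D i q0 (0, 0, t) = 0) \<Longrightarrow> t = 0"
    using rank_functional_matrix_complement[of N "\<lambda>i w. D i q0 (0, 0, w)" Ez, OF linear_D_z[OF _ S(2)] bases(3)]
    by blast
  define V where "V = range (\<lambda>w::'z. (0::'x, 0::'y, w))"
  define T where "T = (\<lambda>w. (0::'x, 0::'y, w)) ` T'"
  have lin: "linear (\<lambda>w::'z. (0::'x, 0::'y, w))" by (auto intro: linearI)
  interpret constant_rank_family f D N S T V "set (prod_basis Ex (prod_basis Ey Ez))" q0
  proof
    show "subspace T" unfolding T_def by (rule linear_subspace_image[OF lin T'(1)])
    show "subspace V" unfolding V_def by (rule linear_subspace_image[OF lin subspace_UNIV])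
    show "T \<subseteq> V" by (auto simp: T_def V_def)
    fix t assume "t \<in> T" "\<And>i. i < N \<Longrightarrow> D i q0 t = 0"
    then show "t = 0" using T'(3) by (auto simp: T_def zero_prod_def)
  next
    fix q v assume q: "q \<in> S" and inj: "\<And>t. t \<in> T \<Longrightarrow> (\<And>i. i < N \<Longrightarrow> D i q t = 0) \<Longrightarrow> t = 0"
      and v: "v \<in> V"
    obtain w where w: "v = (0, 0, w)" using v by (auto simp: V_def)
    \<comment> \<open>Constancy of the rank \<open>k\<close> carries the dimension of
      \<open>T'\<close> from \<open>q0\<close> over to \<open>q\<close>.\<close>
    have dim: "dim T' = vec_space.rank N (functional_matrix N Ez (\<lambda>i w. D i q (0, 0, w)))"
      using T'(2) rank_z S(2) q by simp
    have "t = 0" if "t \<in> T'" "\<And>i. i < N \<Longrightarrow> D i q (0, 0, t) = 0" for t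
      using inj[of "(0, 0, t)"] that by (auto simp: T_def zero_prod_def)
    then obtain t where "t \<in> T'" "\<forall>i<N. D i q (0, 0, w) = D i q (0, 0, t)"
      using rank_functional_matrix_covers[of N "\<lambda>i w. D i q (0, 0, w)" Ez T' w,
          OF linear_D_z[OF _ q] bases(3) T'(1) dim] by blast
    then show "\<exists>t\<in>T. \<forall>i<N. D i q v = D i q t" by (auto simp: T_def w)
  next
    show "finite (set (prod_basis Ex (prod_basis Ey Ez)))"
      "span (set (prod_basis Ex (prod_basis Ey Ez))) = UNIV" by (rule finite_span)+
    show "open S" "q0 \<in> S" by (rule S)+
    show "(f i has_derivative D i q) (at q)" if "i < N" "q \<in> S" for i q by (rule deriv[OF that])
    show "continuous_on S (\<lambda>q. D i q v)" if "i < N" for i v by (rule cont[OF that])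
  qed
  obtain \<sigma> C \<tau> where \<tau>: "\<sigma> > 0" "C \<ge> 0"
    "\<And>q. q \<in> ball q0 \<sigma> \<Longrightarrow> \<tau> q \<in> T \<and> norm (\<tau> q) \<le> C * (\<Sum>i<N. \<bar>f i q - f i q0\<bar>)"
    "\<And>q v i. q \<in> ball q0 \<sigma> \<Longrightarrow> q + v \<in> ball q0 \<sigma> \<Longrightarrow> v \<in> V \<Longrightarrow> i < N \<Longrightarrow>
       f i (q + v + \<tau> (q + v)) = f i (q + \<tau> q)"
    using retraction by blast
  obtain \<rho> K where K: "\<rho> > 0" "K \<ge> 0"
    "\<And>q. q \<in> ball q0 \<rho> \<Longrightarrow> (\<Sum>i<N. \<bar>f i q - f i q0\<bar>) \<le> K * norm (q - q0)"
    using sum_locally_lipschitz by blast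
  obtain \<rho>' where \<rho>': "\<rho>' > 0" "ball q0 \<rho>' \<subseteq> S" using S open_contains_ball by blast
  define \<rho>'' where "\<rho>'' = min \<sigma> (min \<rho> \<rho>')"
  show ?thesis
  proof (rule that[of \<rho>'' "C * K"])
    show "\<rho>'' > 0" "C * K \<ge> 0" "ball q0 \<rho>'' \<subseteq> S" using \<tau> K \<rho>' by (auto simp: \<rho>''_def)
    fix x y z assume q: "(x, y, z) \<in> ball q0 \<rho>''" and sol: "\<And>i. i < N \<Longrightarrow> f i (x, y, z) = f i q0"
    have n: "norm ((x, y, z0) - q0) = norm ((x, y) - (x0, y0))" by (simp add: norm_Pair)
    have "norm ((x, y) - (x0, y0)) \<le> norm ((x, y, z) - q0)"
      by (simp add: norm_Pair)
    then have q': "(x, y, z0) \<in> ball q0 \<rho>''"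
      using q n unfolding mem_ball dist_norm norm_minus_commute[of q0] by linarith
    have b: "(x, y, z) \<in> ball q0 \<sigma>" "(x, y, z0) \<in> ball q0 \<sigma>" "(x, y, z0) \<in> ball q0 \<rho>"
      using q q' by (auto simp: \<rho>''_def)
    \<comment> \<open>Both points lie on one latent fibre, so \<open>f\<close> has the same values
      at their retractions. The point \<open>(x, y, z)\<close> is not moved, since it solves the
      equations already. The point \<open>(x, y, z0)\<close> is moved by at most a multiple of its
      distance to \<open>q0\<close>, which does not involve \<open>z\<close>.\<close>
    have e: "(x, y, z0) = (x, y, z) + (0, 0, z0 - z)" by simp
    have "norm (\<tau> (x, y, z)) \<le> C * (\<Sum>i<N. \<bar>f i (x, y, z) - f i q0\<bar>)" using \<tau>(3)[OF b(1)] by blast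
    then have \<tau>0: "\<tau> (x, y, z) = 0" using sol by simp
    obtain t where t: "\<tau> (x, y, z0) = (0, 0, t)" using \<tau>(3)[OF b(2)] by (auto simp: T_def)
    have "f i (x, y, z0 + t) = f i q0" if i: "i < N" for i
    proof -
      have "f i ((x, y, z) + (0, 0, z0 - z) + \<tau> ((x, y, z) + (0, 0, z0 - z))) = f i ((x, y, z) + \<tau> (x, y, z))"
        using b i unfolding e by (intro \<tau>(4)) (auto simp: V_def)
      then show ?thesis unfolding e[symmetric] t \<tau>0 using sol[OF i] by simp
    qed
    moreover have "norm t \<le> C * K * norm ((x, y) - (x0, y0))"
    proof -
      have "norm t = norm (\<tau> (x, y, z0))" by (simp add: t norm_Pair)
      also have "\<dots> \<le> C * (\<Sum>i<N. \<bar>f i (x, y, z0) - f i q0\<bar>)" using \<tau>(3)[OF b(2)] by blast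
      also have "\<dots> \<le> C * (K * norm ((x, y, z0) - q0))" by (intro mult_left_mono K b \<tau>)
      finally show ?thesis unfolding n by simp
    qed
    ultimately show "\<exists>\<zeta>. norm (\<zeta> - z0) \<le> C * K * norm ((x, y) - (x0, y0)) \<and> (\<forall>i<N. f i (x, y, \<zeta>) = f i q0)"
      by (intro exI[of _ "z0 + t"]) auto
  qed
qed

text \<open>Here the equality of the two ranks enters: directions that leave the input fixed already
  provide a space \<open>T\<close> of the dimension \<open>r\<close> that the total derivative
  requires.\<close>

lemma yz_complement:
  "\<exists>T. subspace T \<and> dim T = r \<and> T \<subseteq> range (Pair 0) \<and> (\<forall>t\<in>T. (\<forall>i<N. D i q0 t = 0) \<longrightarrow> t = 0)"
proof -
  obtain T' where T': "subspace T'"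
    "dim T' = vec_space.rank N (functional_matrix N (prod_basis Ey Ez) (\<lambda>i w. D i q0 (0, w)))"
    "\<And>t. t \<in> T' \<Longrightarrow> (\<And>i. i < N \<Longrightarrow> D i q0 (0, t) = 0) \<Longrightarrow> t = 0"
    using rank_functional_matrix_complement[of N "\<lambda>i w. D i q0 (0, w)" "prod_basis Ey Ez",
        OF linear_D_yz[OF _ S(2)] ordered_basis_prod_basis[OF bases(2,3)]]
    by blast
  have lin: "linear (\<lambda>w::'y \<times> 'z. (0::'x, w))" by (auto intro: linearI)
  define T where "T = Pair (0::'x) ` T'"
  show ?thesis
  proof (intro exI[of _ T] conjI ballI impI)
    show "subspace T" unfolding T_def by (rule linear_subspace_image[OF lin T'(1)])
    show "dim T = r"
      using dim_injective_image[OF lin _ T'(1)] T'(2) rank_yz by (simp add: T_def inj_on_def)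
    show "T \<subseteq> range (Pair 0)" by (auto simp: T_def)
    show "t = 0" if "t \<in> T" "\<forall>i<N. D i q0 t = 0" for t
      using that T'(3) by (auto simp: T_def zero_prod_def)
  qed
qed

lemma derivative_image_covered:
  assumes q: "q \<in> S" and T: "subspace T" "dim T = r"
    and inj: "\<And>t. t \<in> T \<Longrightarrow> (\<And>i. i < N \<Longrightarrow> D i q t = 0) \<Longrightarrow> t = 0"
  shows "\<exists>t\<in>T. \<forall>i<N. D i q v = D i q t"
  using rank_functional_matrix_covers[of N "\<lambda>i. D i q" "prod_basis Ex (prod_basis Ey Ez)" T v,
      OF linear_D[OF _ q] ordered_basis_prod_basis[OF bases(1) ordered_basis_prod_basis[OF bases(2,3)]] T(1)]
    T(2) rank_xyz[OF q] inj by simp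

text \<open>Retracting \<open>q0 + W d\<close> changes only outputs and latents, because
  \<open>T\<close> has no input component, and leads to the values of \<open>f\<close> at
  \<open>q0\<close>, which is its own retraction. The move is bounded by the increments of
  \<open>f\<close> from \<open>q0\<close> to \<open>q0 + W d\<close>, which are \<open>o(d)\<close>
  because \<open>W d\<close> solves the linearised equation.\<close>

theorem solution_along_linear_map:
  fixes L :: "'x \<Rightarrow> 'y" and R :: "'x \<Rightarrow> 'z"
  assumes L: "bounded_linear L" and R: "bounded_linear R"
    and sol: "\<And>i d. i < N \<Longrightarrow> D i q0 (d, L d, R d) = 0" and e: "e > 0"
  obtains \<delta> where "\<delta> > 0" "\<And>d. norm d < \<delta> \<Longrightarrow> \<exists>y z. norm (y - (y0 + L d)) \<le> e * norm d \<and>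
      norm (z - (z0 + R d)) \<le> e * norm d \<and> (\<forall>i<N. f i (x0 + d, y, z) = f i q0)"
proof -
  obtain T where compl: "subspace T" "dim T = r" "T \<subseteq> range (Pair 0)"
    and inj: "\<And>t. t \<in> T \<Longrightarrow> \<forall>i<N. D i q0 t = 0 \<Longrightarrow> t = 0"
    using yz_complement by blast
  interpret constant_rank_family f D N S T UNIV "set (prod_basis Ex (prod_basis Ey Ez))" q0
  proof
    show "t = 0" if "t \<in> T" "\<And>i. i < N \<Longrightarrow> D i q0 t = 0" for t using that inj by blast
    show "\<exists>t\<in>T. \<forall>i<N. D i q v = D i q t"
      if "q \<in> S" "\<And>t. t \<in> T \<Longrightarrow> (\<And>i. i < N \<Longrightarrow> D i q t = 0) \<Longrightarrow> t = 0" for q v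
      using derivative_image_covered[OF that(1) compl(1,2) that(2)] .
  next
    show "finite (set (prod_basis Ex (prod_basis Ey Ez)))"
      "span (set (prod_basis Ex (prod_basis Ey Ez))) = UNIV" by (rule finite_span)+
    show "open S" "q0 \<in> S" by (rule S)+
    show "(f i has_derivative D i q) (at q)" if "i < N" "q \<in> S" for i q by (rule deriv[OF that])
    show "continuous_on S (\<lambda>q. D i q v)" if "i < N" for i v by (rule cont[OF that])
    show "subspace T" by (rule compl)
    show "T \<subseteq> UNIV" by simp
    show "subspace (UNIV :: ('x \<times> 'y \<times> 'z) set)" by (rule subspace_UNIV)
  qed
  obtain \<sigma> C \<tau> where \<tau>: "\<sigma> > 0" "C \<ge> 0"
    "\<And>q. q \<in> ball q0 \<sigma> \<Longrightarrow> \<tau> q \<in> T \<and> norm (\<tau> q) \<le> C * (\<Sum>i<N. \<bar>f i q - f i q0\<bar>)"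
    "\<And>q v i. q \<in> ball q0 \<sigma> \<Longrightarrow> q + v \<in> ball q0 \<sigma> \<Longrightarrow> v \<in> UNIV \<Longrightarrow> i < N \<Longrightarrow>
       f i (q + v + \<tau> (q + v)) = f i (q + \<tau> q)"
    using retraction by blast
  define W where "W d = (d, L d, R d)" for d
  have W: "bounded_linear W" unfolding W_def
    by (intro bounded_linear_Pair bounded_linear_ident L R)
  obtain M where M: "M \<ge> 0" "\<And>d. norm (W d) \<le> norm d * M"
    using bounded_linear.nonneg_bounded[OF W] by blast
  \<comment> \<open>The move is at most \<open>C\<close> times a sum of \<open>N\<close> remainders,
    each at most \<open>\<epsilon> * norm (W d)\<close>, and \<open>M\<close> bounds
    \<open>W\<close>. The result is to be at most \<open>e * norm d\<close>.\<close>
  define \<epsilon> where "\<epsilon> = e / ((C * real N + 1) * (M + 1))"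
  have pos: "(C * real N + 1) * (M + 1) > 0" using \<tau>(2) M(1)
    by (intro mult_pos_pos add_nonneg_pos mult_nonneg_nonneg) auto
  have \<epsilon>: "\<epsilon> > 0" "\<epsilon> * ((C * real N + 1) * (M + 1)) = e"
  proof -
    show "\<epsilon> > 0" unfolding \<epsilon>_def using e pos by (rule divide_pos_pos)
    have "(C * real N + 1) * (M + 1) \<noteq> 0" using pos by linarith
    then show "\<epsilon> * ((C * real N + 1) * (M + 1)) = e"
      by (metis \<epsilon>_def nonzero_eq_divide_eq)
  qed
  have "\<exists>\<rho>>0. \<forall>i\<in>{..<N}. \<forall>q. norm (q - q0) < \<rho> \<longrightarrow> \<bar>f i q - f i q0 - D i q0 (q - q0)\<bar> \<le> \<epsilon> * norm (q - q0)"
  proof (rule common_radius)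
    fix i assume "i \<in> {..<N}"
    then have "(f i has_derivative D i q0) (at q0)" using deriv S by auto
    then show "\<exists>\<rho>>0. \<forall>q. norm (q - q0) < \<rho> \<longrightarrow> \<bar>f i q - f i q0 - D i q0 (q - q0)\<bar> \<le> \<epsilon> * norm (q - q0)"
      unfolding has_derivative_at_alt using \<epsilon>(1) by auto
  qed auto
  then obtain \<rho> where \<rho>: "\<rho> > 0" "\<And>i q. i < N \<Longrightarrow> norm (q - q0) < \<rho> \<Longrightarrow>
      \<bar>f i q - f i q0 - D i q0 (q - q0)\<bar> \<le> \<epsilon> * norm (q - q0)" by blast
  show ?thesis
  proof (rule that[of "min \<rho> \<sigma> / (M + 1)"])
    show "min \<rho> \<sigma> / (M + 1) > 0" using \<rho>(1) \<tau>(1) M(1) by simp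
    fix d :: 'x assume d: "norm d < min \<rho> \<sigma> / (M + 1)"
    have "norm (W d) \<le> norm d * (M + 1)" using M(2)[of d] norm_ge_zero[of d] unfolding distrib_left by linarith
    also have "\<dots> < min \<rho> \<sigma>" using d M(1) by (simp add: pos_less_divide_eq)
    finally have Wd: "norm (W d) < \<rho>" "norm (W d) < \<sigma>" by auto
    have b: "q0 \<in> ball q0 \<sigma>" "q0 + W d \<in> ball q0 \<sigma>" using \<tau>(1) Wd by (simp_all add: dist_norm)
    have "norm (\<tau> q0) \<le> C * (\<Sum>i<N. \<bar>f i q0 - f i q0\<bar>)" using \<tau>(3)[OF b(1)] by blast
    then have \<tau>0: "\<tau> q0 = 0" by simp
    obtain ty tz where t: "\<tau> (q0 + W d) = (0, ty, tz)" using \<tau>(3)[OF b(2)] compl(3) by auto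
    have fi: "f i (x0 + d, y0 + L d + ty, z0 + R d + tz) = f i q0" if i: "i < N" for i
      using \<tau>(4)[OF b(1) b(2) UNIV_I i] unfolding \<tau>0 t by (simp add: W_def)
    have "norm (0::'x, ty, tz) \<le> C * (\<Sum>i<N. \<bar>f i (q0 + W d) - f i q0\<bar>)"
      using \<tau>(3)[OF b(2)] by (simp only: t)
    also have "\<dots> \<le> C * (\<Sum>i<N. \<epsilon> * norm (W d))"
    proof (intro mult_left_mono sum_mono \<tau>)
      fix i assume "i \<in> {..<N}"
      then show "\<bar>f i (q0 + W d) - f i q0\<bar> \<le> \<epsilon> * norm (W d)"
        using \<rho>(2)[of i "q0 + W d"] Wd sol[of i d] by (simp add: W_def)
    qed
    also have "\<dots> = \<epsilon> * (C * real N) * norm (W d)" by simp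
    also have "\<dots> \<le> \<epsilon> * (C * real N + 1) * (norm d * (M + 1))"
      using \<epsilon>(1) \<tau>(2) \<open>norm (W d) \<le> norm d * (M + 1)\<close>
      by (intro mult_mono mult_left_mono) auto
    also have "\<dots> = e * norm d" unfolding \<epsilon>(2)[symmetric] by (simp only: mult_ac)
    finally have "norm (0::'x, ty, tz) \<le> e * norm d" .
    moreover have "norm ty \<le> norm (0::'x, ty, tz)" "norm tz \<le> norm (0::'x, ty, tz)"
      using norm_snd_le[of "(ty, tz)" "0::'x"] norm_fst_le[of ty tz] norm_snd_le[of tz ty] by linarith+
    ultimately have "norm ty \<le> e * norm d" "norm tz \<le> e * norm d" by linarith+
    then show "\<exists>y z. norm (y - (y0 + L d)) \<le> e * norm d \<and>
      norm (z - (z0 + R d)) \<le> e * norm d \<and> (\<forall>i<N. f i (x0 + d, y, z) = f i q0)"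
      using fi by (intro exI[of _ "y0 + L d + ty"] exI[of _ "z0 + R d + tz"]) auto
  qed
qed

text \<open>Some element of \<open>T\<close> has the same image under the derivative as
  \<open>(d, 0, 0)\<close>; it is subtracted.\<close>

lemma linear_equation_solvable: "\<exists>a b. \<forall>i<N. D i q0 (d, a, b) = 0"
proof -
  obtain T where T: "subspace T" "dim T = r" "T \<subseteq> range (Pair 0)"
    and inj: "\<And>t. t \<in> T \<Longrightarrow> \<forall>i<N. D i q0 t = 0 \<Longrightarrow> t = 0"
    using yz_complement by blast
  obtain t where t: "t \<in> T" "\<forall>i<N. D i q0 (d, 0, 0) = D i q0 t"
    using derivative_image_covered[OF S(2) T(1,2)] inj by blast
  obtain a b where ab: "t = (0, a, b)" using t(1) T(3) by auto
  have "D i q0 (d, - a, - b) = 0" if i: "i < N" for i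
  proof -
    have "(d, - a, - b) = (d, 0, 0) - t" by (simp add: ab)
    then show ?thesis using t(2) i linear_diff[OF linear_D[OF i S(2)]] by simp
  qed
  then show ?thesis by blast
qed

end

section \<open>Coordinate norms\<close>

text \<open>For an orthonormal basis at a point this is the Riemannian norm there. The norm of the
  model space is unrelated to the metric and serves for topology and differentiation.\<close>

definition coord_norm :: "'e::real_vector list \<Rightarrow> 'e \<Rightarrow> real" where
  "coord_norm E u = L2_set (\<lambda>i. coord E i u) {..<length E}"

lemma coord_norm_eq_vnorm: "coord_norm E u = vnorm (coord_vec E u)"
  by (simp add: coord_norm_def vnorm_eq_L2_set coord_vec_def L2_set_def)

lemma coord_norm_nonneg [simp]: "coord_norm E u \<ge> 0"
  by (simp add: coord_norm_def)

lemma coord_norm_scaleR: "ordered_basis E \<Longrightarrow> coord_norm E (a *\<^sub>R u) = \<bar>a\<bar> * coord_norm E u"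
  by (simp add: coord_norm_def linear_cmul[OF linear_coord] L2_set_def power_mult_distrib
      sum_distrib_left[symmetric] real_sqrt_mult)

lemma coord_norm_zero [simp]: "ordered_basis E \<Longrightarrow> coord_norm E 0 = 0"
  using coord_norm_scaleR[of E 0 0] by simp

lemma coord_norm_triangle:
  "ordered_basis E \<Longrightarrow> coord_norm E (u + v) \<le> coord_norm E u + coord_norm E v"
  using L2_set_triangle_ineq[of "\<lambda>i. coord E i u" "\<lambda>i. coord E i v" "{..<length E}"]
  by (simp add: coord_norm_def linear_add[OF linear_coord])

lemma coord_norm_minus_commute: "ordered_basis E \<Longrightarrow> coord_norm E (u - v) = coord_norm E (v - u)"
  using coord_norm_scaleR[of E "-1" "u - v"] by simp

lemma coord_norm_triangle_diff:
  "ordered_basis E \<Longrightarrow> coord_norm E (u - w) \<le> coord_norm E (u - v) + coord_norm E (v - w)"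
  using coord_norm_triangle[of E "u - v" "v - w"] by simp

lemma abs_coord_le: "i < length E \<Longrightarrow> \<bar>coord E i u\<bar> \<le> coord_norm E u"
  using member_le_L2_set[of "{..<length E}" i "\<lambda>i. \<bar>coord E i u\<bar>"]
  by (simp add: coord_norm_def L2_set_def)

lemma coord_norm_squared: "(coord_norm E u)\<^sup>2 = (\<Sum>i<length E. (coord E i u)\<^sup>2)"
  by (simp add: coord_norm_def L2_set_def sum_nonneg)

lemma norm_le_coord_norm:
  fixes E :: "'e::real_normed_vector list"
  assumes E: "ordered_basis E"
  obtains K where "K > 0" "\<And>u. norm u \<le> K * coord_norm E u"
proof -
  define K where "K = (\<Sum>i<length E. norm (E ! i)) + 1"
  have "norm u \<le> K * coord_norm E u" for u
  proof -
    have "norm u = norm (\<Sum>i<length E. coord E i u *\<^sub>R E ! i)" using coord_expansion[OF E] by simp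
    also have "\<dots> \<le> (\<Sum>i<length E. coord_norm E u * norm (E ! i))"
      by (rule sum_norm_le) (auto intro!: mult_right_mono abs_coord_le)
    also have "\<dots> \<le> K * coord_norm E u"
      by (simp add: K_def sum_distrib_left[symmetric] algebra_simps)
    finally show ?thesis .
  qed
  moreover have "K > 0" unfolding K_def by (intro add_nonneg_pos sum_nonneg) auto
  ultimately show ?thesis using that by blast
qed

lemma bounded_linear_coord:
  fixes E :: "'e::real_inner list"
  assumes E: "ordered_basis E"
  shows "bounded_linear (coord E i)"
  using ordered_basis_finite_span[OF E] linear_coord[OF E] by (rule linear_imp_bounded_linear)

lemma coord_norm_le_norm:
  fixes E :: "'e::real_inner list"
  assumes E: "ordered_basis E"
  obtains K where "K > 0" "\<And>u. coord_norm E u \<le> K * norm u"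
proof -
  have "\<exists>K\<ge>0. \<forall>u. \<bar>coord E i u\<bar> \<le> norm u * K" for i
    using bounded_linear.nonneg_bounded[OF bounded_linear_coord[OF E]] by auto
  then obtain k where k: "\<And>i. k i \<ge> 0" "\<And>i u. \<bar>coord E i u\<bar> \<le> norm u * k i" by metis
  define K where "K = (\<Sum>i<length E. k i) + 1"
  have "coord_norm E u \<le> K * norm u" for u
  proof -
    have "coord_norm E u \<le> (\<Sum>i<length E. \<bar>coord E i u\<bar>)"
      unfolding coord_norm_def by (rule L2_set_le_sum_abs)
    also have "\<dots> \<le> (\<Sum>i<length E. norm u * k i)" by (intro sum_mono k)
    also have "\<dots> \<le> K * norm u" by (simp add: K_def sum_distrib_left[symmetric] algebra_simps)
    finally show ?thesis .
  qed
  moreover have "K > 0" unfolding K_def by (intro add_nonneg_pos sum_nonneg) (auto simp: k)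
  ultimately show ?thesis using that by blast
qed

lemma continuous_on_coord_norm [continuous_intros]:
  fixes E :: "'e::real_inner list"
  assumes E: "ordered_basis E" and "continuous_on S h"
  shows "continuous_on S (\<lambda>x. coord_norm E (h x))"
  unfolding coord_norm_def L2_set_def
  by (intro continuous_intros bounded_linear.continuous_on[OF bounded_linear_coord[OF E]] assms)

lemma compact_coord_ball:
  fixes E :: "'e::real_inner list"
  assumes E: "ordered_basis E"
  shows "compact {t. coord_norm E (t - a) \<le> \<rho>}"
proof -
  obtain K where K: "K > 0" "\<And>u. norm u \<le> K * coord_norm E u" using norm_le_coord_norm[OF E] by blast
  have "norm (t - a) \<le> K * \<rho>" if "coord_norm E (t - a) \<le> \<rho>" for t
    using K(2)[of "t - a"] mult_left_mono[OF that, of K] K(1) by linarith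
  then have "{t. coord_norm E (t - a) \<le> \<rho>} = cball a (K * \<rho>) \<inter> {t. coord_norm E (t - a) \<le> \<rho>}"
    by (auto simp: dist_norm norm_minus_commute)
  moreover have "closed {t. coord_norm E (t - a) \<le> \<rho>}"
    by (intro closed_Collect_le continuous_intros E)
  ultimately show ?thesis
    using compact_Int_closed[OF compact_cball_finite_span[OF ordered_basis_finite_span[OF E], of a "K * \<rho>"]] by metis
qed

lemma coord_norm_segment:
  assumes E: "ordered_basis E" and "coord_norm E (a - p) \<le> \<rho>" "coord_norm E (b - p) \<le> \<rho>" "0 \<le> s" "s \<le> 1"
  shows "coord_norm E (a + s *\<^sub>R (b - a) - p) \<le> \<rho>"
proof -
  have "a + s *\<^sub>R (b - a) - p = (1 - s) *\<^sub>R (a - p) + s *\<^sub>R (b - p)" by (simp add: algebra_simps)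
  then have "coord_norm E (a + s *\<^sub>R (b - a) - p) \<le> (1 - s) * coord_norm E (a - p) + s * coord_norm E (b - p)"
    using coord_norm_triangle[OF E, of "(1 - s) *\<^sub>R (a - p)" "s *\<^sub>R (b - p)"] assms(4,5)
    by (simp add: coord_norm_scaleR[OF E])
  also have "\<dots> \<le> (1 - s) * \<rho> + s * \<rho>" using assms by (intro add_mono mult_left_mono) auto
  finally show ?thesis by (simp add: algebra_simps)
qed

section \<open>Lengths of paths\<close>

text \<open>No measurability of \<open>f\<close> and \<open>h\<close>: the speed of a path is unspecified at its breakpoints.\<close>

lemma nn_integral_le_split:
  assumes B: "B \<in> sets M" and le: "\<And>x. x \<in> space M \<Longrightarrow> h x \<le> (if x \<in> B then k x else f x)"
  shows "(\<integral>\<^sup>+x. h x \<partial>M) \<le> (\<integral>\<^sup>+x. f x \<partial>M) + (\<integral>\<^sup>+x. k x \<partial>M)"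
  unfolding nn_integral_def[of M h]
proof (rule SUP_least)
  fix s assume "s \<in> {s. simple_function M s \<and> s \<le> h}"
  then have s: "simple_function M s" "\<And>x. s x \<le> h x" by (auto simp: le_fun_def)
  \<comment> \<open>A simple function below \<open>h\<close> is measurable, so its integral may be
    split although that of \<open>h\<close> may not.\<close>
  then have m: "s \<in> borel_measurable M" by (simp add: borel_measurable_simple_function)
  have "integral\<^sup>S M s = (\<integral>\<^sup>+x. s x * indicator (space M - B) x + s x * indicator B x \<partial>M)"
    unfolding nn_integral_eq_simple_integral[OF s(1), symmetric]
    by (intro nn_integral_cong) (auto split: split_indicator)
  also have "\<dots> = (\<integral>\<^sup>+x. s x * indicator (space M - B) x \<partial>M) + (\<integral>\<^sup>+x. s x * indicator B x \<partial>M)"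
    using B m by (intro nn_integral_add) auto
  also have "\<dots> \<le> (\<integral>\<^sup>+x. f x \<partial>M) + (\<integral>\<^sup>+x. k x \<partial>M)"
  proof (intro add_mono nn_integral_mono)
    fix x assume x: "x \<in> space M"
    show "s x * indicator (space M - B) x \<le> f x" "s x * indicator B x \<le> k x"
      using order_trans[OF s(2) le[OF x]] x by (auto split: split_indicator)
  qed
  finally show "integral\<^sup>S M s \<le> (\<integral>\<^sup>+x. f x \<partial>M) + (\<integral>\<^sup>+x. k x \<partial>M)" .
qed

text \<open>The derivative may be unbounded near the breakpoints. Either its integral is infinite
  and nothing is claimed, or it is integrable and the fundamental theorem for the gauge integral,
  which tolerates finitely many exceptional points, evaluates the Lebesgue integral.\<close>

lemma nn_integral_abs_derivative_ge:
  fixes h :: "real \<Rightarrow> real"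
  assumes "finite S" "a \<le> b" and cont: "continuous_on {a..b} h"
    and deriv: "\<And>x. x \<in> {a<..<b} - S \<Longrightarrow> (h has_vector_derivative h' x) (at x)"
    and cont': "continuous_on ({a<..<b} - S) h'"
  shows "ennreal \<bar>h b - h a\<bar> \<le> (\<integral>\<^sup>+x. ennreal (indicator ({a<..<b} - S) x * \<bar>h' x\<bar>) \<partial>lborel)"
proof -
  define k where "k x = indicator ({a<..<b} - S) x *\<^sub>R h' x" for x
  have meas: "k \<in> borel_measurable borel"
    unfolding k_def using assms(1) cont'
    by (intro borel_measurable_continuous_on_indicator) (auto intro!: borel_open open_Diff finite_imp_closed)
  have k: "ennreal (norm (k x)) = ennreal (indicator ({a<..<b} - S) x * \<bar>h' x\<bar>)" for x
    by (simp add: k_def split: split_indicator)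
  show ?thesis
  proof (cases "(\<integral>\<^sup>+x. ennreal (norm (k x)) \<partial>lborel) = \<infinity>")
    case True
    then show ?thesis unfolding k by simp
  next
    case False
    then have int: "integrable lborel k"
      using meas by (auto simp: integrable_iff_bounded less_top)
    have "(h' has_integral (h b - h a)) {a..b}"
      using assms by (intro fundamental_theorem_of_calculus_interior_strong) auto
    moreover have neg: "negligible (S \<union> {a, b})" using assms(1) by (intro negligible_finite) auto
    ultimately have "(k has_integral (h b - h a)) {a..b}"
      by (rule has_integral_spike[rotated 2]) (auto simp: k_def)
    then have "(k has_integral (h b - h a)) UNIV"
      by (rule has_integral_on_superset) (auto simp: k_def)
    moreover have "(k has_integral (\<integral>x. k x \<partial>lborel)) UNIV"
      by (rule has_integral_integral_lborel[OF int])
    ultimately have "h b - h a = (\<integral>x. k x \<partial>lborel)" by (rule has_integral_unique)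
    then show ?thesis using integral_norm_bound_ennreal[OF int] unfolding k by simp
  qed
qed

section \<open>Riemannian metrics in a chart\<close>

lemma smooth_manifold_chart:
  assumes "smooth_manifold A" "d \<in> A"
  shows "open (fst d)" "open (snd d ` fst d)" "continuous_on (fst d) (snd d)"
    "continuous_on (snd d ` fst d) (chart_inv d)"
    "\<And>p. p \<in> fst d \<Longrightarrow> chart_inv d (snd d p) = p"
    "\<And>t. t \<in> snd d ` fst d \<Longrightarrow> snd d (chart_inv d t) = t"
    "\<And>t. t \<in> snd d ` fst d \<Longrightarrow> chart_inv d t \<in> fst d"
proof -
  have "is_chart d" using assms by (simp add: smooth_manifold_def)
  then show "open (fst d)" "open (snd d ` fst d)" "continuous_on (fst d) (snd d)"
    "continuous_on (snd d ` fst d) (chart_inv d)"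
    "\<And>p. p \<in> fst d \<Longrightarrow> chart_inv d (snd d p) = p"
    "\<And>t. t \<in> snd d ` fst d \<Longrightarrow> snd d (chart_inv d t) = t"
    "\<And>t. t \<in> snd d ` fst d \<Longrightarrow> chart_inv d t \<in> fst d"
    unfolding is_chart_def homeomorphism_def by auto
qed

locale riemannian_chart =
  fixes A :: "('m::{t2_space, second_countable_topology}, 'e::real_inner) chart set"
    and g :: "('m, 'e) metric" and c :: "('m, 'e) chart" and p0 :: 'm and E :: "'e list"
  assumes manifold: "smooth_manifold A" and metric: "riemannian_metric A g"
    and c: "c \<in> charts_at A p0" and E: "orthonormal_basis_at g c p0 E"
begin

definition "\<phi> = snd c"
definition "U = fst c"
definition "\<psi> = chart_inv c"
definition "n0 = coord_norm E"

lemma basis: "ordered_basis E" using E by (simp add: orthonormal_basis_at_def)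

lemma cA: "c \<in> A" and p0U: "p0 \<in> U" using c by (auto simp: charts_at_def U_def)

lemmas chart_facts = smooth_manifold_chart[OF manifold]

lemmas chart = chart_facts[OF cA, folded \<phi>_def U_def \<psi>_def]

lemma \<phi>U: "p \<in> U \<Longrightarrow> \<phi> p \<in> \<phi> ` U" by simp

lemma transition:
  assumes d: "d \<in> A" and p: "p \<in> U" "p \<in> fst d"
  shows "((snd d \<circ> \<psi>) has_derivative frechet_derivative (snd d \<circ> \<psi>) (at (\<phi> p))) (at (\<phi> p))"
proof -
  have "smooth_on (snd c ` (fst c \<inter> fst d)) (snd d \<circ> chart_inv c)"
    using manifold cA d by (simp add: smooth_manifold_def)
  then have "Ck_on (Suc 0) (snd c ` (fst c \<inter> fst d)) (snd d \<circ> chart_inv c)"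
    unfolding smooth_on_def by blast
  then have "(snd d \<circ> \<psi>) differentiable (at (\<phi> p))"
    using p by (auto simp: \<phi>_def \<psi>_def U_def)
  then show ?thesis by (simp add: frechet_derivative_works[symmetric])
qed

lemma transition_continuous:
  assumes d: "d \<in> A"
  shows "continuous_on (\<phi> ` (U \<inter> fst d)) (\<lambda>t. frechet_derivative (snd d \<circ> \<psi>) (at t) v)"
proof -
  have "smooth_on (snd c ` (fst c \<inter> fst d)) (snd d \<circ> chart_inv c)"
    using manifold cA d by (simp add: smooth_manifold_def)
  then have "Ck_on (Suc 0) (snd c ` (fst c \<inter> fst d)) (snd d \<circ> chart_inv c)"
    unfolding smooth_on_def by blast
  then show ?thesis by (simp add: \<phi>_def \<psi>_def U_def)
qed

text \<open>The chain rule. Passing through \<open>\<phi>\<close> and \<open>\<psi>\<close>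
  reproduces \<open>\<gamma>\<close> only near \<open>t\<close>, where continuity keeps the curve in
  \<open>U\<close>.\<close>

lemma chart_change_vector_derivative:
  assumes d: "d \<in> A" and \<gamma>: "isCont \<gamma> t" "\<gamma> t \<in> U" "\<gamma> t \<in> fst d"
    and w: "((\<phi> \<circ> \<gamma>) has_vector_derivative w) (at t)"
  shows "((snd d \<circ> \<gamma>) has_vector_derivative
    frechet_derivative (snd d \<circ> \<psi>) (at (\<phi> (\<gamma> t))) w) (at t)"
proof -
  let ?D = "frechet_derivative (snd d \<circ> \<psi>) (at (\<phi> (\<gamma> t)))"
  have D: "((snd d \<circ> \<psi>) has_derivative ?D) (at ((\<phi> \<circ> \<gamma>) t))"
    using transition[OF d \<gamma>(2,3)] by simp
  have "((snd d \<circ> \<psi>) \<circ> (\<phi> \<circ> \<gamma>) has_derivative ?D \<circ> (\<lambda>x. x *\<^sub>R w)) (at t)"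
    using w D unfolding has_vector_derivative_def by (intro diff_chain_at)
  moreover have "?D \<circ> (\<lambda>x. x *\<^sub>R w) = (\<lambda>x. x *\<^sub>R ?D w)"
    using has_derivative_linear[OF D] by (auto simp: linear_cmul)
  ultimately have der: "((snd d \<circ> \<psi>) \<circ> (\<phi> \<circ> \<gamma>) has_vector_derivative ?D w) (at t)"
    by (simp add: has_vector_derivative_def)
  have "eventually (\<lambda>s. \<gamma> s \<in> U) (nhds t)"
    using \<gamma>(1,2) chart(1) unfolding continuous_at by (auto simp: tendsto_def eventually_nhds_conv_at)
  then have ev: "eventually (\<lambda>s. s \<in> UNIV \<longrightarrow> ((snd d \<circ> \<psi>) \<circ> (\<phi> \<circ> \<gamma>)) s = (snd d \<circ> \<gamma>) s) (nhds t)"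
    by eventually_elim (simp add: chart)
  have "((snd d \<circ> \<psi>) \<circ> (\<phi> \<circ> \<gamma>)) t = (snd d \<circ> \<gamma>) t"
    using \<gamma>(2) by (simp add: chart)
  from iffD1[OF has_vector_derivative_cong_ev[OF ev this]] der show ?thesis by blast
qed

lemma metric_properties:
  assumes "p \<in> U"
  shows "bilinear (g c p)" "\<And>u. u \<noteq> 0 \<Longrightarrow> g c p u u > 0"
  using metric cA assms by (auto simp: riemannian_metric_def U_def)

text \<open>The speed is measured in a chart picked by \<open>SOME\<close>; compatibility of the
  metric under changes of charts transfers it to \<open>c\<close>.\<close>

lemma speed_in_chart:
  assumes \<gamma>: "isCont \<gamma> t" "\<gamma> t \<in> U" and w: "((\<phi> \<circ> \<gamma>) has_vector_derivative w) (at t)"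
  shows "speed A g \<gamma> t = sqrt (g c (\<gamma> t) w w)"
proof -
  define d where "d = (SOME c. c \<in> charts_at A (\<gamma> t))"
  have "c \<in> charts_at A (\<gamma> t)" using \<gamma>(2) cA by (simp add: charts_at_def U_def)
  then have "d \<in> charts_at A (\<gamma> t)" unfolding d_def by (rule someI)
  then have d: "d \<in> A" "\<gamma> t \<in> fst d" by (auto simp: charts_at_def)
  let ?D = "frechet_derivative (snd d \<circ> \<psi>) (at (\<phi> (\<gamma> t)))"
  have "vector_derivative (snd d \<circ> \<gamma>) (at t) = ?D w"
    using chart_change_vector_derivative[OF d(1) \<gamma> d(2) w] by (rule vector_derivative_at)
  moreover have "g c (\<gamma> t) w w = g d (\<gamma> t) (?D w) (?D w)"
    using metric cA d \<gamma>(2) unfolding riemannian_metric_def Let_def \<phi>_def \<psi>_def U_def by blast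
  ultimately show ?thesis by (simp add: speed_def Let_def d_def)
qed

lemma metric_expansion:
  assumes "p \<in> U"
  shows "g c p u u = (\<Sum>i<length E. \<Sum>j<length E. coord E i u * coord E j u * g c p (E ! i) (E ! j))"
proof -
  have l: "linear (g c p x)" "linear (\<lambda>x. g c p x y)" for x y
    using metric_properties(1)[OF assms] by (auto simp: bilinear_def)
  have "g c p u u = g c p (\<Sum>i<length E. coord E i u *\<^sub>R E ! i) (\<Sum>j<length E. coord E j u *\<^sub>R E ! j)"
    by (simp add: coord_expansion[OF basis])
  then show ?thesis
    by (subst sum.swap) (simp add: linear_sum[OF l(1)] linear_sum[OF l(2)] linear_cmul[OF l(1)] linear_cmul[OF l(2)]
        sum_distrib_left mult_ac)
qed

lemma metric_p0: "g c p0 u u = (n0 u)\<^sup>2"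
proof -
  have "g c p0 u u = (\<Sum>i<length E. \<Sum>j<length E. if j = i then coord E i u * coord E i u else 0)"
    unfolding metric_expansion[OF p0U] using E
    by (intro sum.cong) (auto simp: orthonormal_basis_at_def)
  then show ?thesis unfolding n0_def coord_norm_squared by (simp add: power2_eq_square)
qed

lemma metric_near:
  assumes \<epsilon>: "\<epsilon> > 0"
  obtains \<rho> where "\<rho> > 0" "cball (\<phi> p0) \<rho> \<subseteq> \<phi> ` U"
    "\<And>t u. t \<in> cball (\<phi> p0) \<rho> \<Longrightarrow> \<bar>g c (\<psi> t) u u - (n0 u)\<^sup>2\<bar> \<le> \<epsilon> * (n0 u)\<^sup>2"
proof -
  define n where "n = length E"
  \<comment> \<open>The quadratic form has \<open>n\<^sup>2\<close> coefficients, each of which is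
    allowed to vary by \<open>\<delta>\<close>.\<close>
  define \<delta> where "\<delta> = \<epsilon> / ((real n)\<^sup>2 + 1)"
  have pos: "(real n)\<^sup>2 + 1 > 0" by (intro add_nonneg_pos) auto
  have \<delta>: "\<delta> > 0" "(real n)\<^sup>2 * \<delta> \<le> \<epsilon>"
    using \<epsilon> pos by (auto simp: \<delta>_def pos_divide_le_eq algebra_simps)
  have "\<exists>r>0. \<forall>ij\<in>{..<n} \<times> {..<n}. \<forall>t\<in>\<phi> ` U. dist t (\<phi> p0) < r \<longrightarrow>
     \<bar>g c (\<psi> t) (E ! fst ij) (E ! snd ij) - g c p0 (E ! fst ij) (E ! snd ij)\<bar> \<le> \<delta>"
  proof (rule common_radius)
    fix ij :: "nat \<times> nat"
    let ?h = "\<lambda>t. g c (\<psi> t) (E ! fst ij) (E ! snd ij)"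
    have "smooth_on (\<phi> ` U) ?h"
      using metric cA by (simp add: riemannian_metric_def \<phi>_def \<psi>_def U_def)
    then have "Ck_on 0 (\<phi> ` U) ?h" unfolding smooth_on_def by blast
    then have "continuous_on (\<phi> ` U) ?h" by simp
    then obtain r where "r > 0" "\<forall>t\<in>\<phi> ` U. dist t (\<phi> p0) < r \<longrightarrow> dist (?h t) (?h (\<phi> p0)) < \<delta>"
      using \<phi>U[OF p0U] \<delta>(1) unfolding continuous_on_iff by blast
    then show "\<exists>r>0. \<forall>t\<in>\<phi> ` U. dist t (\<phi> p0) < r \<longrightarrow>
     \<bar>g c (\<psi> t) (E ! fst ij) (E ! snd ij) - g c p0 (E ! fst ij) (E ! snd ij)\<bar> \<le> \<delta>"
      using chart(5)[OF p0U] by (intro exI[of _ r]) (auto simp: dist_real_def less_imp_le)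
  qed auto
  then obtain r where r: "r > 0" "\<And>i j t. i < n \<Longrightarrow> j < n \<Longrightarrow> t \<in> \<phi> ` U \<Longrightarrow> dist t (\<phi> p0) < r \<Longrightarrow>
     \<bar>g c (\<psi> t) (E ! i) (E ! j) - g c p0 (E ! i) (E ! j)\<bar> \<le> \<delta>" by fastforce
  obtain r' where r': "r' > 0" "cball (\<phi> p0) r' \<subseteq> \<phi> ` U"
    using chart(2) \<phi>U[OF p0U] open_contains_cball by blast
  show ?thesis
  proof (rule that[of "min (r / 2) r'"])
    show "min (r / 2) r' > 0" "cball (\<phi> p0) (min (r / 2) r') \<subseteq> \<phi> ` U" using r r' by auto
    fix t u assume t: "t \<in> cball (\<phi> p0) (min (r / 2) r')"
    then have tU: "t \<in> \<phi> ` U" and tr: "dist t (\<phi> p0) < r" using r' r(1) by (auto simp: dist_commute)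
    have "g c (\<psi> t) u u - (n0 u)\<^sup>2 = g c (\<psi> t) u u - g c p0 u u" by (simp add: metric_p0)
    also have "\<dots> = (\<Sum>i<n. \<Sum>j<n. coord E i u * coord E j u *
        (g c (\<psi> t) (E ! i) (E ! j) - g c p0 (E ! i) (E ! j)))"
      unfolding metric_expansion[OF p0U] metric_expansion[OF chart(7)[OF tU]] n_def
      by (simp add: sum_subtractf right_diff_distrib)
    also have "\<bar>\<dots>\<bar> \<le> (\<Sum>i<n. \<Sum>j<n. n0 u * n0 u * \<delta>)"
    proof (intro order_trans[OF sum_abs] sum_mono)
      fix i j assume ij: "i \<in> {..<n}" "j \<in> {..<n}"
      show "\<bar>coord E i u * coord E j u * (g c (\<psi> t) (E ! i) (E ! j) - g c p0 (E ! i) (E ! j))\<bar> \<le> n0 u * n0 u * \<delta>"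
        unfolding abs_mult n0_def using ij r(2)[of i j t] tU tr
        by (intro mult_mono abs_coord_le) (auto simp: n_def)
    qed
    also have "\<dots> = ((real n)\<^sup>2 * \<delta>) * (n0 u)\<^sup>2" by (simp add: power2_eq_square)
    also have "\<dots> \<le> \<epsilon> * (n0 u)\<^sup>2" using \<delta> by (intro mult_right_mono) auto
    finally show "\<bar>g c (\<psi> t) u u - (n0 u)\<^sup>2\<bar> \<le> \<epsilon> * (n0 u)\<^sup>2" .
  qed
qed

lemma n0_nonneg [simp]: "n0 u \<ge> 0" by (simp add: n0_def)

definition coord_cball :: "real \<Rightarrow> 'm set" where
  "coord_cball \<rho> = {p \<in> U. n0 (\<phi> p - \<phi> p0) \<le> \<rho>}"

definition coord_ball :: "real \<Rightarrow> 'm set" where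
  "coord_ball \<rho> = {p \<in> U. n0 (\<phi> p - \<phi> p0) < \<rho>}"

text \<open>Stated for the closed ball, which is compact and contains the point at which a path
  first leaves the open ball.\<close>

definition good_radius :: "real \<Rightarrow> real \<Rightarrow> bool" where
  "good_radius \<epsilon> \<rho> \<longleftrightarrow> \<rho> > 0 \<and> {t. n0 (t - \<phi> p0) \<le> \<rho>} \<subseteq> \<phi> ` U \<and>
    (\<forall>p\<in>coord_cball \<rho>. \<forall>u. (1 - \<epsilon>) * n0 u \<le> sqrt (g c p u u) \<and> sqrt (g c p u u) \<le> (1 + \<epsilon>) * n0 u)"

lemma good_radius_exists:
  assumes \<epsilon>: "0 < \<epsilon>" "\<epsilon> < 1"
  shows "\<exists>\<rho>>0. \<forall>\<rho>'. 0 < \<rho>' \<longrightarrow> \<rho>' \<le> \<rho> \<longrightarrow> good_radius \<epsilon> \<rho>'"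
proof -
  obtain r where r: "r > 0" "cball (\<phi> p0) r \<subseteq> \<phi> ` U"
    "\<And>t u. t \<in> cball (\<phi> p0) r \<Longrightarrow> \<bar>g c (\<psi> t) u u - (n0 u)\<^sup>2\<bar> \<le> \<epsilon> * (n0 u)\<^sup>2"
    using metric_near[OF \<epsilon>(1)] by blast
  obtain K where K: "K > 0" "\<And>u. norm u \<le> K * n0 u"
    using norm_le_coord_norm[OF basis] unfolding n0_def by blast
  have "good_radius \<epsilon> \<rho>" if \<rho>: "0 < \<rho>" "\<rho> \<le> r / K" for \<rho>
  proof -
    have sub: "t \<in> cball (\<phi> p0) r" if "n0 (t - \<phi> p0) \<le> \<rho>" for t
    proof -
      have "norm (t - \<phi> p0) \<le> K * n0 (t - \<phi> p0)" by (rule K)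
      also have "\<dots> \<le> K * (r / K)" using K that \<rho> by (intro mult_left_mono) auto
      finally show ?thesis using K(1) by (simp add: dist_norm norm_minus_commute)
    qed
    have "(1 - \<epsilon>) * n0 u \<le> sqrt (g c p u u) \<and> sqrt (g c p u u) \<le> (1 + \<epsilon>) * n0 u"
      if p: "p \<in> coord_cball \<rho>" for p u
    proof -
      have pU: "p \<in> U" using p by (simp add: coord_cball_def)
      have b: "\<bar>g c p u u - (n0 u)\<^sup>2\<bar> \<le> \<epsilon> * (n0 u)\<^sup>2"
        using r(3)[OF sub, of "\<phi> p" u] p chart(5)[OF pU] by (simp add: coord_cball_def)
      \<comment> \<open>The estimate \<open>b\<close> for squares passes to the norms themselves
        because \<open>1 - \<epsilon>\<close> dominates its square while
        \<open>1 + \<epsilon>\<close> is dominated by its own.\<close>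
      have "((1 - \<epsilon>) * n0 u)\<^sup>2 = (1 - \<epsilon>) * ((1 - \<epsilon>) * (n0 u)\<^sup>2)" by (simp add: power2_eq_square)
      also have "\<dots> \<le> 1 * ((1 - \<epsilon>) * (n0 u)\<^sup>2)" using \<epsilon> by (intro mult_right_mono) auto
      also have "\<dots> \<le> g c p u u" using b by (simp add: algebra_simps)
      finally have 1: "((1 - \<epsilon>) * n0 u)\<^sup>2 \<le> g c p u u" .
      have "g c p u u \<le> 1 * ((1 + \<epsilon>) * (n0 u)\<^sup>2)" using b by (simp add: algebra_simps)
      also have "\<dots> \<le> (1 + \<epsilon>) * ((1 + \<epsilon>) * (n0 u)\<^sup>2)" using \<epsilon> by (intro mult_right_mono) auto
      also have "\<dots> = ((1 + \<epsilon>) * n0 u)\<^sup>2" by (simp add: power2_eq_square)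
      finally have 2: "g c p u u \<le> ((1 + \<epsilon>) * n0 u)\<^sup>2" .
      show ?thesis using 1 2 \<epsilon> by (auto intro!: real_le_rsqrt real_le_lsqrt)
    qed
    then show ?thesis using sub r(2) \<rho>(1) unfolding good_radius_def by auto
  qed
  then show ?thesis using r(1) K(1) by (intro exI[of _ "r / K"]) auto
qed

lemma coord_ball_subset: "coord_ball \<rho> \<subseteq> coord_cball \<rho>"
  by (auto simp: coord_ball_def coord_cball_def)

lemma open_coord_ball: "open (coord_ball \<rho>)"
proof -
  have "continuous_on U (\<lambda>p. n0 (\<phi> p - \<phi> p0))"
    unfolding n0_def by (intro continuous_intros basis chart)
  then have "open (U \<inter> (\<lambda>p. n0 (\<phi> p - \<phi> p0)) -` {..<\<rho>})"
    by (rule continuous_open_preimage[OF _ chart(1) open_lessThan])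
  then show ?thesis by (simp add: coord_ball_def vimage_def Int_def)
qed

lemma coord_cball_eq_image:
  assumes "{t. n0 (t - \<phi> p0) \<le> \<rho>} \<subseteq> \<phi> ` U"
  shows "coord_cball \<rho> = \<psi> ` {t. n0 (t - \<phi> p0) \<le> \<rho>}"
proof (intro equalityI subsetI)
  fix p assume "p \<in> coord_cball \<rho>"
  then have "p = \<psi> (\<phi> p)" "n0 (\<phi> p - \<phi> p0) \<le> \<rho>" using chart(5) by (auto simp: coord_cball_def)
  then show "p \<in> \<psi> ` {t. n0 (t - \<phi> p0) \<le> \<rho>}" by blast
next
  fix p assume "p \<in> \<psi> ` {t. n0 (t - \<phi> p0) \<le> \<rho>}"
  then obtain t where t: "p = \<psi> t" "n0 (t - \<phi> p0) \<le> \<rho>" by blast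
  then have "t \<in> \<phi> ` U" using assms by blast
  then show "p \<in> coord_cball \<rho>" using t chart(6,7) by (simp add: coord_cball_def)
qed

lemma compact_coord_cball:
  assumes "{t. n0 (t - \<phi> p0) \<le> \<rho>} \<subseteq> \<phi> ` U"
  shows "compact (coord_cball \<rho>)"
  unfolding coord_cball_eq_image[OF assms]
  using compact_coord_ball[OF basis, of "\<phi> p0" \<rho>] continuous_on_subset[OF chart(4) assms]
  by (intro compact_continuous_image) (auto simp: n0_def)

section \<open>Lower bounds for lengths and distances\<close>

lemma path_interior:
  assumes "path \<gamma>" "t \<in> {0<..<1}"
  shows "isCont \<gamma> t"
  using assms continuous_on_interior[of "{0..1}" \<gamma> t] by (simp add: path_def interior_atLeastAtMost_real)

text \<open>Up to the factor \<open>1 - \<epsilon>\<close>, the speed dominates the derivative of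
  \<open>l\<close> along the path, where \<open>l\<close> is the coordinate in the direction of the
  displacement. So the length dominates the total increase of \<open>l\<close>.\<close>

lemma path_len_ge_displacement:
  assumes \<gamma>: "piecewise_C1_path A \<gamma>" and \<rho>: "good_radius \<epsilon> \<rho>" and \<epsilon>: "\<epsilon> < 1"
    and \<tau>: "0 \<le> \<tau>" "\<tau> \<le> 1" and in_ball: "\<And>s. s \<in> {0..\<tau>} \<Longrightarrow> \<gamma> s \<in> coord_cball \<rho>"
  shows "ennreal ((1 - \<epsilon>) * n0 (\<phi> (\<gamma> \<tau>) - \<phi> (\<gamma> 0))) \<le> path_len A g \<gamma>"
proof -
  define \<Delta> where "\<Delta> = \<phi> (\<gamma> \<tau>) - \<phi> (\<gamma> 0)"
  \<comment> \<open>The inner product with the unit vector along \<open>\<Delta>\<close>. If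
    \<open>\<Delta>\<close> is 0, division by 0 makes \<open>l\<close> vanish.\<close>
  define l where "l u = (\<Sum>i<length E. (coord E i \<Delta> / n0 \<Delta>) * coord E i u)" for u
  have l_bl: "bounded_linear l"
    unfolding l_def by (intro bounded_linear_sum bounded_linear_const_mult bounded_linear_coord basis)
  have l_le: "\<bar>l u\<bar> \<le> n0 u" for u
  proof (cases "n0 \<Delta> = 0")
    case False
    have "\<bar>l u\<bar> \<le> (\<Sum>i<length E. \<bar>coord E i \<Delta> / n0 \<Delta>\<bar> * \<bar>coord E i u\<bar>)"
      unfolding l_def by (rule order_trans[OF sum_abs]) (simp add: abs_mult)
    also have "\<dots> = (\<Sum>i<length E. \<bar>coord E i \<Delta>\<bar> * \<bar>coord E i u\<bar>) / n0 \<Delta>"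
      by (simp add: sum_divide_distrib)
    also have "\<dots> \<le> (n0 \<Delta> * n0 u) / n0 \<Delta>"
      unfolding n0_def coord_norm_def by (intro divide_right_mono L2_set_mult_ineq) simp
    finally show ?thesis using False by simp
  qed (simp add: l_def)
  have l_\<Delta>: "l \<Delta> = n0 \<Delta>"
  proof -
    have "l \<Delta> = (\<Sum>i<length E. (coord E i \<Delta>)\<^sup>2) / n0 \<Delta>"
      unfolding l_def by (simp add: sum_divide_distrib power2_eq_square)
    also have "\<dots> = (n0 \<Delta>)\<^sup>2 / n0 \<Delta>" by (simp add: n0_def coord_norm_squared)
    finally show ?thesis by (simp add: power2_eq_square)
  qed
  obtain S where S: "finite S" "(snd c \<circ> \<gamma>) C1_differentiable_on ({0<..<1} \<inter> \<gamma> -` fst c - S)"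
    using \<gamma> cA unfolding piecewise_C1_path_def by blast
  have "path \<gamma>" using \<gamma> by (simp add: piecewise_C1_path_def)
  obtain D where D: "\<And>x. x \<in> {0<..<1} \<inter> \<gamma> -` U - S \<Longrightarrow> ((\<phi> \<circ> \<gamma>) has_vector_derivative D x) (at x)"
    "continuous_on ({0<..<1} \<inter> \<gamma> -` U - S) D"
    using S(2) unfolding C1_differentiable_on_def \<phi>_def U_def by blast
  have inU: "\<gamma> s \<in> U" if "s \<in> {0..\<tau>}" for s using in_ball[OF that] by (simp add: coord_cball_def)
  have sub: "{0<..<\<tau>} - S \<subseteq> {0<..<1} \<inter> \<gamma> -` U - S" using inU \<tau> by auto
  have "ennreal \<bar>l (\<phi> (\<gamma> \<tau>)) - l (\<phi> (\<gamma> 0))\<bar> \<le>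
      (\<integral>\<^sup>+x. ennreal (indicator ({0<..<\<tau>} - S) x * \<bar>l (D x)\<bar>) \<partial>lborel)"
  proof (rule nn_integral_abs_derivative_ge[OF S(1) \<tau>(1)])
    have "continuous_on {0..\<tau>} \<gamma>" using \<open>path \<gamma>\<close> \<tau> unfolding path_def by (auto elim: continuous_on_subset)
    moreover have "continuous_on (\<gamma> ` {0..\<tau>}) \<phi>" using inU by (intro continuous_on_subset[OF chart(3)]) auto
    ultimately have "continuous_on {0..\<tau>} (\<lambda>x. \<phi> (\<gamma> x))"
      using continuous_on_compose[of "{0..\<tau>}" \<gamma> \<phi>] by (simp add: o_def)
    then show "continuous_on {0..\<tau>} (\<lambda>x. l (\<phi> (\<gamma> x)))" by (rule bounded_linear.continuous_on[OF l_bl])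
    show "((\<lambda>x. l (\<phi> (\<gamma> x))) has_vector_derivative l (D x)) (at x)" if "x \<in> {0<..<\<tau>} - S" for x
      using bounded_linear.has_vector_derivative[OF l_bl D(1)[OF subsetD[OF sub that]]] by simp
    show "continuous_on ({0<..<\<tau>} - S) (\<lambda>x. l (D x))"
      by (intro bounded_linear.continuous_on[OF l_bl] continuous_on_subset[OF D(2) sub])
  qed
  then have "ennreal (1 - \<epsilon>) * ennreal (n0 \<Delta>) \<le>
      ennreal (1 - \<epsilon>) * (\<integral>\<^sup>+x. ennreal (indicator ({0<..<\<tau>} - S) x * \<bar>l (D x)\<bar>) \<partial>lborel)"
    using linear_diff[OF bounded_linear.linear[OF l_bl], of "\<phi> (\<gamma> \<tau>)" "\<phi> (\<gamma> 0)"] l_\<Delta>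
    by (intro mult_left_mono) (auto simp: \<Delta>_def)
  also have "\<dots> = (\<integral>\<^sup>+x. ennreal (1 - \<epsilon>) * ennreal (indicator ({0<..<\<tau>} - S) x * \<bar>l (D x)\<bar>) \<partial>lborel)"
  proof (rule nn_integral_cmult[symmetric])
    have "(\<lambda>x. indicator ({0<..<\<tau>} - S) x *\<^sub>R \<bar>l (D x)\<bar>) \<in> borel_measurable borel"
      using S(1) by (intro borel_measurable_continuous_on_indicator)
        (auto intro!: borel_open open_Diff finite_imp_closed continuous_intros
          bounded_linear.continuous_on[OF l_bl] continuous_on_subset[OF D(2) sub])
    then show "(\<lambda>x. ennreal (indicator ({0<..<\<tau>} - S) x * \<bar>l (D x)\<bar>)) \<in> borel_measurable lborel"
      by simp
  qed
  also have "\<dots> \<le> path_len A g \<gamma>"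
    unfolding path_len_def
  proof (rule nn_integral_mono)
    fix x :: real
    show "ennreal (1 - \<epsilon>) * ennreal (indicator ({0<..<\<tau>} - S) x * \<bar>l (D x)\<bar>)
      \<le> ennreal (speed A g \<gamma> x) * indicator {0..1} x"
    proof (cases "x \<in> {0<..<\<tau>} - S")
      case True
      then have x: "x \<in> {0<..<1}" "x \<in> {0..\<tau>}" "x \<in> {0..1}" using \<tau> by auto
      have "speed A g \<gamma> x = sqrt (g c (\<gamma> x) (D x) (D x))"
        using D(1)[OF subsetD[OF sub True]] inU[OF x(2)] path_interior[OF \<open>path \<gamma>\<close> x(1)]
        by (intro speed_in_chart)
      moreover have "(1 - \<epsilon>) * n0 (D x) \<le> sqrt (g c (\<gamma> x) (D x) (D x))"
        using \<rho> in_ball[OF x(2)] unfolding good_radius_def by blast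
      moreover have "(1 - \<epsilon>) * \<bar>l (D x)\<bar> \<le> (1 - \<epsilon>) * n0 (D x)" using \<epsilon> l_le by (intro mult_left_mono) auto
      ultimately have "(1 - \<epsilon>) * \<bar>l (D x)\<bar> \<le> speed A g \<gamma> x" by linarith
      then show ?thesis using True x \<epsilon> by (simp add: ennreal_mult[symmetric] ennreal_leI)
    qed simp
  qed
  finally show ?thesis using \<epsilon> by (simp add: \<Delta>_def ennreal_mult)
qed

text \<open>\<open>\<tau>\<close> is the first time outside the open ball, the least element of a
  compact set of times. Until then the path is in the open ball, so by continuity it is still in the
  closed ball at \<open>\<tau>\<close>.\<close>

lemma path_exit:
  assumes "path \<gamma>" "\<gamma> 0 = p0" and \<rho>: "\<rho> > 0" "{t. n0 (t - \<phi> p0) \<le> \<rho>} \<subseteq> \<phi> ` U"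
    and s: "s \<in> {0..1}" "\<gamma> s \<notin> coord_ball \<rho>"
  obtains \<tau> where "\<tau> \<in> {0..1}" "n0 (\<phi> (\<gamma> \<tau>) - \<phi> p0) = \<rho>" "\<And>s. s \<in> {0..\<tau>} \<Longrightarrow> \<gamma> s \<in> coord_cball \<rho>"
proof -
  have cont: "continuous_on {0..1} \<gamma>" using assms(1) by (simp add: path_def)
  define B where "B = {0..1} \<inter> \<gamma> -` (- coord_ball \<rho>)"
  have "closed B" unfolding B_def
    by (intro continuous_closed_preimage[OF cont]) (auto simp: open_coord_ball)
  moreover have "{0..1} \<inter> B = B" by (auto simp: B_def)
  ultimately have cB: "compact B" using compact_Int_closed[OF compact_Icc[of 0 1], of B] by simp
  have nB: "B \<noteq> {}" using s by (auto simp: B_def)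
  obtain \<tau> where \<tau>: "\<tau> \<in> B" "\<And>s. s \<in> B \<Longrightarrow> \<tau> \<le> s"
    using compact_attains_inf[OF cB nB] by blast
  have \<tau>01: "\<tau> \<in> {0..1}" "\<gamma> \<tau> \<notin> coord_ball \<rho>" using \<tau>(1) by (auto simp: B_def)
  have "p0 \<in> coord_ball \<rho>" using p0U \<rho>(1) basis by (simp add: coord_ball_def n0_def)
  then have \<tau>0: "\<tau> > 0" using \<tau>01 assms(2) by (cases "\<tau> = 0") auto
  have before: "\<gamma> s \<in> coord_ball \<rho>" if "s \<in> {0..<\<tau>}" for s
    using \<tau>(2)[of s] that \<tau>01 by (force simp: B_def)
  have "closed ({0..\<tau>} \<inter> \<gamma> -` coord_cball \<rho>)"
    using cont \<tau>01 compact_imp_closed[OF compact_coord_cball[OF \<rho>(2)]]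
    by (intro continuous_closed_preimage) (auto elim: continuous_on_subset)
  moreover have "{0..<\<tau>} \<subseteq> {0..\<tau>} \<inter> \<gamma> -` coord_cball \<rho>"
  proof
    fix x assume "x \<in> {0..<\<tau>}"
    then show "x \<in> {0..\<tau>} \<inter> \<gamma> -` coord_cball \<rho>"
      using subsetD[OF coord_ball_subset before[of x]] by simp
  qed
  ultimately have "closure {0..<\<tau>} \<subseteq> {0..\<tau>} \<inter> \<gamma> -` coord_cball \<rho>" by (rule closure_minimal[rotated])
  then have all: "\<gamma> s \<in> coord_cball \<rho>" if "s \<in> {0..\<tau>}" for s using \<tau>0 that by auto
  have "\<gamma> \<tau> \<in> coord_cball \<rho>" using all \<tau>0 by simp
  then have "n0 (\<phi> (\<gamma> \<tau>) - \<phi> p0) = \<rho>" using \<tau>01(2) by (auto simp: coord_ball_def coord_cball_def)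
  then show ?thesis using that \<tau>01(1) all by blast
qed

text \<open>A path that leaves the open ball has to cover the whole radius first, and this is at
  least the displacement of any end point in the closed ball.\<close>

lemma path_len_lower_bound:
  assumes \<gamma>: "piecewise_C1_path A \<gamma>" "\<gamma> 0 = p0" and \<rho>: "good_radius \<epsilon> \<rho>" and \<epsilon>: "\<epsilon> < 1"
  shows "ennreal ((1 - \<epsilon>) * (if \<gamma> 1 \<in> coord_cball \<rho> then n0 (\<phi> (\<gamma> 1) - \<phi> p0) else \<rho>)) \<le> path_len A g \<gamma>"
proof (cases "\<forall>s\<in>{0..1}. \<gamma> s \<in> coord_ball \<rho>")
  case True
  then have "\<gamma> s \<in> coord_cball \<rho>" if "s \<in> {0..1}" for s
    using that coord_ball_subset by blast
  then show ?thesis using path_len_ge_displacement[OF \<gamma>(1) \<rho> \<epsilon>, of 1] \<gamma>(2) by simp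
next
  case False
  then obtain s where s: "s \<in> {0..1}" "\<gamma> s \<notin> coord_ball \<rho>" by blast
  have "path \<gamma>" using \<gamma> by (simp add: piecewise_C1_path_def)
  then obtain \<tau> where \<tau>: "\<tau> \<in> {0..1}" "n0 (\<phi> (\<gamma> \<tau>) - \<phi> p0) = \<rho>"
    "\<And>s. s \<in> {0..\<tau>} \<Longrightarrow> \<gamma> s \<in> coord_cball \<rho>"
    using path_exit[OF _ \<gamma>(2) _ _ s] \<rho> unfolding good_radius_def by blast
  have "ennreal ((1 - \<epsilon>) * \<rho>) \<le> path_len A g \<gamma>"
    using path_len_ge_displacement[OF \<gamma>(1) \<rho> \<epsilon>, of \<tau>] \<tau> \<gamma>(2) by simp
  moreover have "(1 - \<epsilon>) * (if \<gamma> 1 \<in> coord_cball \<rho> then n0 (\<phi> (\<gamma> 1) - \<phi> p0) else \<rho>) \<le> (1 - \<epsilon>) * \<rho>"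
    using \<epsilon> by (intro mult_left_mono) (auto simp: coord_cball_def)
  ultimately show ?thesis using order_trans[OF ennreal_leI] by blast
qed

lemma riemannian_dist_lower_bound:
  assumes \<rho>: "good_radius \<epsilon> \<rho>" and \<epsilon>: "\<epsilon> < 1"
  shows "p \<in> coord_cball \<rho> \<Longrightarrow> ennreal ((1 - \<epsilon>) * n0 (\<phi> p - \<phi> p0)) \<le> riemannian_dist A g p0 p"
    and "p \<notin> coord_ball \<rho> \<Longrightarrow> ennreal ((1 - \<epsilon>) * \<rho>) \<le> riemannian_dist A g p0 p"
  unfolding riemannian_dist_def
proof -
  have *: "ennreal ((1 - \<epsilon>) * (if p \<in> coord_cball \<rho> then n0 (\<phi> p - \<phi> p0) else \<rho>)) \<le>
      (INF \<gamma>\<in>{\<gamma>. piecewise_C1_path A \<gamma> \<and> pathstart \<gamma> = p0 \<and> pathfinish \<gamma> = p}. path_len A g \<gamma>)"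
  proof (rule INF_greatest)
    fix \<gamma> assume "\<gamma> \<in> {\<gamma>. piecewise_C1_path A \<gamma> \<and> pathstart \<gamma> = p0 \<and> pathfinish \<gamma> = p}"
    then have "piecewise_C1_path A \<gamma>" "\<gamma> 0 = p0" "\<gamma> 1 = p" by (auto simp: pathstart_def pathfinish_def)
    then show "ennreal ((1 - \<epsilon>) * (if p \<in> coord_cball \<rho> then n0 (\<phi> p - \<phi> p0) else \<rho>)) \<le> path_len A g \<gamma>"
      using path_len_lower_bound[OF _ _ \<rho> \<epsilon>, of \<gamma>] by metis
  qed
  show "p \<in> coord_cball \<rho> \<Longrightarrow> ennreal ((1 - \<epsilon>) * n0 (\<phi> p - \<phi> p0)) \<le>
      (INF \<gamma>\<in>{\<gamma>. piecewise_C1_path A \<gamma> \<and> pathstart \<gamma> = p0 \<and> pathfinish \<gamma> = p}. path_len A g \<gamma>)"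
    using * by simp
  assume p: "p \<notin> coord_ball \<rho>"
  have eq: "(if p \<in> coord_cball \<rho> then n0 (\<phi> p - \<phi> p0) else \<rho>) = \<rho>"
  proof (cases "p \<in> coord_cball \<rho>")
    case True
    then have "n0 (\<phi> p - \<phi> p0) = \<rho>"
      using p unfolding coord_cball_def coord_ball_def by (simp add: not_less)
    then show ?thesis using True by simp
  qed simp
  show "ennreal ((1 - \<epsilon>) * \<rho>) \<le>
      (INF \<gamma>\<in>{\<gamma>. piecewise_C1_path A \<gamma> \<and> pathstart \<gamma> = p0 \<and> pathfinish \<gamma> = p}. path_len A g \<gamma>)"
    using * unfolding eq .
qed


section \<open>Upper bounds, continuity and attained minima of distances\<close>

lemma speed_cong:
  assumes "eventually (\<lambda>s. \<gamma> s = \<gamma>' s) (nhds t)"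
  shows "speed A g \<gamma> t = speed A g \<gamma>' t"
proof -
  have eq: "\<gamma> t = \<gamma>' t" using assms by (rule eventually_nhds_x_imp_x)
  have "vector_derivative (snd d \<circ> \<gamma>) (at t) = vector_derivative (snd d \<circ> \<gamma>') (at t)" for d :: "('m, 'e) chart"
  proof -
    have "eventually (\<lambda>s. s \<in> UNIV \<longrightarrow> (snd d \<circ> \<gamma>) s = (snd d \<circ> \<gamma>') s) (nhds t)"
      using assms by eventually_elim simp
    from vector_derivative_cong_eq[OF this refl refl UNIV_I] show ?thesis .
  qed
  then show ?thesis by (simp add: speed_def eq)
qed

text \<open>The end of \<open>\<gamma>\<close> is replaced by a segment in the chart that leads to \<open>p'\<close>. Unlike concatenation, this
  needs no reparametrisation.\<close>

lemma riemannian_dist_le_extended_path: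
  assumes \<rho>: "good_radius \<epsilon> \<rho>" and \<epsilon>: "0 < \<epsilon>"
    and \<gamma>: "piecewise_C1_path A \<gamma>" "\<gamma> 0 = p0" "\<gamma> 1 = p" and p: "p \<in> coord_ball \<rho>"
    and p': "p' \<in> coord_cball \<rho>" and \<eta>: "\<eta> > 0"
  shows "riemannian_dist A g p0 p' \<le> path_len A g \<gamma> + ennreal ((1 + \<epsilon>) * (n0 (\<phi> p' - \<phi> p) + \<eta>))"
proof -
  have path: "path \<gamma>" and cont\<gamma>: "continuous_on {0..1} \<gamma>"
    using \<gamma>(1) by (auto simp: piecewise_C1_path_def path_def)
  have pU: "p \<in> U" and p'U: "p' \<in> U" using p p' by (auto simp: coord_ball_def coord_cball_def)
  \<comment> \<open>The segment needs room in the parameter interval, so the path is cut at some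
    \<open>s < 1\<close>; \<open>\<eta>\<close> accounts for the gap that remains between
    \<open>\<gamma> s\<close> and \<open>p\<close>.\<close>
  obtain s where s: "0 < s" "s < 1" and \<gamma>s: "\<gamma> s \<in> coord_ball \<rho>" "n0 (\<phi> (\<gamma> s) - \<phi> p) < \<eta>"
  proof -
    define O' where "O' = coord_ball \<rho> \<inter> (U \<inter> (\<lambda>x. n0 (\<phi> x - \<phi> p)) -` {..<\<eta>})"
    have "continuous_on U (\<lambda>x. n0 (\<phi> x - \<phi> p))"
      unfolding n0_def by (intro continuous_intros basis chart)
    then have "open (U \<inter> (\<lambda>x. n0 (\<phi> x - \<phi> p)) -` {..<\<eta>})"
      by (rule continuous_open_preimage[OF _ chart(1) open_lessThan])
    then have "open O'" unfolding O'_def by (rule open_Int[OF open_coord_ball])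
    moreover have "\<gamma> 1 \<in> O'" using p pU \<eta> basis \<gamma>(3) by (simp add: O'_def n0_def)
    moreover have "(\<gamma> \<longlongrightarrow> \<gamma> 1) (at 1 within {0..1})" using cont\<gamma> unfolding continuous_on_def by simp
    ultimately have "eventually (\<lambda>t. \<gamma> t \<in> O') (at 1 within {0..1})" by (rule topological_tendstoD[rotated])
    then obtain \<delta> where \<delta>: "\<delta> > 0" "\<And>t. t \<in> {0..1} \<Longrightarrow> t \<noteq> 1 \<Longrightarrow> dist t 1 < \<delta> \<Longrightarrow> \<gamma> t \<in> O'"
      unfolding eventually_at by blast
    define s where "s = max (1 / 2) (1 - \<delta> / 2)"
    have "0 < s" "s < 1" "dist s 1 < \<delta>" using \<delta>(1) by (auto simp: s_def dist_real_def max_def)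
    then show ?thesis using \<delta>(2)[of s] that[of s] by (auto simp: O'_def)
  qed
  define a b where "a = \<phi> (\<gamma> s)" and "b = \<phi> p'"
  define v where "v = (1 / (1 - s)) *\<^sub>R (b - a)"
  define L where "L t = a + ((t - s) / (1 - s)) *\<^sub>R (b - a)" for t
  define \<gamma>2 where "\<gamma>2 t = \<psi> (L t)" for t
  define \<gamma>' where "\<gamma>' t = (if t \<le> s then \<gamma> t else \<gamma>2 t)" for t
  have \<gamma>sU: "\<gamma> s \<in> U" using \<gamma>s by (simp add: coord_ball_def)
  have L_in: "n0 (L t - \<phi> p0) \<le> \<rho>" if "t \<in> {s..1}" for t
    unfolding L_def n0_def
    using that s \<gamma>s(1) p' by (intro coord_norm_segment[OF basis])
      (auto simp: a_def b_def coord_ball_def coord_cball_def n0_def divide_simps)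
  have LU: "L t \<in> \<phi> ` U" if "t \<in> {s..1}" for t
    using L_in[OF that] \<rho> unfolding good_radius_def by blast
  have \<gamma>2: "\<phi> (\<gamma>2 t) = L t" "\<gamma>2 t \<in> coord_cball \<rho>" "\<gamma>2 t \<in> U" if "t \<in> {s..1}" for t
    using chart(6,7)[OF LU[OF that]] L_in[OF that] by (auto simp: \<gamma>2_def coord_cball_def)
  have contL: "continuous_on X L" for X unfolding L_def using s by (intro continuous_intros) auto
  have cont\<gamma>2: "continuous_on {s..1} \<gamma>2"
    unfolding \<gamma>2_def using LU by (intro continuous_on_compose2[OF chart(4) contL]) auto
  have "L s = a" "L 1 = b" using s by (simp_all add: L_def)
  then have ends: "\<gamma>2 s = \<gamma> s" "\<gamma>2 1 = p'"
    using chart(5)[OF \<gamma>sU] chart(5)[OF p'U] by (simp_all add: \<gamma>2_def a_def b_def)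
  have L': "(L has_vector_derivative v) (at t)" for t
  proof -
    have "((\<lambda>t. a + (t - s) *\<^sub>R v) has_vector_derivative v) (at t)"
      by (auto intro!: derivative_eq_intros)
    moreover have "L = (\<lambda>t. a + (t - s) *\<^sub>R v)" by (auto simp: L_def v_def)
    ultimately show ?thesis by simp
  qed
  have iso: "isCont \<gamma>2 t" if "t \<in> {s<..<1}" for t
    using continuous_on_interior[OF cont\<gamma>2, of t] that by (simp add: interior_atLeastAtMost_real)
  have \<gamma>2': "((\<phi> \<circ> \<gamma>2) has_vector_derivative v) (at t)" if t: "t \<in> {s<..<1}" for t
    by (rule has_vector_derivative_transform_within_open[OF L' open_greaterThanLessThan t]) (simp add: \<gamma>2)
  have cont\<gamma>': "continuous_on {0..1} \<gamma>'"
    unfolding \<gamma>'_def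
  proof (rule continuous_on_cases_le)
    show "continuous_on {t \<in> {0..1}. t \<le> s} \<gamma>" by (rule continuous_on_subset[OF cont\<gamma>]) auto
    show "continuous_on {t \<in> {0..1}. s \<le> t} \<gamma>2" by (rule continuous_on_subset[OF cont\<gamma>2]) auto
  qed (use ends in \<open>auto intro: continuous_intros\<close>)
  obtain S where S: "finite S" "\<And>d. d \<in> A \<Longrightarrow> (snd d \<circ> \<gamma>) C1_differentiable_on ({0<..<1} \<inter> \<gamma> -` fst d - S)"
    using \<gamma>(1) unfolding piecewise_C1_path_def by blast
  have C1: "(snd d \<circ> \<gamma>') C1_differentiable_on ({0<..<1} \<inter> \<gamma>' -` fst d - insert s S)" if d: "d \<in> A" for d
  proof -
    obtain D where D: "\<And>t. t \<in> {0<..<1} \<inter> \<gamma> -` fst d - S \<Longrightarrow> ((snd d \<circ> \<gamma>) has_vector_derivative D t) (at t)"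
      "continuous_on ({0<..<1} \<inter> \<gamma> -` fst d - S) D"
      using S(2)[OF d] unfolding C1_differentiable_on_def by blast
    \<comment> \<open>The cut \<open>s\<close> joins the breakpoints. The two pieces then live on
      disjoint open sets, so that the derivative, which may jump at \<open>s\<close>, is continuous
      on their union.\<close>
    define T1 where "T1 = {0<..<s} \<inter> \<gamma> -` fst d - S"
    define T2 where "T2 = {s<..<1} \<inter> \<gamma>2 -` fst d"
    define D2 where "D2 t = frechet_derivative (snd d \<circ> \<psi>) (at (L t)) v" for t
    have T1sub: "T1 \<subseteq> {0<..<1} \<inter> \<gamma> -` fst d - S" using s by (auto simp: T1_def)
    have "open T1" unfolding T1_def using S(1) s
      by (intro open_Diff continuous_open_preimage chart_facts(1)[OF d] continuous_on_subset[OF cont\<gamma>] finite_imp_closed) auto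
    moreover have "open T2" unfolding T2_def using s
      by (intro continuous_open_preimage chart_facts(1)[OF d] continuous_on_subset[OF cont\<gamma>2]) auto
    moreover have "continuous_on T1 (\<lambda>t. if t < s then D t else D2 t)"
      using continuous_on_subset[OF D(2) T1sub] by (rule continuous_on_eq) (auto simp: T1_def)
    moreover have "continuous_on T2 (\<lambda>t. if t < s then D t else D2 t)"
    proof -
      have "L ` T2 \<subseteq> \<phi> ` (U \<inter> fst d)"
      proof
        fix l assume "l \<in> L ` T2"
        then obtain t where t: "t \<in> T2" "l = L t" by blast
        then have "\<gamma>2 t \<in> U \<inter> fst d" "\<phi> (\<gamma>2 t) = l" using \<gamma>2[of t] by (auto simp: T2_def)
        then show "l \<in> \<phi> ` (U \<inter> fst d)" by blast
      qed
      then have "continuous_on T2 D2" unfolding D2_def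
        by (intro continuous_on_compose2[OF transition_continuous[OF d] contL])
      then show ?thesis by (rule continuous_on_eq) (auto simp: T2_def)
    qed
    ultimately have "continuous_on (T1 \<union> T2) (\<lambda>t. if t < s then D t else D2 t)"
      by (rule continuous_on_open_Un)
    moreover have "((snd d \<circ> \<gamma>') has_vector_derivative (if t < s then D t else D2 t)) (at t)"
      if "t \<in> T1 \<union> T2" for t
    proof (cases "t < s")
      case True
      then have t: "t \<in> T1" using that by (auto simp: T2_def)
      have "((snd d \<circ> \<gamma>') has_vector_derivative D t) (at t)"
        using True by (intro has_vector_derivative_transform_within_open[OF D(1)[OF subsetD[OF T1sub t]] open_lessThan[of s]])
          (auto simp: \<gamma>'_def)
      then show ?thesis using True by simp
    next
      case False
      then have t: "t \<in> {s<..<1}" "\<gamma>2 t \<in> fst d" using that by (auto simp: T1_def T2_def)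
      then have "((snd d \<circ> \<gamma>2) has_vector_derivative D2 t) (at t)"
        using chart_change_vector_derivative[OF d iso[OF t(1)] \<gamma>2(3) t(2) \<gamma>2'[OF t(1)]] \<gamma>2(1)[of t]
        by (simp add: D2_def)
      then have "((snd d \<circ> \<gamma>') has_vector_derivative D2 t) (at t)"
        by (rule has_vector_derivative_transform_within_open[OF _ open_greaterThanLessThan t(1)])
          (auto simp: \<gamma>'_def)
      then show ?thesis using False by simp
    qed
    ultimately have "(snd d \<circ> \<gamma>') C1_differentiable_on (T1 \<union> T2)"
      unfolding C1_differentiable_on_def
      by (intro exI[of _ "\<lambda>t. if t < s then D t else D2 t"] conjI ballI)
    moreover have "{0<..<1} \<inter> \<gamma>' -` fst d - insert s S \<subseteq> T1 \<union> T2"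
      by (auto simp: \<gamma>'_def T1_def T2_def split: if_splits)
    ultimately show ?thesis by (rule C1_differentiable_on_subset)
  qed
  have pw: "piecewise_C1_path A \<gamma>'"
    unfolding piecewise_C1_path_def path_def
  proof (intro conjI exI[of _ "insert s S"] ballI)
    show "continuous_on {0..1} \<gamma>'" by (rule cont\<gamma>')
  qed (use C1 S(1) in auto)
  have speed1: "speed A g \<gamma>' t = speed A g \<gamma> t" if "t < s" for t
  proof (rule speed_cong)
    have "eventually (\<lambda>x. x \<in> {..<s}) (nhds t)" using that by (intro eventually_nhds_in_open) auto
    then show "eventually (\<lambda>x. \<gamma>' x = \<gamma> x) (nhds t)" by eventually_elim (simp add: \<gamma>'_def)
  qed
  have speed2: "speed A g \<gamma>' t \<le> (1 + \<epsilon>) * n0 v" if t: "t \<in> {s<..<1}" for t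
  proof -
    have "eventually (\<lambda>x. x \<in> {s<..<1}) (nhds t)" using t by (intro eventually_nhds_in_open) auto
    then have "eventually (\<lambda>x. \<gamma>' x = \<gamma>2 x) (nhds t)" by eventually_elim (simp add: \<gamma>'_def)
    then have "speed A g \<gamma>' t = speed A g \<gamma>2 t" by (rule speed_cong)
    also have "\<dots> = sqrt (g c (\<gamma>2 t) v v)"
      using t by (intro speed_in_chart iso \<gamma>2 \<gamma>2') auto
    also have "\<dots> \<le> (1 + \<epsilon>) * n0 v" using \<gamma>2(2)[of t] t \<rho> unfolding good_radius_def by auto
    finally show ?thesis .
  qed
  \<comment> \<open>The speed of the new path is not controlled at the corner \<open>s\<close> and
    at the end 1, which form a null set.\<close>
  have "path_len A g \<gamma>' = (\<integral>\<^sup>+t. (if t = s \<or> t = 1 then 0 else ennreal (speed A g \<gamma>' t) * indicator {0..1} t) \<partial>lborel)"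
    unfolding path_len_def
  proof (rule nn_integral_cong_AE)
    have "AE t in lborel. t \<noteq> s" "AE t in lborel. t \<noteq> 1" by (rule AE_lborel_singleton)+
    then show "AE t in lborel. ennreal (speed A g \<gamma>' t) * indicator {0..1} t =
      (if t = s \<or> t = 1 then 0 else ennreal (speed A g \<gamma>' t) * indicator {0..1} t)"
      by eventually_elim simp
  qed
  also have "\<dots> \<le> path_len A g \<gamma> + (\<integral>\<^sup>+t. ennreal ((1 + \<epsilon>) * n0 v) * indicator {s..1} t \<partial>lborel)"
    unfolding path_len_def
  proof (rule nn_integral_le_split[of "{s..1}"])
    fix t :: real
    consider "t < s" | "t = s" | "t \<in> {s<..<1}" | "t = 1" | "t > 1" by fastforce
    then show "(if t = s \<or> t = 1 then 0 else ennreal (speed A g \<gamma>' t) * indicator {0..1} t) \<le>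
      (if t \<in> {s..1} then ennreal ((1 + \<epsilon>) * n0 v) * indicator {s..1} t
       else ennreal (speed A g \<gamma> t) * indicator {0..1} t)"
    proof cases
      case 1
      then show ?thesis using speed1[OF 1] s by simp
    next
      case 3
      then show ?thesis using speed2[OF 3] s by (auto intro: ennreal_leI)
    qed (use s in auto)
  qed simp
  also have "(\<integral>\<^sup>+t. ennreal ((1 + \<epsilon>) * n0 v) * indicator {s..1} t \<partial>lborel) = ennreal ((1 + \<epsilon>) * n0 v * (1 - s))"
    using s \<epsilon> by (simp add: nn_integral_cmult_indicator ennreal_mult)
  also have "(1 + \<epsilon>) * n0 v * (1 - s) = (1 + \<epsilon>) * n0 (b - a)"
    using s by (simp add: v_def n0_def coord_norm_scaleR[OF basis])
  also have "ennreal \<dots> \<le> ennreal ((1 + \<epsilon>) * (n0 (\<phi> p' - \<phi> p) + \<eta>))"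
  proof (intro ennreal_leI mult_left_mono)
    show "n0 (b - a) \<le> n0 (\<phi> p' - \<phi> p) + \<eta>"
      using coord_norm_triangle_diff[OF basis, of b a "\<phi> p"] \<gamma>s(2)
        coord_norm_minus_commute[OF basis, of "\<phi> p" a]
      by (simp add: n0_def a_def b_def)
  qed (use \<epsilon> in simp)
  finally have "path_len A g \<gamma>' \<le> path_len A g \<gamma> + ennreal ((1 + \<epsilon>) * (n0 (\<phi> p' - \<phi> p) + \<eta>))"
    by (simp add: add_left_mono)
  moreover have "riemannian_dist A g p0 p' \<le> path_len A g \<gamma>'"
    unfolding riemannian_dist_def using pw \<gamma>(2) ends s
    by (intro INF_lower) (auto simp: pathstart_def pathfinish_def \<gamma>'_def)
  ultimately show ?thesis by (rule order_trans[rotated])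
qed

text \<open>A nearly shortest path to \<open>p\<close> is extended to \<open>p'\<close>. For
  \<open>p = p0\<close> this bounds the distance from above; in general it makes the distance
  continuous in coordinates, as is required for its minimum to be attained.\<close>

lemma riemannian_dist_lipschitz:
  assumes \<rho>: "good_radius \<epsilon> \<rho>" and \<epsilon>: "0 < \<epsilon>" and p: "p \<in> coord_ball \<rho>" and p': "p' \<in> coord_cball \<rho>"
  shows "riemannian_dist A g p0 p' \<le> riemannian_dist A g p0 p + ennreal ((1 + \<epsilon>) * n0 (\<phi> p' - \<phi> p))"
proof (rule ennreal_le_epsilon)
  fix e :: real assume fin: "riemannian_dist A g p0 p + ennreal ((1 + \<epsilon>) * n0 (\<phi> p' - \<phi> p)) < top" and e: "e > 0"
  then have "riemannian_dist A g p0 p < riemannian_dist A g p0 p + ennreal (e / 2)"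
    by (cases "riemannian_dist A g p0 p") (auto simp: ennreal_plus[symmetric] ennreal_less_iff simp del: ennreal_plus)
  then obtain \<gamma> where \<gamma>: "piecewise_C1_path A \<gamma>" "\<gamma> 0 = p0" "\<gamma> 1 = p"
    and len: "path_len A g \<gamma> < riemannian_dist A g p0 p + ennreal (e / 2)"
    unfolding riemannian_dist_def INF_less_iff by (auto simp: pathstart_def pathfinish_def)
  define \<eta> where "\<eta> = e / 2 / (1 + \<epsilon>)"
  have "\<eta> > 0" using e \<epsilon> by (simp add: \<eta>_def)
  have "1 + \<epsilon> \<noteq> 0" using \<epsilon> by linarith
  then have "(1 + \<epsilon>) * \<eta> = e / 2"
    by (metis \<eta>_def nonzero_mult_div_cancel_left times_divide_eq_right)
  note \<eta> = \<open>\<eta> > 0\<close> this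
  have "riemannian_dist A g p0 p' \<le> path_len A g \<gamma> + ennreal ((1 + \<epsilon>) * (n0 (\<phi> p' - \<phi> p) + \<eta>))"
    by (rule riemannian_dist_le_extended_path[OF \<rho> \<epsilon> \<gamma> p p' \<eta>(1)])
  also have "\<dots> \<le> (riemannian_dist A g p0 p + ennreal (e / 2)) + ennreal ((1 + \<epsilon>) * (n0 (\<phi> p' - \<phi> p) + \<eta>))"
    using len by (intro add_right_mono) simp
  also have "(1 + \<epsilon>) * (n0 (\<phi> p' - \<phi> p) + \<eta>) = (1 + \<epsilon>) * n0 (\<phi> p' - \<phi> p) + e / 2"
    unfolding \<eta>(2)[symmetric] by (simp add: algebra_simps)
  also have "ennreal \<dots> = ennreal ((1 + \<epsilon>) * n0 (\<phi> p' - \<phi> p)) + ennreal (e / 2)"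
    using \<epsilon> e by (intro ennreal_plus) auto
  also have "riemannian_dist A g p0 p + ennreal (e / 2) + (ennreal ((1 + \<epsilon>) * n0 (\<phi> p' - \<phi> p)) + ennreal (e / 2))
     = riemannian_dist A g p0 p + ennreal ((1 + \<epsilon>) * n0 (\<phi> p' - \<phi> p)) + (ennreal (e / 2) + ennreal (e / 2))"
    by (simp only: add_ac)
  also have "ennreal (e / 2) + ennreal (e / 2) = ennreal e"
    using e by (simp add: ennreal_plus[symmetric] del: ennreal_plus)
  finally show "riemannian_dist A g p0 p' \<le>
      riemannian_dist A g p0 p + ennreal ((1 + \<epsilon>) * n0 (\<phi> p' - \<phi> p)) + ennreal e" .
qed

lemma riemannian_dist_refl: "riemannian_dist A g p0 p0 = 0"
proof -
  have "path_len A g (\<lambda>_. p0) = 0"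
  proof -
    have "((\<phi> \<circ> (\<lambda>_. p0)) has_vector_derivative 0) (at t)" for t :: real by (simp add: o_def)
    from speed_in_chart[OF _ _ this] have "speed A g (\<lambda>_. p0) t = 0" for t
      using p0U metric_properties(1)[OF p0U] by (simp add: bilinear_lzero)
    then show ?thesis by (simp add: path_len_def)
  qed
  moreover have "piecewise_C1_path A (\<lambda>_. p0)"
    by (auto simp: piecewise_C1_path_def path_def o_def intro!: exI[of _ "{}"])
  ultimately have "riemannian_dist A g p0 p0 \<le> 0"
    unfolding riemannian_dist_def
    by (intro INF_lower2[of "\<lambda>_. p0"]) (auto simp: pathstart_def pathfinish_def)
  then show ?thesis by simp
qed

lemma riemannian_dist_upper_bound:
  assumes \<rho>: "good_radius \<epsilon> \<rho>" and \<epsilon>: "0 < \<epsilon>" and p: "p \<in> coord_cball \<rho>"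
  shows "riemannian_dist A g p0 p \<le> ennreal ((1 + \<epsilon>) * n0 (\<phi> p - \<phi> p0))"
proof -
  have "p0 \<in> coord_ball \<rho>" using p0U \<rho> basis by (simp add: coord_ball_def n0_def good_radius_def)
  from riemannian_dist_lipschitz[OF \<rho> \<epsilon> this p] show ?thesis by (simp add: riemannian_dist_refl)
qed

text \<open>On \<open>K\<close> the distance is finite by the upper bound, and as a real function of
  the coordinates it is Lipschitz.\<close>

lemma riemannian_dist_attains_min:
  assumes \<rho>: "good_radius \<epsilon> \<rho>" and \<epsilon>: "0 < \<epsilon>"
    and K: "compact K" "K \<noteq> {}" "\<And>t. t \<in> K \<Longrightarrow> n0 (t - \<phi> p0) < \<rho>"
  shows "\<exists>t\<in>K. \<forall>t'\<in>K. riemannian_dist A g p0 (\<psi> t) \<le> riemannian_dist A g p0 (\<psi> t')"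
proof -
  let ?d = "\<lambda>t. riemannian_dist A g p0 (\<psi> t)"
  have tU: "t \<in> \<phi> ` U" if "t \<in> K" for t
    using K(3)[OF that] \<rho> unfolding good_radius_def by force
  have in_ball: "\<psi> t \<in> coord_ball \<rho>" if "t \<in> K" for t
    using K(3)[OF that] chart(6,7)[OF tU[OF that]] by (simp add: coord_ball_def)
  have fin: "?d t = ennreal (enn2real (?d t))" if "t \<in> K" for t
  proof -
    have "?d t \<le> ennreal ((1 + \<epsilon>) * n0 (\<phi> (\<psi> t) - \<phi> p0))"
      using subsetD[OF coord_ball_subset in_ball[OF that]] by (rule riemannian_dist_upper_bound[OF \<rho> \<epsilon>])
    then have "?d t < top" using ennreal_less_top by (rule le_less_trans)
    then show ?thesis by simp
  qed
  obtain M where M: "M > 0" "\<And>u. n0 u \<le> M * norm u"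
    using coord_norm_le_norm[OF basis] unfolding n0_def by blast
  have lip: "enn2real (?d t') \<le> enn2real (?d t) + (1 + \<epsilon>) * M * norm (t' - t)" if t: "t \<in> K" "t' \<in> K" for t t'
  proof -
    have "?d t' \<le> ?d t + ennreal ((1 + \<epsilon>) * n0 (\<phi> (\<psi> t') - \<phi> (\<psi> t)))"
      using in_ball t coord_ball_subset by (intro riemannian_dist_lipschitz[OF \<rho> \<epsilon>]) auto
    also have "\<dots> = ennreal (enn2real (?d t) + (1 + \<epsilon>) * n0 (t' - t))"
      unfolding chart(6)[OF tU[OF t(1)]] chart(6)[OF tU[OF t(2)]] using \<epsilon>
      by (subst fin[OF t(1)], subst ennreal_plus[symmetric]) auto
    finally have "enn2real (?d t') \<le> enn2real (?d t) + (1 + \<epsilon>) * n0 (t' - t)"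
      using \<epsilon> by (intro enn2real_leI) auto
    also have "\<dots> \<le> enn2real (?d t) + (1 + \<epsilon>) * (M * norm (t' - t))"
      using M(2) \<epsilon> by (intro add_left_mono mult_left_mono) auto
    finally show ?thesis by (simp add: mult.assoc)
  qed
  have "((1 + \<epsilon>) * M)-lipschitz_on K (\<lambda>t. enn2real (?d t))"
  proof (rule lipschitz_onI)
    fix t t' assume t: "t \<in> K" "t' \<in> K"
    show "dist (enn2real (?d t)) (enn2real (?d t')) \<le> (1 + \<epsilon>) * M * dist t t'"
      using lip[OF t] lip[OF t(2,1)] by (simp add: dist_real_def dist_norm norm_minus_commute abs_le_iff)
  qed (use \<epsilon> M in simp)
  then have "continuous_on K (\<lambda>t. enn2real (?d t))" by (rule lipschitz_on_continuous_on)
  then obtain t where t: "t \<in> K" "\<And>t'. t' \<in> K \<Longrightarrow> enn2real (?d t) \<le> enn2real (?d t')"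
    using continuous_attains_inf[OF K(1,2)] by blast
  have "?d t \<le> ?d t'" if "t' \<in> K" for t'
    using t(2)[OF that] fin[OF that] fin[OF t(1)] by (metis ennreal_leI)
  then show ?thesis using t(1) by blast
qed

end

section \<open>The problem in charts\<close>

lemma chart_inv_product:
  assumes "inj_on (snd c) (fst c)" "inj_on (snd d) (fst d)" "s \<in> snd c ` fst c" "t \<in> snd d ` fst d"
  shows "chart_inv (fst c \<times> fst d, map_prod (snd c) (snd d)) (s, t) = (chart_inv c s, chart_inv d t)"
proof -
  obtain p q where p: "p \<in> fst c" "s = snd c p" and q: "q \<in> fst d" "t = snd d q" using assms by blast
  have "inj_on (map_prod (snd c) (snd d)) (fst c \<times> fst d)"
    using assms(1,2) by (rule map_prod_inj_on)
  then have "inv_into (fst c \<times> fst d) (map_prod (snd c) (snd d)) (map_prod (snd c) (snd d) (p, q)) = (p, q)"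
    using p q by (intro inv_into_f_f) auto
  then show ?thesis using assms p q by (simp add: chart_inv_def)
qed

lemma smooth_manifold_chart_inj:
  assumes "smooth_manifold A" "d \<in> A"
  shows "inj_on (snd d) (fst d)"
  using smooth_manifold_chart(5)[OF assms] by (rule inj_on_inverseI)

text \<open>\<open>h\<close> has to agree with the composition only on a neighbourhood of
  \<open>b\<close>: inverses of charts are unspecified outside the chart images.\<close>

lemma frechet_derivative_substitution:
  assumes f: "(f has_derivative D) (at (j b))" and j: "(j has_derivative J) (at b)"
    and T: "open T" "b \<in> T" and h: "\<And>t. t \<in> T \<Longrightarrow> h t = f (j t)"
  shows "frechet_derivative h (at b) = D \<circ> J"
proof -
  have "((f \<circ> j) has_derivative D \<circ> J) (at b)" using j f by (rule diff_chain_at)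
  then have "(h has_derivative D \<circ> J) (at b)"
    by (rule has_derivative_transform_within_open[OF _ T]) (simp add: h)
  then show ?thesis by (rule frechet_derivative_at[symmetric])
qed

lemma jacobian_mat_eq: "jacobian_mat N c E F p =
    functional_matrix N E (\<lambda>i. frechet_derivative (\<lambda>t. F (chart_inv c t) $ i) (at (snd c p)))"
  by (simp add: jacobian_mat_def functional_matrix_def)

lemma functional_matrix_cong:
  "(\<And>i. i < N \<Longrightarrow> \<phi> i = \<phi>' i) \<Longrightarrow> functional_matrix N E \<phi> = functional_matrix N E \<phi>'"
  by (intro eq_matI) (auto simp: functional_matrix_def)

locale crep_in_charts =
  fixes AX :: "('x::{t2_space, second_countable_topology}, 'ex::real_inner) chart set"
    and AY :: "('y::{t2_space, second_countable_topology}, 'ey::real_inner) chart set"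
    and AZ :: "('z::{t2_space, second_countable_topology}, 'ez::real_inner) chart set"
    and gX :: "('x, 'ex) metric" and gY :: "('y, 'ey) metric"
    and N :: nat and F :: "'x \<times> 'y \<times> 'z \<Rightarrow> real vec" and c :: "real vec"
    and x0 :: 'x and y0 :: 'y and z0 :: 'z
    and cx :: "('x, 'ex) chart" and cy :: "('y, 'ey) chart" and cz :: "('z, 'ez) chart"
    and Ex :: "'ex list" and Ey :: "'ey list" and Ez :: "'ez list"
  assumes crep: "CREP AX AY AZ N F c"
    and gX: "riemannian_metric AX gX" and gY: "riemannian_metric AY gY"
    and solution: "F (x0, y0, z0) = c"
    and cx: "cx \<in> charts_at AX x0" and Ex: "orthonormal_basis_at gX cx x0 Ex"
    and cy: "cy \<in> charts_at AY y0" and Ey: "orthonormal_basis_at gY cy y0 Ey"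
    and cz: "cz \<in> charts_at AZ z0" and Ez: "ordered_basis Ez"
begin

lemma manifolds: "smooth_manifold AX" "smooth_manifold AY" "smooth_manifold AZ"
  using crep by (auto simp: CREP_def)

sublocale X: riemannian_chart AX gX cx x0 Ex
  using manifolds gX cx Ex by unfold_locales
sublocale Y: riemannian_chart AY gY cy y0 Ey
  using manifolds gY cy Ey by unfold_locales

lemma czA: "cz \<in> AZ" and z0U: "z0 \<in> fst cz" using cz by (auto simp: charts_at_def)

definition "\<phi>Z = snd cz"
definition "UZ = fst cz"
definition "\<psi>Z = chart_inv cz"

lemmas chartZ = smooth_manifold_chart[OF manifolds(3) czA, folded \<phi>Z_def UZ_def \<psi>Z_def]

lemma z0UZ: "z0 \<in> UZ" using z0U by (simp add: UZ_def)

definition "cyz = (fst cy \<times> fst cz, map_prod (snd cy) (snd cz))"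
definition "cxyz = (fst cx \<times> fst cyz, map_prod (snd cx) (snd cyz))"
definition "S = (X.\<phi> ` X.U) \<times> (Y.\<phi> ` Y.U) \<times> (\<phi>Z ` UZ)"
text \<open>Defined through the inverse of the product chart, to which the smoothness of
  \<open>F\<close> applies as it is stated; on \<open>S\<close> this inverse splits into the three
  factors by \<open>f_eq\<close>.\<close>

definition "f i q = F (chart_inv cxyz q) $ i"
definition "D i q = frechet_derivative (f i) (at q)"

lemma cyzA: "cyz \<in> prod_atlas AY AZ" and cxyzA: "cxyz \<in> prod_atlas AX (prod_atlas AY AZ)"
  using X.cA Y.cA czA unfolding prod_atlas_def cyz_def cxyz_def by blast+

lemma S_eq: "S = snd cxyz ` fst cxyz"
  by (force simp: S_def cxyz_def cyz_def X.\<phi>_def X.U_def Y.\<phi>_def Y.U_def \<phi>Z_def UZ_def)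

lemma inj_charts: "inj_on (snd cx) (fst cx)" "inj_on (snd cy) (fst cy)" "inj_on (snd cz) (fst cz)"
  "inj_on (snd cyz) (fst cyz)"
proof -
  show 1: "inj_on (snd cx) (fst cx)" "inj_on (snd cy) (fst cy)" "inj_on (snd cz) (fst cz)"
    using smooth_manifold_chart_inj manifolds X.cA Y.cA czA by blast+
  show "inj_on (snd cyz) (fst cyz)" unfolding cyz_def using map_prod_inj_on[OF 1(2,3)] by simp
qed

lemma chart_inv_cyz:
  assumes "y \<in> Y.\<phi> ` Y.U" "z \<in> \<phi>Z ` UZ"
  shows "chart_inv cyz (y, z) = (Y.\<psi> y, \<psi>Z z)"
  using chart_inv_product[OF inj_charts(2,3)] assms
  by (simp add: cyz_def Y.\<phi>_def Y.U_def Y.\<psi>_def \<phi>Z_def UZ_def \<psi>Z_def)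

lemma chart_inv_cxyz:
  assumes "(x, y, z) \<in> S"
  shows "chart_inv cxyz (x, y, z) = (X.\<psi> x, Y.\<psi> y, \<psi>Z z)"
proof -
  have m: "x \<in> snd cx ` fst cx" "(y, z) \<in> snd cyz ` fst cyz" "y \<in> Y.\<phi> ` Y.U" "z \<in> \<phi>Z ` UZ"
    using assms unfolding S_eq cxyz_def by (force simp: S_def[unfolded S_eq] cyz_def Y.\<phi>_def Y.U_def \<phi>Z_def UZ_def)+
  show ?thesis
    using chart_inv_product[OF inj_charts(1,4) m(1,2)] chart_inv_cyz[OF m(3,4)]
    by (simp add: cxyz_def X.\<psi>_def)
qed

lemma f_eq: "(x, y, z) \<in> S \<Longrightarrow> f i (x, y, z) = F (X.\<psi> x, Y.\<psi> y, \<psi>Z z) $ i"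
  by (simp add: f_def chart_inv_cxyz)

lemma open_S: "open S"
  unfolding S_def by (intro open_Times X.chart Y.chart chartZ)

lemma C1_f: assumes "i < N" shows "Ck_on (Suc 0) S (f i)"
proof -
  have "smooth_on (snd cxyz ` fst cxyz) ((\<lambda>p. F p $ i) \<circ> chart_inv cxyz)"
    using crep assms cxyzA unfolding CREP_def smooth_vec_map_def smooth_function_def by blast
  then have "Ck_on (Suc 0) S ((\<lambda>p. F p $ i) \<circ> chart_inv cxyz)"
    unfolding smooth_on_def S_eq by blast
  moreover have "(\<lambda>p. F p $ i) \<circ> chart_inv cxyz = f i" by (auto simp: f_def)
  ultimately show ?thesis by simp
qed

lemma deriv_f: "i < N \<Longrightarrow> q \<in> S \<Longrightarrow> (f i has_derivative D i q) (at q)"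
  using C1_f[of i] unfolding D_def by (simp add: frechet_derivative_works[symmetric])

lemma cont_D: "i < N \<Longrightarrow> continuous_on S (\<lambda>q. D i q v)"
  using C1_f[of i] unfolding D_def Ck_on.simps by blast

definition "q0 = (X.\<phi> x0, Y.\<phi> y0, \<phi>Z z0)"

lemma q0S: "q0 \<in> S" using X.p0U Y.p0U z0UZ by (simp add: q0_def S_def)

lemma partial_derivative:
  assumes i: "i < N" and q: "j b \<in> S" and j: "(j has_derivative J) (at b)"
    and T: "open T" "b \<in> T" "\<And>t. t \<in> T \<Longrightarrow> h t = f i (j t)"
  shows "frechet_derivative h (at b) = (\<lambda>v. D i (j b) (J v))"
  using frechet_derivative_substitution[OF deriv_f[OF i q] j T] by (simp add: o_def)

lemma has_derivative_z: "((\<lambda>z. (x, y, z)) has_derivative (\<lambda>w. (0, 0, w))) (at z)"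
  by (auto intro!: derivative_eq_intros simp: zero_prod_def)
lemma has_derivative_y: "((\<lambda>y. (x, y, z)) has_derivative (\<lambda>w. (0, w, 0))) (at y)"
  by (auto intro!: derivative_eq_intros simp: zero_prod_def)
lemma has_derivative_x: "((\<lambda>x. (x, y, z)) has_derivative (\<lambda>w. (w, 0, 0))) (at x)"
  by (auto intro!: derivative_eq_intros simp: zero_prod_def)
lemma has_derivative_yz: "((\<lambda>w. (x, w)) has_derivative (\<lambda>w. (0, w))) (at w')"
  by (auto intro!: derivative_eq_intros simp: zero_prod_def)

lemma jacobian_z:
  assumes q: "(x, y, z) \<in> S"
  shows "jacobian_mat N cz Ez (\<lambda>z. F (X.\<psi> x, Y.\<psi> y, z)) (\<psi>Z z) =
    functional_matrix N Ez (\<lambda>i w. D i (x, y, z) (0, 0, w))"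
proof -
  have m: "x \<in> X.\<phi> ` X.U" "y \<in> Y.\<phi> ` Y.U" "z \<in> \<phi>Z ` UZ" using q by (auto simp: S_def)
  have "frechet_derivative (\<lambda>t. F (X.\<psi> x, Y.\<psi> y, \<psi>Z t) $ i) (at z) = (\<lambda>w. D i (x, y, z) (0, 0, w))"
    if "i < N" for i
    using that q has_derivative_z chartZ(2) m(3)
    by (rule partial_derivative) (use m in \<open>auto simp: f_eq S_def\<close>)
  then show ?thesis
    unfolding jacobian_mat_eq using chartZ(6)[OF m(3)]
    by (intro functional_matrix_cong) (simp add: \<psi>Z_def \<phi>Z_def)
qed

lemma jacobian_y:
  assumes q: "(x, y, z) \<in> S"
  shows "jacobian_mat N cy Ey (\<lambda>y. F (X.\<psi> x, y, \<psi>Z z)) (Y.\<psi> y) =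
    functional_matrix N Ey (\<lambda>i w. D i (x, y, z) (0, w, 0))"
proof -
  have m: "x \<in> X.\<phi> ` X.U" "y \<in> Y.\<phi> ` Y.U" "z \<in> \<phi>Z ` UZ" using q by (auto simp: S_def)
  have "frechet_derivative (\<lambda>t. F (X.\<psi> x, Y.\<psi> t, \<psi>Z z) $ i) (at y) = (\<lambda>w. D i (x, y, z) (0, w, 0))"
    if "i < N" for i
    using that q has_derivative_y Y.chart(2) m(2)
    by (rule partial_derivative) (use m in \<open>auto simp: f_eq S_def\<close>)
  then show ?thesis
    unfolding jacobian_mat_eq using Y.chart(6)[OF m(2)]
    by (intro functional_matrix_cong) (simp add: Y.\<psi>_def Y.\<phi>_def)
qed

lemma jacobian_x:
  assumes q: "(x, y, z) \<in> S"
  shows "jacobian_mat N cx Ex (\<lambda>x. F (x, Y.\<psi> y, \<psi>Z z)) (X.\<psi> x) =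
    functional_matrix N Ex (\<lambda>i w. D i (x, y, z) (w, 0, 0))"
proof -
  have m: "x \<in> X.\<phi> ` X.U" "y \<in> Y.\<phi> ` Y.U" "z \<in> \<phi>Z ` UZ" using q by (auto simp: S_def)
  have "frechet_derivative (\<lambda>t. F (X.\<psi> t, Y.\<psi> y, \<psi>Z z) $ i) (at x) = (\<lambda>w. D i (x, y, z) (w, 0, 0))"
    if "i < N" for i
    using that q has_derivative_x X.chart(2) m(1)
    by (rule partial_derivative) (use m in \<open>auto simp: f_eq S_def\<close>)
  then show ?thesis
    unfolding jacobian_mat_eq using X.chart(6)[OF m(1)]
    by (intro functional_matrix_cong) (simp add: X.\<psi>_def X.\<phi>_def)
qed

lemma jacobian_yz:
  assumes q: "(x, y, z) \<in> S"
  shows "jacobian_mat N cyz (prod_basis Ey Ez) (\<lambda>w. F (X.\<psi> x, w)) (Y.\<psi> y, \<psi>Z z) =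
    functional_matrix N (prod_basis Ey Ez) (\<lambda>i w. D i (x, y, z) (0, w))"
proof -
  have m: "x \<in> X.\<phi> ` X.U" "y \<in> Y.\<phi> ` Y.U" "z \<in> \<phi>Z ` UZ" using q by (auto simp: S_def)
  have "frechet_derivative (\<lambda>t. F (X.\<psi> x, chart_inv cyz t) $ i) (at (y, z)) = (\<lambda>w. D i (x, y, z) (0, w))"
    if "i < N" for i
    using that q has_derivative_yz open_Times[OF Y.chart(2) chartZ(2)]
    by (rule partial_derivative) (use m in \<open>auto simp: f_eq S_def chart_inv_cyz\<close>)
  moreover have "snd cyz (Y.\<psi> y, \<psi>Z z) = (y, z)"
    using Y.chart(6)[OF m(2)] chartZ(6)[OF m(3)] by (simp add: cyz_def Y.\<phi>_def \<phi>Z_def)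
  ultimately show ?thesis
    unfolding jacobian_mat_eq by (intro functional_matrix_cong) simp
qed

lemma jacobian_xyz:
  assumes q: "(x, y, z) \<in> S"
  shows "jacobian_mat N cxyz E F (X.\<psi> x, Y.\<psi> y, \<psi>Z z) = functional_matrix N E (\<lambda>i. D i (x, y, z))"
proof -
  have "snd cxyz (X.\<psi> x, Y.\<psi> y, \<psi>Z z) = (x, y, z)"
    using q X.chart(6) Y.chart(6) chartZ(6)
    by (auto simp: S_def cxyz_def cyz_def X.\<phi>_def Y.\<phi>_def \<phi>Z_def)
  then show ?thesis
    unfolding jacobian_mat_eq by (intro functional_matrix_cong) (simp add: D_def f_def[abs_def])
qed

lemma base_points: "X.\<psi> (X.\<phi> x0) = x0" "Y.\<psi> (Y.\<phi> y0) = y0" "\<psi>Z (\<phi>Z z0) = z0"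
  using X.chart(5)[OF X.p0U] Y.chart(5)[OF Y.p0U] chartZ(5)[OF z0UZ] by auto

lemma jacobians_at_base:
  "jacobian_mat N cx Ex (\<lambda>x. F (x, y0, z0)) x0 = functional_matrix N Ex (\<lambda>i w. D i q0 (w, 0, 0))"
  "jacobian_mat N cy Ey (\<lambda>y. F (x0, y, z0)) y0 = functional_matrix N Ey (\<lambda>i w. D i q0 (0, w, 0))"
  "jacobian_mat N cz Ez (\<lambda>z. F (x0, y0, z)) z0 = functional_matrix N Ez (\<lambda>i w. D i q0 (0, 0, w))"
  using jacobian_x[OF q0S[unfolded q0_def]] jacobian_y[OF q0S[unfolded q0_def]] jacobian_z[OF q0S[unfolded q0_def]]
  by (simp_all add: base_points q0_def)

text \<open>The rank conditions hold for all charts and bases. Product charts and product bases make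
  the three ranks comparable, as the partial derivatives become restrictions of one and the same
  \<open>D\<close>.\<close>

lemma constant_rank:
  obtains r k where "constant_rank_elimination f D N r k S (X.\<phi> x0) (Y.\<phi> y0) (\<phi>Z z0) Ex Ey Ez"
proof -
  obtain r k where rk: "\<And>x y z. differential_rank (prod_atlas AX (prod_atlas AY AZ)) N F (x, y, z) r"
    "\<And>x y z. differential_rank (prod_atlas AY AZ) N (\<lambda>q. F (x, q)) (y, z) r"
    "\<And>x y z. differential_rank AZ N (\<lambda>z'. F (x, y, z')) z k"
    using crep unfolding CREP_def by blast
  have bases: "ordered_basis (prod_basis Ey Ez)" "ordered_basis (prod_basis Ex (prod_basis Ey Ez))"
    using X.basis Y.basis Ez by (auto intro!: ordered_basis_prod_basis)
  have r1: "vec_space.rank N (functional_matrix N (prod_basis Ex (prod_basis Ey Ez)) (\<lambda>i. D i (x, y, z))) = r"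
    and r2: "vec_space.rank N (functional_matrix N (prod_basis Ey Ez) (\<lambda>i w. D i (x, y, z) (0, w))) = r"
    and r3: "vec_space.rank N (functional_matrix N Ez (\<lambda>i w. D i (x, y, z) (0, 0, w))) = k"
    if q: "(x, y, z) \<in> S" for x y z
  proof -
    have m: "X.\<psi> x \<in> X.U" "Y.\<psi> y \<in> Y.U" "\<psi>Z z \<in> UZ"
      using q X.chart(7) Y.chart(7) chartZ(7) by (auto simp: S_def)
    have ch: "cz \<in> charts_at AZ (\<psi>Z z)" "cyz \<in> charts_at (prod_atlas AY AZ) (Y.\<psi> y, \<psi>Z z)"
      "cxyz \<in> charts_at (prod_atlas AX (prod_atlas AY AZ)) (X.\<psi> x, Y.\<psi> y, \<psi>Z z)"
      using m cyzA cxyzA czA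
      by (auto simp: charts_at_def cyz_def cxyz_def X.U_def Y.U_def UZ_def)
    show "vec_space.rank N (functional_matrix N (prod_basis Ex (prod_basis Ey Ez)) (\<lambda>i. D i (x, y, z))) = r"
      using rk(1) ch(3) bases(2) unfolding differential_rank_def jacobian_xyz[OF q, symmetric] by blast
    show "vec_space.rank N (functional_matrix N (prod_basis Ey Ez) (\<lambda>i w. D i (x, y, z) (0, w))) = r"
      using rk(2) ch(2) bases(1) unfolding differential_rank_def jacobian_yz[OF q, symmetric] by blast
    show "vec_space.rank N (functional_matrix N Ez (\<lambda>i w. D i (x, y, z) (0, 0, w))) = k"
      using rk(3) ch(1) Ez unfolding differential_rank_def jacobian_z[OF q, symmetric] by blast
  qed
  have "constant_rank_elimination f D N r k S (X.\<phi> x0) (Y.\<phi> y0) (\<phi>Z z0) Ex Ey Ez"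
  proof
    show "(X.\<phi> x0, Y.\<phi> y0, \<phi>Z z0) \<in> S" using q0S by (simp add: q0_def)
    then show "vec_space.rank N (functional_matrix N (prod_basis Ey Ez) (\<lambda>i w. D i (X.\<phi> x0, Y.\<phi> y0, \<phi>Z z0) (0, w))) = r"
      by (rule r2)
    show "(f i has_derivative D i q) (at q)" if "i < N" "q \<in> S" for i q using that by (rule deriv_f)
    show "continuous_on S (\<lambda>q. D i q v)" if "i < N" for i v using that by (rule cont_D)
    show "vec_space.rank N (functional_matrix N (prod_basis Ex (prod_basis Ey Ez)) (\<lambda>i. D i q)) = r"
      if "q \<in> S" for q using r1 that by (cases q) simp
    show "vec_space.rank N (functional_matrix N Ez (\<lambda>i w. D i q (0, 0, w))) = k"
      if "q \<in> S" for q using r3 that by (cases q) simp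
  qed (use X.basis Y.basis Ez open_S in auto)
  then show ?thesis by (rule that)
qed

lemma F_eq_c_iff:
  assumes "(x, y, z) \<in> S"
  shows "F (X.\<psi> x, Y.\<psi> y, \<psi>Z z) = c \<longleftrightarrow> (\<forall>i<N. f i (x, y, z) = f i q0)"
proof -
  have car: "F p \<in> carrier_vec N" for p
    using crep unfolding CREP_def smooth_vec_map_def by blast
  have "f i q0 = c $ i" for i
    using f_eq[OF q0S[unfolded q0_def]] by (simp add: base_points solution q0_def)
  moreover have "c \<in> carrier_vec N" using car[of "(x0, y0, z0)"] solution by simp
  ultimately show ?thesis
    using car[of "(X.\<psi> x, Y.\<psi> y, \<psi>Z z)"] by (auto simp: f_eq[OF assms] intro!: eq_vecI)
qed

end

section \<open>First-order behaviour of the solution set\<close>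

lemma coord_vec_add: "ordered_basis E \<Longrightarrow> coord_vec E (u + v) = coord_vec E u + coord_vec E v"
  by (intro eq_vecI) (auto simp: coord_vec_def linear_add[OF linear_coord])

lemma coord_vec_scaleR: "ordered_basis E \<Longrightarrow> coord_vec E (a *\<^sub>R u) = a \<cdot>\<^sub>v coord_vec E u"
  by (intro eq_vecI) (auto simp: coord_vec_def linear_cmul[OF linear_coord])

lemma of_coords_add: "a \<in> carrier_vec (length E) \<Longrightarrow> b \<in> carrier_vec (length E) \<Longrightarrow> of_coords E (a + b) = of_coords E a + of_coords E b"
  by (simp add: of_coords_def scaleR_left_distrib sum.distrib)

lemma of_coords_smult: "a \<in> carrier_vec (length E) \<Longrightarrow> of_coords E (s \<cdot>\<^sub>v a) = s *\<^sub>R of_coords E a"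
  by (simp add: of_coords_def scaleR_sum_right)

locale crep_with_left_inverse =
  crep_in_charts AX AY AZ gX gY N F c x0 y0 z0 cx cy cz Ex Ey Ez +
  LE: linear_elimination Jx Jy Jz Q Uy Uz N "length Ex" "length Ey" "length Ez" q u
  for AX :: "('x::{t2_space, second_countable_topology}, 'ex::real_inner) chart set"
    and AY :: "('y::{t2_space, second_countable_topology}, 'ey::real_inner) chart set"
    and AZ :: "('z::{t2_space, second_countable_topology}, 'ez::real_inner) chart set"
    and gX gY N F c x0 y0 z0 cx cy cz Ex Ey Ez Jx Jy Jz Q Uy Uz q u +
  fixes A' :: "real mat"
  assumes J: "Jx = jacobian_mat N cx Ex (\<lambda>x. F (x, y0, z0)) x0"
      "Jy = jacobian_mat N cy Ey (\<lambda>y. F (x0, y, z0)) y0"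
      "Jz = jacobian_mat N cz Ez (\<lambda>z. F (x0, y0, z)) z0"
    and A': "A' \<in> carrier_mat (length Ey) (q + u)" "A' * LE.A = 1\<^sub>m (length Ey)"
begin

definition "M = A' * LE.B"
text \<open>The first-order solution map: \<open>A' * B\<close>, transported from coordinates to the
  model spaces.\<close>

definition "L d = of_coords Ey (M *\<^sub>v coord_vec Ex d)"

lemma M: "M \<in> carrier_mat (length Ey) (length Ex)"
  using A'(1) LE.B_carrier by (simp add: M_def)

lemma coord_vec_L: "coord_vec Ey (L d) = M *\<^sub>v coord_vec Ex d"
  unfolding L_def using M by (intro coord_vec_of_coords Y.basis) auto

lemma n0_L: "Y.n0 (L d) = vnorm (M *\<^sub>v coord_vec Ex d)"
  by (simp add: Y.n0_def coord_norm_eq_vnorm coord_vec_L)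

lemma n0_X: "X.n0 d = vnorm (coord_vec Ex d)"
  by (simp add: X.n0_def coord_norm_eq_vnorm)

lemma n0_L_le: "Y.n0 (L d) \<le> mat_norm2 M * X.n0 d"
  unfolding n0_L n0_X by (rule vnorm_mult_le_mat_norm2[OF M]) simp

lemma linear_L: "linear L"
proof (rule linearI)
  have c: "M *\<^sub>v coord_vec Ex d \<in> carrier_vec (length Ey)" for d using M by auto
  show "L (d + e) = L d + L e" for d e
    by (simp add: L_def coord_vec_add[OF X.basis] mult_add_distrib_mat_vec[OF M] of_coords_add c)
  show "L (r *\<^sub>R d) = r *\<^sub>R L d" for r d
    by (simp add: L_def coord_vec_scaleR[OF X.basis] mult_mat_vec[OF M] of_coords_smult c)
qed

lemma bounded_linear_L: "bounded_linear L"
  using ordered_basis_finite_span[OF X.basis] linear_L by (rule linear_imp_bounded_linear)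

lemma linear_D: "i < N \<Longrightarrow> linear (D i q0)"
  using deriv_f[OF _ q0S] by (rule has_derivative_linear)

lemma J_eq: "Jx = functional_matrix N Ex (\<lambda>i w. D i q0 (w, 0, 0))"
  "Jy = functional_matrix N Ey (\<lambda>i w. D i q0 (0, w, 0))"
  "Jz = functional_matrix N Ez (\<lambda>i w. D i q0 (0, 0, w))"
  unfolding J by (rule jacobians_at_base)+

lemma J_sum: "Jx *\<^sub>v coord_vec Ex d + Jy *\<^sub>v coord_vec Ey a + Jz *\<^sub>v coord_vec Ez b =
    vec N (\<lambda>i. D i q0 (d, a, b))"
proof -
  have lin: "linear (\<lambda>w. D i q0 (w, 0, 0))" "linear (\<lambda>w. D i q0 (0, w, 0))" "linear (\<lambda>w. D i q0 (0, 0, w))"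
    if "i < N" for i
    using linear_compose[OF has_derivative_linear[OF has_derivative_x] linear_D[OF that]]
      linear_compose[OF has_derivative_linear[OF has_derivative_y] linear_D[OF that]]
      linear_compose[OF has_derivative_linear[OF has_derivative_z] linear_D[OF that]]
    by (simp_all add: o_def)
  have "Jx *\<^sub>v coord_vec Ex d = vec N (\<lambda>i. D i q0 (d, 0, 0))"
    unfolding J_eq by (rule functional_matrix_mult_coord_vec[OF lin(1) X.basis])
  moreover have "Jy *\<^sub>v coord_vec Ey a = vec N (\<lambda>i. D i q0 (0, a, 0))"
    unfolding J_eq by (rule functional_matrix_mult_coord_vec[OF lin(2) Y.basis])
  moreover have "Jz *\<^sub>v coord_vec Ez b = vec N (\<lambda>i. D i q0 (0, 0, b))"
    unfolding J_eq by (rule functional_matrix_mult_coord_vec[OF lin(3) Ez])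
  moreover have "D i q0 (d, 0, 0) + (D i q0 (0, a, 0) + D i q0 (0, 0, b)) = D i q0 (d, a, b)" if "i < N" for i
    by (simp flip: linear_add[OF linear_D[OF that]])
  ultimately show ?thesis by (intro eq_vecI) auto
qed

text \<open>The latent part \<open>W d\<close> is first chosen for each \<open>d\<close> separately
  and need not be linear. Extending its values on the basis linearly preserves the equations,
  because \<open>L\<close> and the derivative are linear.\<close>

lemma linear_solution_with_L:
  obtains R where "bounded_linear R" "\<And>i d. i < N \<Longrightarrow> D i q0 (d, L d, R d) = 0"
proof -
  obtain r k where "constant_rank_elimination f D N r k S (X.\<phi> x0) (Y.\<phi> y0) (\<phi>Z z0) Ex Ey Ez"
    by (rule constant_rank)
  then interpret E: constant_rank_elimination f D N r k S "X.\<phi> x0" "Y.\<phi> y0" "\<phi>Z z0" Ex Ey Ez .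
  have "\<exists>w. \<forall>i<N. D i q0 (d, L d, w) = 0" for d
  proof -
    obtain a b where ab: "\<forall>i<N. D i q0 (d, a, b) = 0"
      using E.linear_equation_solvable[of d, folded q0_def] by blast
    have "Jx *\<^sub>v coord_vec Ex d + Jy *\<^sub>v coord_vec Ey a + Jz *\<^sub>v coord_vec Ez b = 0\<^sub>v N"
      unfolding J_sum using ab by (intro eq_vecI) auto
    then obtain w where w: "w \<in> carrier_vec (length Ez)"
      "Jx *\<^sub>v coord_vec Ex d + Jy *\<^sub>v (M *\<^sub>v coord_vec Ex d) + Jz *\<^sub>v w = 0\<^sub>v N"
      using LE.left_inverse_solves[OF A' coord_vec_carrier coord_vec_carrier coord_vec_carrier]
      unfolding M_def by blast
    have "vec N (\<lambda>i. D i q0 (d, L d, of_coords Ez w)) = 0\<^sub>v N"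
      using w(2) unfolding J_sum[symmetric] coord_vec_L coord_vec_of_coords[OF Ez w(1)] .
    then have "\<forall>i<N. D i q0 (d, L d, of_coords Ez w) = 0" by (metis index_vec index_zero_vec(1))
    then show ?thesis by blast
  qed
  then obtain W where W: "\<And>d i. i < N \<Longrightarrow> D i q0 (d, L d, W d) = 0" by metis
  define R where "R d = (\<Sum>j<length Ex. coord Ex j d *\<^sub>R W (Ex ! j))" for d
  have "bounded_linear R" unfolding R_def
    by (intro bounded_linear_sum bounded_linear_compose[OF bounded_linear_scaleR_left] bounded_linear_coord X.basis)
  moreover have "D i q0 (d, L d, R d) = 0" if i: "i < N" for i d
  proof -
    have d: "(\<Sum>j<length Ex. coord Ex j d *\<^sub>R Ex ! j) = d" by (rule coord_expansion[OF X.basis])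
    have "L d = L (\<Sum>j<length Ex. coord Ex j d *\<^sub>R Ex ! j)" by (simp only: d)
    also have "\<dots> = (\<Sum>j<length Ex. coord Ex j d *\<^sub>R L (Ex ! j))"
      by (simp only: linear_sum[OF linear_L] linear_cmul[OF linear_L])
    finally have Ld: "L d = (\<Sum>j<length Ex. coord Ex j d *\<^sub>R L (Ex ! j))" .
    have "(d, L d, R d) = (\<Sum>j<length Ex. coord Ex j d *\<^sub>R (Ex ! j, L (Ex ! j), W (Ex ! j)))"
      by (simp add: prod_eq_iff fst_sum snd_sum d Ld R_def)
    then have "D i q0 (d, L d, R d) = (\<Sum>j<length Ex. coord Ex j d * D i q0 (Ex ! j, L (Ex ! j), W (Ex ! j)))"
      by (simp only: linear_sum[OF linear_D[OF i]] linear_cmul[OF linear_D[OF i]] real_scaleR_def)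
    then show ?thesis using W[OF i] by simp
  qed
  ultimately show ?thesis by (rule that)
qed

lemma norm_bounds:
  obtains K where "K \<ge> 1" "\<And>d. norm d \<le> K * X.n0 d" "\<And>d. X.n0 d \<le> K * norm d"
    "\<And>a. norm a \<le> K * Y.n0 a" "\<And>a. Y.n0 a \<le> K * norm a"
proof -
  obtain K1 where 1: "K1 > 0" "\<And>d. norm d \<le> K1 * X.n0 d" using norm_le_coord_norm[OF X.basis] unfolding X.n0_def by blast
  obtain K2 where 2: "K2 > 0" "\<And>d. X.n0 d \<le> K2 * norm d" using coord_norm_le_norm[OF X.basis] unfolding X.n0_def by blast
  obtain K3 where 3: "K3 > 0" "\<And>d. norm d \<le> K3 * Y.n0 d" using norm_le_coord_norm[OF Y.basis] unfolding Y.n0_def by blast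
  obtain K4 where 4: "K4 > 0" "\<And>d. Y.n0 d \<le> K4 * norm d" using coord_norm_le_norm[OF Y.basis] unfolding Y.n0_def by blast
  let ?K = "K1 + K2 + K3 + K4 + 1"
  show ?thesis
  proof (rule that[of ?K])
    show "norm d \<le> ?K * X.n0 d" for d
      by (rule order_trans[OF 1(2) mult_right_mono]) (use 1(1) 2(1) 3(1) 4(1) in auto)
    show "X.n0 d \<le> ?K * norm d" for d
      by (rule order_trans[OF 2(2) mult_right_mono]) (use 1(1) 2(1) 3(1) 4(1) in auto)
    show "norm d \<le> ?K * Y.n0 d" for d
      by (rule order_trans[OF 3(2) mult_right_mono]) (use 1(1) 2(1) 3(1) 4(1) in auto)
    show "Y.n0 d \<le> ?K * norm d" for d
      by (rule order_trans[OF 4(2) mult_right_mono]) (use 1(1) 2(1) 3(1) 4(1) in auto)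
  qed (use 1 2 3 4 in simp)
qed

text \<open>The latent bound has a constant of its own that does not shrink with
  \<open>\<epsilon>\<close>: it only has to keep the latent variable in \<open>Zh\<close> for small
  \<open>d\<close>.\<close>

definition solution_near_L :: "real \<Rightarrow> real \<Rightarrow> 'ex \<Rightarrow> bool" where
  "solution_near_L \<epsilon> K d \<longleftrightarrow> (\<exists>y z. Y.n0 (y - (Y.\<phi> y0 + L d)) \<le> \<epsilon> * X.n0 d \<and>
    norm (z - \<phi>Z z0) \<le> K * X.n0 d \<and> (\<forall>i<N. f i (X.\<phi> x0 + d, y, z) = f i q0))"

lemma solution_close_to_L:
  obtains K where "K \<ge> 0" "\<And>\<epsilon>. \<epsilon> > 0 \<Longrightarrow> \<exists>\<delta>>0. \<forall>d. X.n0 d < \<delta> \<longrightarrow> solution_near_L \<epsilon> K d"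
proof -
  obtain r k where "constant_rank_elimination f D N r k S (X.\<phi> x0) (Y.\<phi> y0) (\<phi>Z z0) Ex Ey Ez"
    by (rule constant_rank)
  then interpret E: constant_rank_elimination f D N r k S "X.\<phi> x0" "Y.\<phi> y0" "\<phi>Z z0" Ex Ey Ez .
  obtain R where R: "bounded_linear R" "\<And>i d. i < N \<Longrightarrow> D i q0 (d, L d, R d) = 0"
    using linear_solution_with_L by blast
  obtain KR where KR: "KR \<ge> 0" "\<And>d. norm (R d) \<le> norm d * KR"
    using bounded_linear.nonneg_bounded[OF R(1)] by blast
  obtain K where K: "K \<ge> 1" "\<And>d. norm d \<le> K * X.n0 d" "\<And>d. X.n0 d \<le> K * norm d"
    "\<And>a. norm a \<le> K * Y.n0 a" "\<And>a. Y.n0 a \<le> K * norm a"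
    by (rule norm_bounds) (rule that; blast)
  show ?thesis
  proof (rule that[of "(1 + KR) * K"])
    show "(1 + KR) * K \<ge> 0" using KR K(1) by simp
    fix \<epsilon> :: real assume \<epsilon>: "\<epsilon> > 0"
    \<comment> \<open>The two factors \<open>K\<close> convert norms of the model spaces to
      coordinate norms, once for outputs and once for inputs. The cap 1 keeps the latent bound
      independent of \<open>\<epsilon>\<close>.\<close>
    define e where "e = min 1 (\<epsilon> / (K * K))"
    have e: "e > 0" "e \<le> 1" "e * (K * K) \<le> \<epsilon>"
      using \<epsilon> K(1) by (auto simp: e_def min_le_iff_disj pos_le_divide_eq[symmetric])
    have sol: "D i (X.\<phi> x0, Y.\<phi> y0, \<phi>Z z0) (d, L d, R d) = 0" if "i < N" for i d
      using R(2)[OF that] by (simp add: q0_def)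
    have "\<exists>\<delta>>0. \<forall>d. norm d < \<delta> \<longrightarrow> (\<exists>y z. norm (y - (Y.\<phi> y0 + L d)) \<le> e * norm d \<and>
      norm (z - (\<phi>Z z0 + R d)) \<le> e * norm d \<and> (\<forall>i<N. f i (X.\<phi> x0 + d, y, z) = f i q0))"
      using E.solution_along_linear_map[OF bounded_linear_L R(1) sol e(1), folded q0_def] by metis
    then obtain \<delta> where \<delta>: "\<delta> > 0" "\<And>d. norm d < \<delta> \<Longrightarrow> \<exists>y z. norm (y - (Y.\<phi> y0 + L d)) \<le> e * norm d \<and>
      norm (z - (\<phi>Z z0 + R d)) \<le> e * norm d \<and> (\<forall>i<N. f i (X.\<phi> x0 + d, y, z) = f i q0)"
      by auto
    have "solution_near_L \<epsilon> ((1 + KR) * K) d" if d: "X.n0 d < \<delta> / K" for d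
    proof -
      have "K * X.n0 d < \<delta>" using d K(1) by (simp add: pos_less_divide_eq mult.commute)
      then have "norm d < \<delta>" using K(2)[of d] by linarith
      then obtain y z where yz: "norm (y - (Y.\<phi> y0 + L d)) \<le> e * norm d"
        "norm (z - (\<phi>Z z0 + R d)) \<le> e * norm d" "\<forall>i<N. f i (X.\<phi> x0 + d, y, z) = f i q0"
        using \<delta>(2) by blast
      have "Y.n0 (y - (Y.\<phi> y0 + L d)) \<le> K * norm (y - (Y.\<phi> y0 + L d))" by (rule K(5))
      also have "\<dots> \<le> K * (e * (K * X.n0 d))"
      proof (rule mult_left_mono)
        show "norm (y - (Y.\<phi> y0 + L d)) \<le> e * (K * X.n0 d)"
          using yz(1) mult_left_mono[OF K(2)[of d], of e] e(1) by linarith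
      qed (use K(1) in simp)
      also have "\<dots> = (e * (K * K)) * X.n0 d" by simp
      also have "\<dots> \<le> \<epsilon> * X.n0 d" using e(3) by (intro mult_right_mono) auto
      finally have 1: "Y.n0 (y - (Y.\<phi> y0 + L d)) \<le> \<epsilon> * X.n0 d" .
      have "norm (z - \<phi>Z z0) \<le> norm (z - (\<phi>Z z0 + R d)) + norm (R d)"
        using norm_triangle_ineq[of "z - (\<phi>Z z0 + R d)" "R d"] by (simp add: algebra_simps)
      also have "\<dots> \<le> 1 * norm d + norm d * KR"
        using yz(2) KR(2)[of d] mult_right_mono[OF e(2), of "norm d"] by simp
      also have "\<dots> = (1 + KR) * norm d" by (simp add: algebra_simps)
      also have "\<dots> \<le> (1 + KR) * (K * X.n0 d)" using K KR by (intro mult_left_mono) auto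
      finally have 2: "norm (z - \<phi>Z z0) \<le> (1 + KR) * K * X.n0 d" by (simp add: mult.assoc)
      show ?thesis unfolding solution_near_L_def using 1 2 yz(3) by blast
    qed
    then show "\<exists>\<delta>>0. \<forall>d. X.n0 d < \<delta> \<longrightarrow> solution_near_L \<epsilon> ((1 + KR) * K) d"
      using \<delta>(1) K(1) by (intro exI[of _ "\<delta> / K"]) auto
  qed
qed

lemma latent_close:
  obtains \<rho> C where "\<rho> > 0" "C \<ge> 0"
    "\<And>d a w. X.n0 d < \<rho> \<Longrightarrow> Y.n0 a < \<rho> \<Longrightarrow> norm w < \<rho> \<Longrightarrow> (X.\<phi> x0 + d, Y.\<phi> y0 + a, \<phi>Z z0 + w) \<in> S"
    "\<And>d a w. X.n0 d < \<rho> \<Longrightarrow> Y.n0 a < \<rho> \<Longrightarrow> norm w < \<rho> \<Longrightarrow>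
      (\<And>i. i < N \<Longrightarrow> f i (X.\<phi> x0 + d, Y.\<phi> y0 + a, \<phi>Z z0 + w) = f i q0) \<Longrightarrow>
      \<exists>w'. norm w' \<le> C * (X.n0 d + Y.n0 a) \<and> (\<forall>i<N. f i (X.\<phi> x0 + d, Y.\<phi> y0 + a, \<phi>Z z0 + w') = f i q0)"
proof -
  obtain r k where "constant_rank_elimination f D N r k S (X.\<phi> x0) (Y.\<phi> y0) (\<phi>Z z0) Ex Ey Ez"
    by (rule constant_rank)
  then interpret E: constant_rank_elimination f D N r k S "X.\<phi> x0" "Y.\<phi> y0" "\<phi>Z z0" Ex Ey Ez .
  obtain \<rho> C where \<rho>: "\<rho> > 0" "C \<ge> 0" "ball q0 \<rho> \<subseteq> S"
    "\<And>x y z. (x, y, z) \<in> ball q0 \<rho> \<Longrightarrow> (\<And>i. i < N \<Longrightarrow> f i (x, y, z) = f i q0) \<Longrightarrow>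
      \<exists>\<zeta>. norm (\<zeta> - \<phi>Z z0) \<le> C * norm ((x, y) - (X.\<phi> x0, Y.\<phi> y0)) \<and> (\<forall>i<N. f i (x, y, \<zeta>) = f i q0)"
    by (rule E.latent_near_z0[folded q0_def]) blast
  obtain K where K: "K \<ge> 1" "\<And>d. norm d \<le> K * X.n0 d" "\<And>d. X.n0 d \<le> K * norm d"
    "\<And>a. norm a \<le> K * Y.n0 a" "\<And>a. Y.n0 a \<le> K * norm a"
    by (rule norm_bounds) (rule that; blast)
  \<comment> \<open>One third of the radius for each of the three components; \<open>K\<close>
    converts the coordinate norms of the first two.\<close>
  have in_ball: "(X.\<phi> x0 + d, Y.\<phi> y0 + a, \<phi>Z z0 + w) \<in> ball q0 \<rho>"
    if "X.n0 d < \<rho> / (3 * K)" "Y.n0 a < \<rho> / (3 * K)" "norm w < \<rho> / (3 * K)" for d a w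
  proof -
    have "norm (d, a, w) \<le> norm d + (norm a + norm w)"
      using norm_Pair_le[of d "(a, w)"] norm_Pair_le[of a w] by linarith
    moreover have "K * X.n0 d < \<rho> / 3" "K * Y.n0 a < \<rho> / 3"
      using that K(1) by (simp_all add: pos_less_divide_eq mult_ac)
    moreover have "norm w < \<rho> / 3"
    proof -
      have "\<rho> / (3 * K) \<le> \<rho> / 3" using K(1) \<rho>(1) by (intro divide_left_mono) auto
      then show ?thesis using that(3) by linarith
    qed
    ultimately have "norm (d, a, w) < \<rho>" using K(2)[of d] K(4)[of a] by linarith
    then show ?thesis
      by (simp only: mem_ball dist_norm norm_minus_commute[of q0]) (simp add: q0_def)
  qed
  show ?thesis
  proof (rule that[of "\<rho> / (3 * K)" "C * K"])
    show "\<rho> / (3 * K) > 0" "C * K \<ge> 0" using \<rho>(1,2) K(1) by auto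
    fix d :: 'ex and a :: 'ey and w :: 'ez assume d: "X.n0 d < \<rho> / (3 * K)" "Y.n0 a < \<rho> / (3 * K)" "norm w < \<rho> / (3 * K)"
    show "(X.\<phi> x0 + d, Y.\<phi> y0 + a, \<phi>Z z0 + w) \<in> S" using in_ball[OF d] \<rho>(3) by blast
    assume "\<And>i. i < N \<Longrightarrow> f i (X.\<phi> x0 + d, Y.\<phi> y0 + a, \<phi>Z z0 + w) = f i q0"
    from \<rho>(4)[OF in_ball[OF d] this] obtain \<zeta> where \<zeta>:
      "norm (\<zeta> - \<phi>Z z0) \<le> C * norm ((X.\<phi> x0 + d, Y.\<phi> y0 + a) - (X.\<phi> x0, Y.\<phi> y0))"
      "\<forall>i<N. f i (X.\<phi> x0 + d, Y.\<phi> y0 + a, \<zeta>) = f i q0" by blast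
    have "norm (\<zeta> - \<phi>Z z0) \<le> C * norm (d, a)" using \<zeta>(1) by simp
    also have "\<dots> \<le> C * (K * X.n0 d + K * Y.n0 a)"
      using norm_Pair_le[of d a] K(2)[of d] K(4)[of a] \<rho>(2) by (intro mult_left_mono) auto
    finally have "norm (\<zeta> - \<phi>Z z0) \<le> C * K * (X.n0 d + Y.n0 a)" by (simp add: algebra_simps)
    then show "\<exists>w'. norm w' \<le> C * K * (X.n0 d + Y.n0 a) \<and>
      (\<forall>i<N. f i (X.\<phi> x0 + d, Y.\<phi> y0 + a, \<phi>Z z0 + w') = f i q0)"
      using \<zeta>(2) by (intro exI[of _ "\<zeta> - \<phi>Z z0"]) auto
  qed
qed

text \<open>If \<open>a\<close> and \<open>w\<close> are of the order of \<open>d\<close>, an exact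
  solution satisfies the linearised equation up to \<open>o(d)\<close>, and
  \<open>left_inverse_lower_bound\<close> applies with that residual. For the canonical solution,
  \<open>latent_close\<close> will provide such a \<open>w\<close>.\<close>

lemma solution_not_closer_than_L:
  assumes C: "C \<ge> 0" and \<epsilon>: "\<epsilon> > 0"
  obtains \<delta> where "\<delta> > 0" "\<And>d a w. X.n0 d < \<delta> \<Longrightarrow> Y.n0 a \<le> C * X.n0 d \<Longrightarrow> norm w \<le> C * X.n0 d \<Longrightarrow>
      (\<And>i. i < N \<Longrightarrow> f i (X.\<phi> x0 + d, Y.\<phi> y0 + a, \<phi>Z z0 + w) = f i q0) \<Longrightarrow>
      Y.n0 (L d) \<le> Y.n0 a + \<epsilon> * X.n0 d"
proof -
  obtain K where K: "K \<ge> 1" "\<And>d. norm d \<le> K * X.n0 d" "\<And>d. X.n0 d \<le> K * norm d"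
    "\<And>a. norm a \<le> K * Y.n0 a" "\<And>a. Y.n0 a \<le> K * norm a"
    by (rule norm_bounds) (rule that; blast)
  obtain KA where KA: "KA \<ge> 0" "\<And>d a b. d \<in> carrier_vec (length Ex) \<Longrightarrow> a \<in> carrier_vec (length Ey) \<Longrightarrow>
    b \<in> carrier_vec (length Ez) \<Longrightarrow>
    vnorm (M *\<^sub>v d) \<le> vnorm a + KA * (\<Sum>i<N. \<bar>(Jx *\<^sub>v d + Jy *\<^sub>v a + Jz *\<^sub>v b) $ i\<bar>)"
    using LE.left_inverse_lower_bound[OF A'] unfolding M_def by blast
  \<comment> \<open>\<open>M' * X.n0 d\<close> bounds the norm of the whole increment. Then
    \<open>e\<close> is such that \<open>N\<close> remainders, multiplied by \<open>KA\<close>, add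
    up to at most \<open>\<epsilon> * X.n0 d\<close>.\<close>
  define M' where "M' = K + K * C + C"
  have M': "M' > 0" using K(1) C by (auto simp: M'_def intro!: add_pos_nonneg)
  define e where "e = \<epsilon> / (KA * real N * M' + 1)"
  have pos: "KA * real N * M' + 1 > 0" using KA(1) M' by (intro add_nonneg_pos mult_nonneg_nonneg) auto
  have e: "e > 0" "KA * real N * M' * e \<le> \<epsilon>"
  proof -
    show "e > 0" using \<epsilon> pos by (simp add: e_def)
    have "(KA * real N * M' + 1) * e = \<epsilon>" using pos unfolding e_def by (metis less_irrefl nonzero_mult_div_cancel_left times_divide_eq_right)
    then show "KA * real N * M' * e \<le> \<epsilon>" using \<open>e > 0\<close> by (simp add: distrib_right)
  qed
  have "\<exists>r>0. \<forall>i\<in>{..<N}. \<forall>q. norm (q - q0) < r \<longrightarrow> \<bar>f i q - f i q0 - D i q0 (q - q0)\<bar> \<le> e * norm (q - q0)"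
  proof (rule common_radius)
    fix i assume "i \<in> {..<N}"
    then have "(f i has_derivative D i q0) (at q0)" using deriv_f q0S by auto
    then show "\<exists>r>0. \<forall>q. norm (q - q0) < r \<longrightarrow> \<bar>f i q - f i q0 - D i q0 (q - q0)\<bar> \<le> e * norm (q - q0)"
      unfolding has_derivative_at_alt using e(1) by auto
  qed auto
  then obtain r where r: "r > 0" "\<And>i q. i < N \<Longrightarrow> norm (q - q0) < r \<Longrightarrow>
      \<bar>f i q - f i q0 - D i q0 (q - q0)\<bar> \<le> e * norm (q - q0)" by blast
  show ?thesis
  proof (rule that[of "r / M'"])
    show "r / M' > 0" using r(1) M' by simp
    fix d :: 'ex and a :: 'ey and w :: 'ez assume d: "X.n0 d < r / M'" "Y.n0 a \<le> C * X.n0 d" "norm w \<le> C * X.n0 d"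
      and sol: "\<And>i. i < N \<Longrightarrow> f i (X.\<phi> x0 + d, Y.\<phi> y0 + a, \<phi>Z z0 + w) = f i q0"
    have "norm (d, a, w) \<le> norm d + (norm a + norm w)"
      using norm_Pair_le[of d "(a, w)"] norm_Pair_le[of a w] by linarith
    also have "\<dots> \<le> K * X.n0 d + (K * (C * X.n0 d) + C * X.n0 d)"
      using K(2)[of d] K(4)[of a] mult_left_mono[OF d(2), of K] K(1) d(3) by linarith
    also have "\<dots> = M' * X.n0 d" by (simp add: M'_def algebra_simps)
    finally have n: "norm (d, a, w) \<le> M' * X.n0 d" .
    also have "\<dots> < r" using d(1) M' by (simp add: pos_less_divide_eq mult.commute)
    finally have nr: "norm (d, a, w) < r" .
    have "\<bar>D i q0 (d, a, w)\<bar> \<le> M' * e * X.n0 d" if i: "i < N" for i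
    proof -
      have "\<bar>D i q0 (d, a, w)\<bar> \<le> e * norm (d, a, w)"
        using r(2)[OF i, of "(X.\<phi> x0 + d, Y.\<phi> y0 + a, \<phi>Z z0 + w)"] nr sol[OF i] by (simp add: q0_def)
      also have "\<dots> \<le> e * (M' * X.n0 d)" using n e(1) by (intro mult_left_mono) auto
      finally show ?thesis by (simp add: mult_ac)
    qed
    then have "(\<Sum>i<N. \<bar>D i q0 (d, a, w)\<bar>) \<le> (\<Sum>i<N. M' * e * X.n0 d)" by (intro sum_mono) auto
    then have s: "KA * (\<Sum>i<N. \<bar>D i q0 (d, a, w)\<bar>) \<le> KA * (\<Sum>i<N. M' * e * X.n0 d)"
      using KA(1) by (intro mult_left_mono)
    have "Y.n0 (L d) \<le> vnorm (coord_vec Ey a) + KA * (\<Sum>i<N. \<bar>(Jx *\<^sub>v coord_vec Ex d + Jy *\<^sub>v coord_vec Ey a + Jz *\<^sub>v coord_vec Ez w) $ i\<bar>)"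
      unfolding n0_L by (intro KA) auto
    also have "\<dots> = Y.n0 a + KA * (\<Sum>i<N. \<bar>D i q0 (d, a, w)\<bar>)"
      unfolding J_sum by (simp add: Y.n0_def coord_norm_eq_vnorm)
    also have "\<dots> \<le> Y.n0 a + KA * (\<Sum>i<N. M' * e * X.n0 d)" using s by simp
    also have "\<dots> = Y.n0 a + (KA * real N * M' * e) * X.n0 d" by simp
    also have "\<dots> \<le> Y.n0 a + \<epsilon> * X.n0 d" using e(2) by (intro add_left_mono mult_right_mono) auto
    finally show "Y.n0 (L d) \<le> Y.n0 a + \<epsilon> * X.n0 d" .
  qed
qed

end

section \<open>The condition number\<close>

lemma arg_min_is_min:
  fixes h :: "'a \<Rightarrow> 'b::linorder"
  assumes "P y" "\<And>y'. P y' \<Longrightarrow> h y \<le> h y'"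
  shows "P (arg_min h P)" "P y' \<Longrightarrow> h (arg_min h P) \<le> h y'"
proof -
  have "is_arg_min h P y" using assms by (auto simp: is_arg_min_def not_less)
  then have "is_arg_min h P (arg_min h P)" unfolding arg_min_def by (rule someI)
  then show "P (arg_min h P)" "P y' \<Longrightarrow> h (arg_min h P) \<le> h y'"
    by (auto simp: is_arg_min_def not_less)
qed

context crep_with_left_inverse
begin

text \<open>The factors \<open>1 - \<epsilon>\<close> and \<open>1 + \<epsilon>\<close> come from
  comparing distances with coordinate norms, the added multiples of \<open>X.n0\<close> from the
  \<open>o(dx)\<close> error of the linearisation. A negative lower bound becomes 0 under
  \<open>ennreal\<close>.\<close>

definition tracks_L :: "real \<Rightarrow> ('x \<Rightarrow> ennreal) \<Rightarrow> bool" where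
  "tracks_L \<epsilon> h \<longleftrightarrow> (\<exists>\<delta>>0. \<forall>x\<in>X.U. X.n0 (X.\<phi> x - X.\<phi> x0) < \<delta> \<longrightarrow>
    ennreal ((1 - \<epsilon>) * (Y.n0 (L (X.\<phi> x - X.\<phi> x0)) - \<epsilon> * X.n0 (X.\<phi> x - X.\<phi> x0))) \<le> h x \<and>
    h x \<le> ennreal ((1 + \<epsilon>) * (Y.n0 (L (X.\<phi> x - X.\<phi> x0)) + \<epsilon> * X.n0 (X.\<phi> x - X.\<phi> x0))))"

definition solution_dist :: "'z set \<Rightarrow> 'x \<Rightarrow> ennreal" where
  "solution_dist Zh x = riemannian_dist AY gY y0 (canonical_solution AY gY F c y0 Zh x)"

text \<open>\<open>Zh\<close> need not be closed, so the solutions over it need not form a compact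
  set. But near \<open>y0\<close> they coincide with those whose latent variable lies in a closed
  ball inside \<open>Zh\<close>, because latents can be moved back, and a solution near
  \<open>L\<close> beats everything farther away. So the minimum over a compact set is one over all
  solutions, and whichever minimiser \<open>arg_min\<close> picks is close enough for the
  first-order estimates.\<close>

theorem canonical_solution_dist:
  obtains Z0 where "open Z0" "z0 \<in> Z0" "\<And>Zh \<epsilon>. Zh \<subseteq> Z0 \<Longrightarrow> z0 \<in> interior Zh \<Longrightarrow> 0 < \<epsilon> \<Longrightarrow> \<epsilon> \<le> 1 / 2 \<Longrightarrow>
    tracks_L \<epsilon> (solution_dist Zh)"
proof -
  obtain \<rho>L C where latent: "\<rho>L > 0" "C \<ge> 0"
    "\<And>d a w. X.n0 d < \<rho>L \<Longrightarrow> Y.n0 a < \<rho>L \<Longrightarrow> norm w < \<rho>L \<Longrightarrow> (X.\<phi> x0 + d, Y.\<phi> y0 + a, \<phi>Z z0 + w) \<in> S"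
    "\<And>d a w. X.n0 d < \<rho>L \<Longrightarrow> Y.n0 a < \<rho>L \<Longrightarrow> norm w < \<rho>L \<Longrightarrow>
      (\<And>i. i < N \<Longrightarrow> f i (X.\<phi> x0 + d, Y.\<phi> y0 + a, \<phi>Z z0 + w) = f i q0) \<Longrightarrow>
      \<exists>w'. norm w' \<le> C * (X.n0 d + Y.n0 a) \<and> (\<forall>i<N. f i (X.\<phi> x0 + d, Y.\<phi> y0 + a, \<phi>Z z0 + w') = f i q0)"
    by (rule latent_close) (rule that; blast)
  define Z0 where "Z0 = UZ \<inter> \<phi>Z -` ball (\<phi>Z z0) \<rho>L"
  show ?thesis
  proof (rule that[of Z0])
    show "open Z0" unfolding Z0_def
      by (rule continuous_open_preimage[OF chartZ(3,1) open_ball])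
    show "z0 \<in> Z0" using z0UZ latent(1) by (simp add: Z0_def)
    fix Zh and \<epsilon> :: real assume Zh: "Zh \<subseteq> Z0" "z0 \<in> interior Zh" and \<epsilon>: "0 < \<epsilon>" "\<epsilon> \<le> 1 / 2"
    have "open (\<phi>Z ` UZ \<inter> \<psi>Z -` interior Zh)"
      by (rule continuous_open_preimage[OF chartZ(4,2) open_interior])
    moreover have "\<phi>Z z0 \<in> \<phi>Z ` UZ \<inter> \<psi>Z -` interior Zh" using z0UZ Zh(2) base_points(3) by simp
    ultimately obtain \<sigma>' where \<sigma>': "\<sigma>' > 0" "cball (\<phi>Z z0) \<sigma>' \<subseteq> \<phi>Z ` UZ \<inter> \<psi>Z -` interior Zh"
      using open_contains_cball by blast
    define \<sigma> where "\<sigma> = min \<sigma>' (\<rho>L / 2)"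
    have \<sigma>: "\<sigma> > 0" "\<sigma> < \<rho>L" using \<sigma>'(1) latent(1) by (auto simp: \<sigma>_def)
    have in_Zh: "\<psi>Z (\<phi>Z z0 + w) \<in> Zh" if "norm w \<le> \<sigma>" for w
    proof -
      have "\<phi>Z z0 + w \<in> cball (\<phi>Z z0) \<sigma>'" using that by (simp add: \<sigma>_def dist_norm)
      then show ?thesis using \<sigma>'(2) interior_subset by blast
    qed
    obtain \<rho>g where \<rho>g: "\<rho>g > 0" "\<And>\<rho>'. 0 < \<rho>' \<Longrightarrow> \<rho>' \<le> \<rho>g \<Longrightarrow> Y.good_radius \<epsilon> \<rho>'"
      using Y.good_radius_exists[of \<epsilon>] \<epsilon> by auto
    \<comment> \<open>For inputs and outputs within \<open>\<tau>\<close> of the base point,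
      \<open>latent_close\<close> provides latents within \<open>\<sigma>\<close>, where
      \<open>Zh\<close> is known to contain them.\<close>
    define \<tau> where "\<tau> = \<sigma> / (2 * (C + 1))"
    have \<tau>: "\<tau> > 0" "C * (\<tau> + \<tau>) \<le> \<sigma>"
    proof -
      show "\<tau> > 0" using \<sigma>(1) latent(2) by (simp add: \<tau>_def)
      have "0 < 2 * (C + 1)" using latent(2) by simp
      then have "2 * (C + 1) \<noteq> 0" by (rule less_imp_neq[symmetric])
      then have "2 * (C + 1) * \<tau> = \<sigma>"
        by (metis \<tau>_def nonzero_mult_div_cancel_left times_divide_eq_right)
      then show "C * (\<tau> + \<tau>) \<le> \<sigma>" using \<open>\<tau> > 0\<close> by (simp add: algebra_simps)
    qed
    define \<rho> where "\<rho> = min \<rho>g (min (\<rho>L / 2) \<tau>)"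
    have \<rho>: "\<rho> > 0" "\<rho> < \<rho>L" "\<rho> \<le> \<tau>" using \<rho>g(1) latent(1) \<tau>(1) by (auto simp: \<rho>_def)
    \<comment> \<open>The radius \<open>\<rho> / 2\<close> confines the competitors;
      \<open>\<rho>\<close> leaves the strict margin demanded by
      \<open>riemannian_dist_attains_min\<close>.\<close>
    have good: "Y.good_radius \<epsilon> \<rho>" "Y.good_radius \<epsilon> (\<rho> / 2)"
      using \<rho>g(2)[of \<rho>] \<rho>g(2)[of "\<rho> / 2"] \<rho>(1) by (auto simp: \<rho>_def)
    obtain KS where KS: "KS \<ge> 0" "\<And>\<epsilon>. \<epsilon> > 0 \<Longrightarrow> \<exists>\<delta>>0. \<forall>d. X.n0 d < \<delta> \<longrightarrow> solution_near_L \<epsilon> KS d"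
      by (rule solution_close_to_L) (rule that; blast)
    obtain \<delta>1 where \<delta>1: "\<delta>1 > 0" "\<And>d. X.n0 d < \<delta>1 \<Longrightarrow> solution_near_L \<epsilon> KS d"
      using KS(2)[OF \<epsilon>(1)] by blast
    define \<Lambda> where "\<Lambda> = mat_norm2 M"
    have \<Lambda>: "\<Lambda> \<ge> 0" "\<And>d. Y.n0 (L d) \<le> \<Lambda> * X.n0 d"
      using mat_norm2_nonneg n0_L_le by (auto simp: \<Lambda>_def)
    \<comment> \<open>The canonical solution will satisfy
      \<open>m \<le> 3 * (\<Lambda> + 1) * n\<close>, and its latent variable can be taken within
      \<open>C * (n + m)\<close>. \<open>Cc\<close> dominates both ratios to
      \<open>n\<close>.\<close>
    define Cc where "Cc = (C + 1) * (1 + 3 * (\<Lambda> + 1))"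
    have Cc: "3 * (\<Lambda> + 1) \<le> Cc" "C * (1 + 3 * (\<Lambda> + 1)) \<le> Cc" "Cc \<ge> 0"
    proof -
      have "0 \<le> C * (1 + 3 * (\<Lambda> + 1))" using latent(2) \<Lambda>(1) by (intro mult_nonneg_nonneg) auto
      then show "3 * (\<Lambda> + 1) \<le> Cc" "C * (1 + 3 * (\<Lambda> + 1)) \<le> Cc" "Cc \<ge> 0"
        using \<Lambda>(1) unfolding Cc_def distrib_right by auto
    qed
    obtain \<delta>2 where \<delta>2: "\<delta>2 > 0" "\<And>d a w. X.n0 d < \<delta>2 \<Longrightarrow> Y.n0 a \<le> Cc * X.n0 d \<Longrightarrow> norm w \<le> Cc * X.n0 d \<Longrightarrow>
      (\<And>i. i < N \<Longrightarrow> f i (X.\<phi> x0 + d, Y.\<phi> y0 + a, \<phi>Z z0 + w) = f i q0) \<Longrightarrow>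
      Y.n0 (L d) \<le> Y.n0 a + \<epsilon> * X.n0 d"
      by (rule solution_not_closer_than_L[OF Cc(3) \<epsilon>(1)]) (rule that; blast)
    \<comment> \<open>The 8 makes the bound \<open>3 / 2 * (\<Lambda> + 1) * n\<close> for the best
      distance less than 3/16 of \<open>\<rho>\<close>, whereas outputs outside the ball of radius
      \<open>\<rho> / 2\<close> are at least a quarter of \<open>\<rho>\<close> away. The last term
      keeps the latent variable of the solution near \<open>L\<close> within
      \<open>\<sigma>\<close>.\<close>
    define \<delta> where "\<delta> = min (min \<delta>1 \<delta>2) (min (min \<rho>L \<tau>) (min (\<rho> / (8 * (\<Lambda> + 1))) (\<sigma> / (KS + 1))))"
    have "\<delta> > 0" using \<delta>1(1) \<delta>2(1) latent(1) \<tau>(1) \<rho>(1) \<sigma>(1) \<Lambda>(1) KS(1) by (simp add: \<delta>_def)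
    moreover have "ennreal ((1 - \<epsilon>) * (Y.n0 (L (X.\<phi> x - X.\<phi> x0)) - \<epsilon> * X.n0 (X.\<phi> x - X.\<phi> x0)))
        \<le> riemannian_dist AY gY y0 (canonical_solution AY gY F c y0 Zh x) \<and>
      riemannian_dist AY gY y0 (canonical_solution AY gY F c y0 Zh x)
        \<le> ennreal ((1 + \<epsilon>) * (Y.n0 (L (X.\<phi> x - X.\<phi> x0)) + \<epsilon> * X.n0 (X.\<phi> x - X.\<phi> x0)))"
      if xU: "x \<in> X.U" and close: "X.n0 (X.\<phi> x - X.\<phi> x0) < \<delta>" for x
    proof -
      define d where "d = X.\<phi> x - X.\<phi> x0"
      define n where "n = X.n0 d"
      define l where "l = Y.n0 (L d)"
      let ?dist = "riemannian_dist AY gY y0"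
      have x: "X.\<phi> x0 + d = X.\<phi> x" "X.\<psi> (X.\<phi> x) = x" using X.chart(5)[OF xU] by (simp_all add: d_def)
      have n0: "n \<ge> 0" by (simp add: n_def)
      have n: "n < \<delta>1" "n < \<delta>2" "n < \<rho>L" "n < \<tau>" "(\<Lambda> + 1) * n < \<rho> / 8" "KS * n \<le> \<sigma>"
      proof -
        have "n < \<delta>" using close by (simp add: n_def d_def)
        then have *: "n < \<rho> / (8 * (\<Lambda> + 1))" "n < \<sigma> / (KS + 1)"
          and "n < \<delta>1" "n < \<delta>2" "n < \<rho>L" "n < \<tau>" by (auto simp: \<delta>_def)
        then show "n < \<delta>1" "n < \<delta>2" "n < \<rho>L" "n < \<tau>" by auto
        have "n * (8 * (\<Lambda> + 1)) < \<rho>" using *(1) \<Lambda>(1) by (subst (asm) pos_less_divide_eq) auto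
        then show "(\<Lambda> + 1) * n < \<rho> / 8" by (simp add: algebra_simps)
        have "n * (KS + 1) < \<sigma>" using *(2) KS(1) by (subst (asm) pos_less_divide_eq) auto
        then show "KS * n \<le> \<sigma>" using n0 by (simp add: algebra_simps)
      qed
      have l: "0 \<le> l" "l \<le> \<Lambda> * n" using \<Lambda>(2) by (auto simp: l_def n_def)
      have "\<epsilon> * n \<le> 1 * n" using \<epsilon> n0 by (intro mult_right_mono) auto
      then have l\<epsilon>: "l + \<epsilon> * n \<le> (\<Lambda> + 1) * n" "0 \<le> l + \<epsilon> * n"
        using l \<epsilon> n0 by (auto simp: algebra_simps)
      define Sol where "Sol y \<longleftrightarrow> (\<exists>z\<in>Zh. F (x, y, z) = c)" for y
      define eqs where "eqs t w \<longleftrightarrow> (\<forall>i<N. f i (X.\<phi> x, t, \<phi>Z z0 + w) = f i q0)" for t w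
      have inS: "(X.\<phi> x, t, \<phi>Z z0 + w) \<in> S" if "Y.n0 (t - Y.\<phi> y0) < \<rho>L" "norm w < \<rho>L" for t w
        using latent(3)[of d "t - Y.\<phi> y0" w] n(3) that by (simp add: x n_def)
      have Sol_eqs: "\<exists>w. norm w \<le> C * (n + Y.n0 (Y.\<phi> y - Y.\<phi> y0)) \<and> eqs (Y.\<phi> y) w"
        if y: "y \<in> Y.U" "Y.n0 (Y.\<phi> y - Y.\<phi> y0) < \<rho>L" and "Sol y" for y
      proof -
        obtain z where z: "z \<in> Zh" "F (x, y, z) = c" using \<open>Sol y\<close> unfolding Sol_def by blast
        have zU: "z \<in> UZ" "norm (\<phi>Z z - \<phi>Z z0) < \<rho>L"
          using z(1) Zh(1) by (auto simp: Z0_def dist_norm norm_minus_commute)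
        have "(X.\<phi> x, Y.\<phi> y, \<phi>Z z) \<in> S" using inS[OF y(2) zU(2)] by simp
        from F_eq_c_iff[OF this] have "\<forall>i<N. f i (X.\<phi> x, Y.\<phi> y, \<phi>Z z) = f i q0"
          using z(2) x(2) Y.chart(5)[OF y(1)] chartZ(5)[OF zU(1)] by simp
        then show ?thesis
          using latent(4)[of d "Y.\<phi> y - Y.\<phi> y0" "\<phi>Z z - \<phi>Z z0"] n(3) y(2) zU(2)
          by (simp add: x n_def eqs_def)
      qed
      have eqs_Sol: "Sol (Y.\<psi> t)" if t: "Y.n0 (t - Y.\<phi> y0) < \<rho>L" and w: "norm w \<le> \<sigma>" "eqs t w" for t w
      proof -
        have "(X.\<phi> x, t, \<phi>Z z0 + w) \<in> S" using t w(1) \<sigma>(2) by (intro inS) auto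
        from F_eq_c_iff[OF this] have "F (x, Y.\<psi> t, \<psi>Z (\<phi>Z z0 + w)) = c"
          using w(2) by (simp add: eqs_def x(2))
        then show ?thesis using in_Zh[OF w(1)] unfolding Sol_def by blast
      qed
      define P where "P = {t. Y.n0 (t - Y.\<phi> y0) \<le> \<rho> / 2} \<times> cball (0::'ez) \<sigma>"
      \<comment> \<open>Projecting the compact set of pairs removes the latent variable. The outer
        intersection with \<open>P\<close> matters for \<open>N = 0\<close>, where the intersection
        over the equations is the whole space.\<close>
      define K where "K = fst ` (P \<inter> (\<Inter>i\<in>{..<N}. {p \<in> P. f i (X.\<phi> x, fst p, \<phi>Z z0 + snd p) = f i q0}))"
      have K_iff: "t \<in> K \<longleftrightarrow> Y.n0 (t - Y.\<phi> y0) \<le> \<rho> / 2 \<and> (\<exists>w. norm w \<le> \<sigma> \<and> eqs t w)" for t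
      proof
        assume "t \<in> K"
        then obtain p where p: "p \<in> P" "t = fst p" "\<forall>i<N. f i (X.\<phi> x, fst p, \<phi>Z z0 + snd p) = f i q0"
          unfolding K_def by auto
        then have "eqs t (snd p)" by (simp add: eqs_def)
        moreover have "Y.n0 (t - Y.\<phi> y0) \<le> \<rho> / 2" "norm (snd p) \<le> \<sigma>"
          using p(1,2) by (auto simp: P_def)
        ultimately show "Y.n0 (t - Y.\<phi> y0) \<le> \<rho> / 2 \<and> (\<exists>w. norm w \<le> \<sigma> \<and> eqs t w)" by blast
      next
        assume "Y.n0 (t - Y.\<phi> y0) \<le> \<rho> / 2 \<and> (\<exists>w. norm w \<le> \<sigma> \<and> eqs t w)"
        then obtain w where w: "Y.n0 (t - Y.\<phi> y0) \<le> \<rho> / 2" "norm w \<le> \<sigma>" "eqs t w" by blast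
        have "(t, w) \<in> P" using w(1,2) by (simp add: P_def)
        then show "t \<in> K" unfolding K_def using w(3)
          by (intro image_eqI[of _ _ "(t, w)"]) (auto simp: eqs_def)
      qed
      have "compact P" unfolding P_def Y.n0_def
        by (intro compact_Times compact_coord_ball[OF Y.basis] compact_cball_finite_span[OF ordered_basis_finite_span[OF Ez]])
      have PS: "(X.\<phi> x, fst p, \<phi>Z z0 + snd p) \<in> S" if "p \<in> P" for p
        using that \<rho>(1,2) \<sigma>(2) by (intro inS) (auto simp: P_def)
      have "continuous_on P (\<lambda>p. f i (X.\<phi> x, fst p, \<phi>Z z0 + snd p))" if "i < N" for i
      proof (rule continuous_on_compose2[of S "f i" P])
        show "continuous_on S (f i)"
          using deriv_f[OF that] by (intro continuous_at_imp_continuous_on ballI has_derivative_continuous) blast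
        show "continuous_on P (\<lambda>p. (X.\<phi> x, fst p, \<phi>Z z0 + snd p))" by (intro continuous_intros)
      qed (use PS in auto)
      then have cl: "closed {p \<in> P. f i (X.\<phi> x, fst p, \<phi>Z z0 + snd p) = f i q0}" if "i < N" for i
        using that compact_imp_closed[OF \<open>compact P\<close>] by (intro continuous_closed_preimage_constant) auto
      have "closed (\<Inter>i\<in>{..<N}. {p \<in> P. f i (X.\<phi> x, fst p, \<phi>Z z0 + snd p) = f i q0})"
        by (rule closed_INT) (use cl in auto)
      from compact_Int_closed[OF \<open>compact P\<close> this] have "compact K" unfolding K_def
        by (rule compact_continuous_image[rotated]) (intro continuous_intros)
      \<comment> \<open>A true solution near \<open>L d\<close>: its distance is an upper bound for
        that of every minimiser.\<close>
      obtain y1 z1 where y1: "Y.n0 (y1 - (Y.\<phi> y0 + L d)) \<le> \<epsilon> * n" "norm (z1 - \<phi>Z z0) \<le> KS * n"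
        "\<forall>i<N. f i (X.\<phi> x0 + d, y1, z1) = f i q0"
        using \<delta>1(2)[of d] n(1) unfolding n_def solution_near_L_def by blast
      have y1n: "Y.n0 (y1 - Y.\<phi> y0) \<le> l + \<epsilon> * n"
        using coord_norm_triangle[OF Y.basis, of "y1 - (Y.\<phi> y0 + L d)" "L d"] y1(1)
        by (simp add: Y.n0_def l_def)
      then have y1\<rho>: "Y.n0 (y1 - Y.\<phi> y0) \<le> \<rho> / 2" using l\<epsilon>(1) n(5) \<rho>(1) by linarith
      have "y1 \<in> K"
        unfolding K_iff eqs_def using y1\<rho> y1(2,3) n(6) x(1)
        by (intro conjI exI[of _ "z1 - \<phi>Z z0"]) auto
      have psi: "Y.\<phi> (Y.\<psi> t) = t" "Y.\<psi> t \<in> Y.U" if "t \<in> K" for t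
      proof -
        have "Y.n0 (t - Y.\<phi> y0) \<le> \<rho>" using that \<rho>(1) unfolding K_iff by linarith
        then have "t \<in> Y.\<phi> ` Y.U" using good(1) unfolding Y.good_radius_def by blast
        then show "Y.\<phi> (Y.\<psi> t) = t" "Y.\<psi> t \<in> Y.U" using Y.chart(6,7) by blast+
      qed
      have dist_y1: "?dist (Y.\<psi> y1) \<le> ennreal ((1 + \<epsilon>) * (l + \<epsilon> * n))"
      proof -
        have "Y.\<psi> y1 \<in> Y.coord_cball (\<rho> / 2)"
          using psi[OF \<open>y1 \<in> K\<close>] y1\<rho> by (simp add: Y.coord_cball_def)
        from Y.riemannian_dist_upper_bound[OF good(2) \<epsilon>(1) this]
        have "?dist (Y.\<psi> y1) \<le> ennreal ((1 + \<epsilon>) * Y.n0 (y1 - Y.\<phi> y0))" by (simp add: psi[OF \<open>y1 \<in> K\<close>])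
        also have "\<dots> \<le> ennreal ((1 + \<epsilon>) * (l + \<epsilon> * n))"
          using y1n \<epsilon> by (intro ennreal_leI mult_left_mono) auto
        finally show ?thesis .
      qed
      have up: "(1 + \<epsilon>) * (l + \<epsilon> * n) \<le> 3 / 2 * ((\<Lambda> + 1) * n)"
        using \<epsilon> l\<epsilon> by (intro mult_mono) auto
      have "1 / 2 * (\<rho> / 2) \<le> (1 - \<epsilon>) * (\<rho> / 2)" using \<epsilon> \<rho>(1) by (intro mult_right_mono) auto
      then have up2: "(1 + \<epsilon>) * (l + \<epsilon> * n) < (1 - \<epsilon>) * (\<rho> / 2)"
        using up n(5) \<rho>(1) by linarith
      have outside: "y \<in> Y.coord_ball (\<rho> / 2)" if "?dist y \<le> ennreal ((1 + \<epsilon>) * (l + \<epsilon> * n))" for y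
      proof (rule ccontr)
        assume "y \<notin> Y.coord_ball (\<rho> / 2)"
        then have "ennreal ((1 - \<epsilon>) * (\<rho> / 2)) \<le> ?dist y"
          using \<epsilon> by (intro Y.riemannian_dist_lower_bound(2)[OF good(2)]) auto
        then have "ennreal ((1 - \<epsilon>) * (\<rho> / 2)) \<le> ennreal ((1 + \<epsilon>) * (l + \<epsilon> * n))"
          using that by (rule order_trans)
        moreover have "0 \<le> (1 + \<epsilon>) * (l + \<epsilon> * n)" using \<epsilon> l\<epsilon>(2) by simp
        ultimately show False using up2 by (simp add: ennreal_le_iff)
      qed
      obtain t where t: "t \<in> K" "\<And>t'. t' \<in> K \<Longrightarrow> ?dist (Y.\<psi> t) \<le> ?dist (Y.\<psi> t')"
      proof -
        have "Y.n0 (t - Y.\<phi> y0) < \<rho>" if "t \<in> K" for t using that \<rho>(1) unfolding K_iff by linarith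
        then show ?thesis
          using Y.riemannian_dist_attains_min[OF good(1) \<epsilon>(1) \<open>compact K\<close>] \<open>y1 \<in> K\<close> that by blast
      qed
      have t_y1: "?dist (Y.\<psi> t) \<le> ennreal ((1 + \<epsilon>) * (l + \<epsilon> * n))"
        using t(2)[OF \<open>y1 \<in> K\<close>] dist_y1 by (rule order_trans)
      have small: "C * (n + Y.n0 (Y.\<phi> y - Y.\<phi> y0)) \<le> \<sigma>" "Y.n0 (Y.\<phi> y - Y.\<phi> y0) < \<rho>L" "y \<in> Y.U"
        if "y \<in> Y.coord_ball (\<rho> / 2)" for y
      proof -
        have y: "y \<in> Y.U" "Y.n0 (Y.\<phi> y - Y.\<phi> y0) < \<rho> / 2" using that by (auto simp: Y.coord_ball_def)
        have "C * (n + Y.n0 (Y.\<phi> y - Y.\<phi> y0)) \<le> C * (\<tau> + \<tau>)"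
          using y(2) \<rho>(1,3) n(4) latent(2) by (intro mult_left_mono) auto
        then show "C * (n + Y.n0 (Y.\<phi> y - Y.\<phi> y0)) \<le> \<sigma>" using \<tau>(2) by linarith
        show "Y.n0 (Y.\<phi> y - Y.\<phi> y0) < \<rho>L" "y \<in> Y.U" using y \<rho>(1,2) by auto
      qed
      \<comment> \<open>A solution within the bound for \<open>y1\<close> lies in the small ball;
        its latent variable can then be moved back, so it belongs to \<open>K\<close>. Any other
        solution is farther away than \<open>Y.\<psi> t\<close>.\<close>
      have min: "?dist (Y.\<psi> t) \<le> ?dist y" if sol_y: "Sol y" for y
      proof (cases "?dist y \<le> ennreal ((1 + \<epsilon>) * (l + \<epsilon> * n))")
        case True
        from outside[OF this] have yb: "y \<in> Y.coord_ball (\<rho> / 2)" .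
        obtain w where w: "norm w \<le> C * (n + Y.n0 (Y.\<phi> y - Y.\<phi> y0))" "eqs (Y.\<phi> y) w"
          using Sol_eqs[OF small(3,2)[OF yb] sol_y] by blast
        have "norm w \<le> \<sigma>" using w(1) small(1)[OF yb] by linarith
        then have "Y.\<phi> y \<in> K" unfolding K_iff using w(2) yb by (auto simp: Y.coord_ball_def)
        from t(2)[OF this] show ?thesis using Y.chart(5)[OF small(3)[OF yb]] by simp
      next
        case False
        then show ?thesis using t_y1 by (meson linear order_trans)
      qed
      have "Sol (Y.\<psi> t)"
      proof -
        obtain w where w: "norm w \<le> \<sigma>" "eqs t w" using t(1) unfolding K_iff by blast
        have "Y.n0 (t - Y.\<phi> y0) < \<rho>L" using t(1) \<rho>(1,2) unfolding K_iff by linarith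
        from eqs_Sol[OF this w] show ?thesis .
      qed
      define H where "H = canonical_solution AY gY F c y0 Zh x"
      have H_eq: "H = arg_min ?dist Sol"
        by (simp add: H_def canonical_solution_def Sol_def[abs_def])
      have H: "Sol H" "?dist H \<le> ?dist (Y.\<psi> t)"
        unfolding H_eq using arg_min_is_min[of Sol "Y.\<psi> t" ?dist, OF \<open>Sol (Y.\<psi> t)\<close> min] \<open>Sol (Y.\<psi> t)\<close> by blast+
      have upper: "?dist H \<le> ennreal ((1 + \<epsilon>) * (l + \<epsilon> * n))" using H(2) t_y1 by (rule order_trans)
      from outside[OF upper] have Hb: "H \<in> Y.coord_ball (\<rho> / 2)" .
      define m where "m = Y.n0 (Y.\<phi> H - Y.\<phi> y0)"
      have lower: "ennreal ((1 - \<epsilon>) * m) \<le> ?dist H"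
        unfolding m_def using \<epsilon> subsetD[OF Y.coord_ball_subset Hb]
        by (intro Y.riemannian_dist_lower_bound(1)[OF good(2)]) auto
      have "ennreal ((1 - \<epsilon>) * m) \<le> ennreal ((1 + \<epsilon>) * (l + \<epsilon> * n))" using lower upper by (rule order_trans)
      moreover have "0 \<le> (1 + \<epsilon>) * (l + \<epsilon> * n)" using \<epsilon> l\<epsilon>(2) by simp
      ultimately have "(1 - \<epsilon>) * m \<le> (1 + \<epsilon>) * (l + \<epsilon> * n)" by (simp add: ennreal_le_iff)
      moreover have "1 / 2 * m \<le> (1 - \<epsilon>) * m" using \<epsilon> by (intro mult_right_mono) (auto simp: m_def)
      ultimately have m: "m \<le> 3 * (\<Lambda> + 1) * n" using up by linarith
      obtain w where w: "norm w \<le> C * (n + m)" "eqs (Y.\<phi> H) w"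
        using Sol_eqs[OF small(3,2)[OF Hb] H(1)] unfolding m_def by blast
      have "Y.n0 (L d) \<le> Y.n0 (Y.\<phi> H - Y.\<phi> y0) + \<epsilon> * X.n0 d"
      proof (rule \<delta>2(2))
        show "X.n0 d < \<delta>2" using n(2) by (simp add: n_def)
        have "3 * (\<Lambda> + 1) * n \<le> Cc * n" using Cc(1) n0 by (intro mult_right_mono)
        then show "Y.n0 (Y.\<phi> H - Y.\<phi> y0) \<le> Cc * X.n0 d" using m by (simp add: m_def n_def)
        have "C * (n + m) \<le> C * (n + 3 * (\<Lambda> + 1) * n)" using m latent(2) by (intro mult_left_mono) auto
        also have "\<dots> = (C * (1 + 3 * (\<Lambda> + 1))) * n" by (simp add: algebra_simps)
        also have "\<dots> \<le> Cc * n" using Cc(2) n0 by (intro mult_right_mono)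
        finally show "norm w \<le> Cc * X.n0 d" using w(1) by (simp add: n_def)
        show "f i (X.\<phi> x0 + d, Y.\<phi> y0 + (Y.\<phi> H - Y.\<phi> y0), \<phi>Z z0 + w) = f i q0" if "i < N" for i
          using w(2) that by (simp add: eqs_def x(1))
      qed
      then have "(1 - \<epsilon>) * (l - \<epsilon> * n) \<le> (1 - \<epsilon>) * m"
        using \<epsilon> by (intro mult_left_mono) (auto simp: l_def m_def n_def)
      then have "ennreal ((1 - \<epsilon>) * (l - \<epsilon> * n)) \<le> ?dist H" using lower ennreal_leI order_trans by blast
      with upper show ?thesis by (simp add: H_def l_def n_def d_def)
    qed
    ultimately show "tracks_L \<epsilon> (solution_dist Zh)"
      unfolding tracks_L_def solution_dist_def by blast
  qed
qed

text \<open>From above, all quotients near \<open>x0\<close> are at most slightly larger than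
  \<open>\<Lambda>\<close>. From below, points are taken on rays in the chart whose direction
  \<open>u\<close> nearly attains the operator norm. If \<open>x0\<close> is isolated, the limes
  superior over the trivial filter and \<open>\<Lambda>\<close> are both 0; this needs no separate
  case, since a limes superior below \<open>\<Lambda>\<close> forces \<open>\<Lambda> > 0\<close>
  and so provides a nonzero \<open>u\<close>.\<close>

lemma Limsup_ratio:
  fixes h :: "'x \<Rightarrow> ennreal"
  assumes bounds: "\<And>\<epsilon>. 0 < \<epsilon> \<Longrightarrow> \<epsilon> \<le> 1 / 2 \<Longrightarrow> tracks_L \<epsilon> h"
  shows "Limsup (at x0) (\<lambda>x. h x / riemannian_dist AX gX x0 x) = ennreal (mat_norm2 M)"
proof -
  define \<Lambda> where "\<Lambda> = mat_norm2 M"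
  have \<Lambda>: "\<Lambda> \<ge> 0" "\<And>d. Y.n0 (L d) \<le> \<Lambda> * X.n0 d"
    using mat_norm2_nonneg n0_L_le by (auto simp: \<Lambda>_def)
  let ?n = "\<lambda>x. X.n0 (X.\<phi> x - X.\<phi> x0)" and ?l = "\<lambda>x. Y.n0 (L (X.\<phi> x - X.\<phi> x0))"
  let ?d = "riemannian_dist AX gX x0"
  have near: "eventually (\<lambda>x. x \<in> X.U \<and> ?n x > 0 \<and>
      ennreal ((1 - \<epsilon>) * (?l x - \<epsilon> * ?n x)) \<le> h x \<and> h x \<le> ennreal ((1 + \<epsilon>) * (?l x + \<epsilon> * ?n x)) \<and>
      ennreal ((1 - \<epsilon>) * ?n x) \<le> ?d x \<and> ?d x \<le> ennreal ((1 + \<epsilon>) * ?n x)) (at x0)"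
    if \<epsilon>: "0 < \<epsilon>" "\<epsilon> \<le> 1 / 2" for \<epsilon>
  proof -
    obtain \<delta> where \<delta>: "\<delta> > 0" "\<And>x. x \<in> X.U \<Longrightarrow> ?n x < \<delta> \<Longrightarrow>
      ennreal ((1 - \<epsilon>) * (?l x - \<epsilon> * ?n x)) \<le> h x \<and> h x \<le> ennreal ((1 + \<epsilon>) * (?l x + \<epsilon> * ?n x))"
      using bounds[OF \<epsilon>] unfolding tracks_L_def by blast
    obtain \<rho> where \<rho>: "\<rho> > 0" "X.good_radius \<epsilon> \<rho>"
      using X.good_radius_exists[of \<epsilon>] \<epsilon> by auto
    have "open (X.coord_ball (min \<delta> \<rho>))" by (rule X.open_coord_ball)
    moreover have "x0 \<in> X.coord_ball (min \<delta> \<rho>)"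
      using X.p0U \<delta>(1) \<rho>(1) X.basis by (simp add: X.coord_ball_def X.n0_def)
    moreover have "x \<in> X.U \<and> ?n x > 0 \<and>
      ennreal ((1 - \<epsilon>) * (?l x - \<epsilon> * ?n x)) \<le> h x \<and> h x \<le> ennreal ((1 + \<epsilon>) * (?l x + \<epsilon> * ?n x)) \<and>
      ennreal ((1 - \<epsilon>) * ?n x) \<le> ?d x \<and> ?d x \<le> ennreal ((1 + \<epsilon>) * ?n x)"
      if xb: "x \<in> X.coord_ball (min \<delta> \<rho>)" and ne: "x \<noteq> x0" for x
    proof -
      have x: "x \<in> X.U" "?n x < \<delta>" "?n x < \<rho>" using xb by (auto simp: X.coord_ball_def)
      have xc: "x \<in> X.coord_cball \<rho>" using x by (simp add: X.coord_cball_def)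
      have "?n x > 0"
      proof (rule ccontr)
        assume "\<not> ?n x > 0"
        then have "?n x = 0" using X.n0_nonneg[of "X.\<phi> x - X.\<phi> x0"] by linarith
        obtain K where "\<And>u. norm u \<le> K * X.n0 u"
          using norm_le_coord_norm[OF X.basis] unfolding X.n0_def by blast
        from this[of "X.\<phi> x - X.\<phi> x0"] have "X.\<phi> x = X.\<phi> x0" using \<open>?n x = 0\<close> by simp
        then show False using ne X.chart(5)[OF x(1)] base_points(1) by metis
      qed
      moreover have "ennreal ((1 - \<epsilon>) * ?n x) \<le> ?d x"
        using \<epsilon> by (intro X.riemannian_dist_lower_bound(1)[OF \<rho>(2) _ xc]) auto
      moreover have "?d x \<le> ennreal ((1 + \<epsilon>) * ?n x)"
        by (rule X.riemannian_dist_upper_bound[OF \<rho>(2) \<epsilon>(1) xc])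
      ultimately show ?thesis using \<delta>(2)[OF x(1,2)] x(1) by blast
    qed
    ultimately show ?thesis unfolding eventually_at_topological by blast
  qed
  show ?thesis unfolding \<Lambda>_def[symmetric]
  proof (rule antisym)
    show "Limsup (at x0) (\<lambda>x. h x / ?d x) \<le> ennreal \<Lambda>"
      unfolding Limsup_le_iff
    proof (intro allI impI)
      fix y assume "y > ennreal \<Lambda>"
      then obtain z where z: "ennreal \<Lambda> < z" "z < y" using dense by blast
      then have "z < top" using top_greatest less_le_trans by blast
      then obtain r where r: "z = ennreal r" "r \<ge> 0" by (cases z) auto
      have r\<Lambda>: "\<Lambda> < r" using z(1) \<Lambda>(1) unfolding r(1) by (simp add: ennreal_less_iff)
      \<comment> \<open>Solves \<open>(1 + \<epsilon>) * (\<Lambda> + \<epsilon>) \<le> (1 -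
        \<epsilon>) * r\<close>; the summand 2 absorbs
        \<open>\<epsilon> + \<epsilon> * \<epsilon>\<close>.\<close>
      define \<epsilon> where "\<epsilon> = min (1 / 2) ((r - \<Lambda>) / (\<Lambda> + r + 2))"
      have \<epsilon>: "0 < \<epsilon>" "\<epsilon> \<le> 1 / 2"
      proof -
        show "0 < \<epsilon>" using r\<Lambda> \<Lambda>(1) r(2) by (simp add: \<epsilon>_def)
        show "\<epsilon> \<le> 1 / 2" unfolding \<epsilon>_def by (rule min.cobounded1)
      qed
      have "\<epsilon> \<le> (r - \<Lambda>) / (\<Lambda> + r + 2)" by (simp add: \<epsilon>_def)
      then have \<epsilon>r: "\<epsilon> * (\<Lambda> + r + 2) \<le> r - \<Lambda>" using \<Lambda>(1) r(2) by (simp add: pos_le_divide_eq)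
      have "\<epsilon> * \<epsilon> \<le> 1 * \<epsilon>" using \<epsilon> by (intro mult_right_mono) auto
      then have main: "(1 + \<epsilon>) * (\<Lambda> + \<epsilon>) \<le> (1 - \<epsilon>) * r" using \<epsilon>r by (simp add: algebra_simps)
      show "eventually (\<lambda>x. y > h x / ?d x) (at x0)"
        using near[OF \<epsilon>]
      proof eventually_elim
        case (elim x)
        have "(1 + \<epsilon>) * (?l x + \<epsilon> * ?n x) \<le> (1 + \<epsilon>) * (\<Lambda> * ?n x + \<epsilon> * ?n x)"
          using \<Lambda>(2) \<epsilon> by (intro mult_left_mono add_mono) auto
        also have "\<dots> = ((1 + \<epsilon>) * (\<Lambda> + \<epsilon>)) * ?n x" by (simp add: algebra_simps)
        also have "\<dots> \<le> ((1 - \<epsilon>) * r) * ?n x" using main by (intro mult_right_mono) auto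
        finally have b: "(1 + \<epsilon>) * (?l x + \<epsilon> * ?n x) \<le> ((1 - \<epsilon>) * ?n x) * r" by (simp add: mult_ac)
        have "h x \<le> ennreal (((1 - \<epsilon>) * ?n x) * r)" using elim b by (meson ennreal_leI order_trans)
        also have "\<dots> = ennreal ((1 - \<epsilon>) * ?n x) * ennreal r" using \<epsilon> r(2) by (intro ennreal_mult) auto
        also have "\<dots> \<le> ?d x * ennreal r" using elim by (intro mult_right_mono) auto
        finally have "h x \<le> ?d x * ennreal r" .
        moreover have "?d x > 0"
        proof -
          have "0 < (1 - \<epsilon>) * ?n x" using elim \<epsilon> by (intro mult_pos_pos) auto
          then have "0 < ennreal ((1 - \<epsilon>) * ?n x)" by simp
          then show ?thesis using elim less_le_trans by blast
        qed
        ultimately have "h x / ?d x \<le> ennreal r" by (intro divide_le_posI_ennreal)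
        then show ?case using z(2) r(1) by (metis le_less_trans)
      qed
    qed
    show "ennreal \<Lambda> \<le> Limsup (at x0) (\<lambda>x. h x / ?d x)"
    proof (rule ccontr)
      assume "\<not> ?thesis"
      then have "Limsup (at x0) (\<lambda>x. h x / ?d x) < ennreal \<Lambda>" by simp
      then obtain z where z: "Limsup (at x0) (\<lambda>x. h x / ?d x) < z" "z < ennreal \<Lambda>" using dense by blast
      then have "z < top" using top_greatest less_le_trans by blast
      then obtain r where r: "z = ennreal r" "r \<ge> 0" by (cases z) auto
      have r\<Lambda>: "r < \<Lambda>" using z(2) r(2) unfolding r(1) by (simp add: ennreal_less_iff)
      have ev: "eventually (\<lambda>x. h x / ?d x < z) (at x0)"
        using Limsup_le_iff[of "at x0" "\<lambda>x. h x / ?d x" "Limsup (at x0) (\<lambda>x. h x / ?d x)"] z(1) by blast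
      obtain c' where c': "r < c'" "c' < \<Lambda>" using dense[OF r\<Lambda>] by blast
      obtain v where v: "v \<in> carrier_vec (dim_col M)" "vnorm v \<le> 1" "c' < vnorm (M *\<^sub>v v)"
        using mat_norm2_approx[of c' M] c'(2) unfolding \<Lambda>_def by blast
      have vc: "v \<in> carrier_vec (length Ex)" using v(1) M by simp
      define u where "u = of_coords Ex v"
      have cu: "coord_vec Ex u = v" unfolding u_def by (rule coord_vec_of_coords[OF X.basis vc])
      have nu: "X.n0 u \<le> 1" "c' < Y.n0 (L u)" using v by (simp_all add: n0_X n0_L cu)
      define \<epsilon> where "\<epsilon> = min (1 / 2) ((c' - r) / (c' + r + 1))"
      have \<epsilon>: "0 < \<epsilon>" "\<epsilon> \<le> 1 / 2"
      proof -
        show "0 < \<epsilon>" using c'(1) r(2) by (simp add: \<epsilon>_def)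
        show "\<epsilon> \<le> 1 / 2" unfolding \<epsilon>_def by (rule min.cobounded1)
      qed
      have "\<epsilon> \<le> (c' - r) / (c' + r + 1)" by (simp add: \<epsilon>_def)
      then have \<epsilon>r: "\<epsilon> * (c' + r + 1) \<le> c' - r" using c'(1) r(2) by (simp add: pos_le_divide_eq)
      have "(1 - \<epsilon>) * (c' - \<epsilon>) - r * (1 + \<epsilon>) = (c' - r) - \<epsilon> * (c' + r + 1) + \<epsilon> * \<epsilon>"
        by (simp add: algebra_simps)
      moreover have "0 \<le> \<epsilon> * \<epsilon>" by simp
      ultimately have main: "r * (1 + \<epsilon>) \<le> (1 - \<epsilon>) * (c' - \<epsilon>)" using \<epsilon>r by linarith
      have "u \<noteq> 0"
      proof
        assume "u = 0"
        then have "Y.n0 (L u) = 0" using linear_0[OF linear_L] Y.basis by (simp add: Y.n0_def)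
        then show False using nu(2) c'(1) r(2) by linarith
      qed
      obtain O' where O': "open O'" "x0 \<in> O'" "\<And>x. x \<in> O' \<Longrightarrow> x \<noteq> x0 \<Longrightarrow> h x / ?d x < z \<and> x \<in> X.U \<and> ?n x > 0 \<and>
        ennreal ((1 - \<epsilon>) * (?l x - \<epsilon> * ?n x)) \<le> h x \<and> h x \<le> ennreal ((1 + \<epsilon>) * (?l x + \<epsilon> * ?n x)) \<and>
        ennreal ((1 - \<epsilon>) * ?n x) \<le> ?d x \<and> ?d x \<le> ennreal ((1 + \<epsilon>) * ?n x)"
        using eventually_conj[OF ev near[OF \<epsilon>]] unfolding eventually_at_topological by blast
      have "open (X.\<phi> ` X.U \<inter> X.\<psi> -` O')"
        by (rule continuous_open_preimage[OF X.chart(4,2) O'(1)])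
      moreover have "X.\<phi> x0 \<in> X.\<phi> ` X.U \<inter> X.\<psi> -` O'" using X.p0U O'(2) base_points(1) by simp
      ultimately obtain e where e: "e > 0" "cball (X.\<phi> x0) e \<subseteq> X.\<phi> ` X.U \<inter> X.\<psi> -` O'"
        using open_contains_cball by blast
      \<comment> \<open>One point of the ray in the neighbourhood is enough, since every quotient
        there is supposed to be below \<open>r\<close>.\<close>
      define s where "s = e / norm u"
      have s: "s > 0" "norm (s *\<^sub>R u) \<le> e" using e(1) \<open>u \<noteq> 0\<close> by (simp_all add: s_def)
      define x where "x = X.\<psi> (X.\<phi> x0 + s *\<^sub>R u)"
      have "X.\<phi> x0 + s *\<^sub>R u \<in> cball (X.\<phi> x0) e" using s(2) by (simp add: dist_norm)
      then have in': "X.\<phi> x0 + s *\<^sub>R u \<in> X.\<phi> ` X.U" and xO: "x \<in> O'" using e(2) by (auto simp: x_def)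
      have \<phi>x: "X.\<phi> x - X.\<phi> x0 = s *\<^sub>R u" unfolding x_def using X.chart(6)[OF in'] by simp
      have "x \<noteq> x0" using \<phi>x s(1) \<open>u \<noteq> 0\<close> by auto
      note x = O'(3)[OF xO this]
      have nx: "?n x = s * X.n0 u" and lx: "?l x = s * Y.n0 (L u)"
        unfolding \<phi>x using s(1)
        by (simp_all add: X.n0_def Y.n0_def coord_norm_scaleR X.basis Y.basis linear_cmul[OF linear_L])
      have "c' * ?n x \<le> ?l x"
      proof -
        have "c' * X.n0 u \<le> c' * 1" using nu(1) c'(1) r(2) by (intro mult_left_mono) auto
        then have "c' * X.n0 u \<le> Y.n0 (L u)" using nu(2) by linarith
        then have "s * (c' * X.n0 u) \<le> s * Y.n0 (L u)" using s(1) by (intro mult_left_mono) auto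
        then show ?thesis unfolding nx lx by (simp add: mult_ac)
      qed
      then have "(1 - \<epsilon>) * (c' * ?n x - \<epsilon> * ?n x) \<le> (1 - \<epsilon>) * (?l x - \<epsilon> * ?n x)"
        using \<epsilon> by (intro mult_left_mono) auto
      moreover have "r * (1 + \<epsilon>) * ?n x \<le> (1 - \<epsilon>) * (c' - \<epsilon>) * ?n x" using main by (intro mult_right_mono) auto
      ultimately have "r * ((1 + \<epsilon>) * ?n x) \<le> (1 - \<epsilon>) * (?l x - \<epsilon> * ?n x)" by (simp add: algebra_simps)
      then have "ennreal (r * ((1 + \<epsilon>) * ?n x)) \<le> h x" using x by (meson ennreal_leI order_trans)
      moreover have "ennreal r * ?d x \<le> ennreal r * ennreal ((1 + \<epsilon>) * ?n x)" using x by (intro mult_left_mono) auto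
      moreover have "ennreal r * ennreal ((1 + \<epsilon>) * ?n x) = ennreal (r * ((1 + \<epsilon>) * ?n x))"
        using r(2) \<epsilon> by (intro ennreal_mult[symmetric]) auto
      ultimately have "ennreal r * ?d x \<le> h x" by (metis order_trans)
      moreover have "?d x \<noteq> 0"
      proof
        assume "?d x = 0"
        then have "ennreal ((1 - \<epsilon>) * ?n x) \<le> 0" using x by simp
        moreover have "0 < (1 - \<epsilon>) * ?n x" using x \<epsilon> by (intro mult_pos_pos) auto
        ultimately show False by (simp add: ennreal_eq_0_iff)
      qed
      moreover have "?d x < top" using x ennreal_less_top le_less_trans by blast
      ultimately have "\<not> h x / ?d x < ennreal r" by (simp add: divide_less_ennreal not_less)
      then show False using x r(1) by simp
    qed
  qed
qed

theorem condition_number_eq: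
  "condition_number AX gX AY gY F c x0 y0 z0 = ennreal (mat_norm2 (A' * LE.B))"
proof -
  obtain Z0 where Z0: "open Z0" "z0 \<in> Z0" and *: "\<And>Zh \<epsilon>. Zh \<subseteq> Z0 \<Longrightarrow> z0 \<in> interior Zh \<Longrightarrow> 0 < \<epsilon> \<Longrightarrow> \<epsilon> \<le> 1 / 2 \<Longrightarrow>
    tracks_L \<epsilon> (solution_dist Zh)"
    by (rule canonical_solution_dist) (rule that; blast)
  have lim: "Limsup (at x0) (\<lambda>x. solution_dist Zh x / riemannian_dist AX gX x0 x) = ennreal (mat_norm2 M)"
    if "Zh \<subseteq> Z0" "z0 \<in> interior Zh" for Zh
    using *[OF that] by (rule Limsup_ratio)
  have "condition_number AX gX AY gY F c x0 y0 z0 = ennreal (mat_norm2 M)"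
    unfolding condition_number_def solution_dist_def[symmetric]
  proof (rule the_equality)
    show "\<exists>Z0. open Z0 \<and> z0 \<in> Z0 \<and> (\<forall>Zh. Zh \<subseteq> Z0 \<and> z0 \<in> interior Zh \<longrightarrow>
      Limsup (at x0) (\<lambda>x. solution_dist Zh x / riemannian_dist AX gX x0 x) = ennreal (mat_norm2 M))"
      using Z0 lim by blast
    fix \<kappa> assume "\<exists>Z0. open Z0 \<and> z0 \<in> Z0 \<and> (\<forall>Zh. Zh \<subseteq> Z0 \<and> z0 \<in> interior Zh \<longrightarrow>
      Limsup (at x0) (\<lambda>x. solution_dist Zh x / riemannian_dist AX gX x0 x) = \<kappa>)"
    then obtain Z1 where Z1: "open Z1" "z0 \<in> Z1" "\<And>Zh. Zh \<subseteq> Z1 \<and> z0 \<in> interior Zh \<Longrightarrow>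
      Limsup (at x0) (\<lambda>x. solution_dist Zh x / riemannian_dist AX gX x0 x) = \<kappa>" by blast
    \<comment> \<open>Two candidates for the common value agree, because
      \<open>Z0 \<inter> Z1\<close> is an admissible neighbourhood for both.\<close>
    have i: "z0 \<in> interior (Z0 \<inter> Z1)" using Z0 Z1(1,2) by (simp add: interior_open open_Int)
    show "\<kappa> = ennreal (mat_norm2 M)"
      using lim[of "Z0 \<inter> Z1"] Z1(3)[of "Z0 \<inter> Z1"] i by simp
  qed
  then show ?thesis by (simp add: M_def)
qed

end

theorem proposition10:
  fixes AX :: "('x::{t2_space, second_countable_topology}, 'ex::real_inner) chart set"
    and AY :: "('y::{t2_space, second_countable_topology}, 'ey::real_inner) chart set"
    and AZ :: "('z::{t2_space, second_countable_topology}, 'ez::real_inner) chart set"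
    and gX :: "('x, 'ex) metric" and gY :: "('y, 'ey) metric"
    and N :: nat and F :: "'x \<times> 'y \<times> 'z \<Rightarrow> real vec" and c :: "real vec"
    and x0 :: 'x and y0 :: 'y and z0 :: 'z
    and cx :: "('x, 'ex) chart" and cy :: "('y, 'ey) chart" and cz :: "('z, 'ez) chart"
    and Ex :: "'ex list" and Ey :: "'ey list" and Ez :: "'ez list"
    and Jx Jy Jz Q Uy Uz A B :: "real mat" and q u :: nat
  assumes "CREP AX AY AZ N F c"
    and "riemannian_metric AX gX" and "riemannian_metric AY gY"
    and "F (x0, y0, z0) = c"
    and "cx \<in> charts_at AX x0" and "orthonormal_basis_at gX cx x0 Ex"
    and "cy \<in> charts_at AY y0" and "orthonormal_basis_at gY cy y0 Ey"
    and "cz \<in> charts_at AZ z0" and "ordered_basis Ez"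
    and "Jx = jacobian_mat N cx Ex (\<lambda>x. F (x, y0, z0)) x0"
    and "Jy = jacobian_mat N cy Ey (\<lambda>y. F (x0, y, z0)) y0"
    and "Jz = jacobian_mat N cz Ez (\<lambda>z. F (x0, y0, z)) z0"
    and "Q \<in> carrier_mat N q"
    and "vec_space.col_space N Q = vec_module.orthogonal_complement N (vec_space.col_space N Jz)"
    and "Uy \<in> carrier_mat (length Ey) u" and "Uz \<in> carrier_mat (length Ez) u"
    and "Jy * Uy + Jz * Uz = 0\<^sub>m N u"
    and "mat_kernel (Jy @\<^sub>c Jz) = vec_space.col_space (length Ey + length Ez) (Uy @\<^sub>r Uz)"
    and "A = (transpose_mat Q * Jy) @\<^sub>r transpose_mat Uy"
    and "B = (- (transpose_mat Q * Jx)) @\<^sub>r 0\<^sub>m u (length Ex)"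
  shows "lin_indpt_cols A \<and>
    (\<forall>A'. A' \<in> carrier_mat (length Ey) (q + u) \<and> inverts_mat A' A \<longrightarrow>
       condition_number AX gX AY gY F c x0 y0 z0 = ennreal (mat_norm2 (A' * B)))"
proof -
  have J: "Jx \<in> carrier_mat N (length Ex)" "Jy \<in> carrier_mat N (length Ey)" "Jz \<in> carrier_mat N (length Ez)"
    using assms(11-13) by (auto simp: jacobian_mat_def)
  interpret LE: linear_elimination Jx Jy Jz Q Uy Uz N "length Ex" "length Ey" "length Ez" q u
    using J assms by unfold_locales
  have A: "A = LE.A" and B: "B = LE.B"
    using assms(20,21) by (simp_all add: LE.A_def LE.B_def)
  have "condition_number AX gX AY gY F c x0 y0 z0 = ennreal (mat_norm2 (A' * B))"
    if A': "A' \<in> carrier_mat (length Ey) (q + u)" "inverts_mat A' A" for A'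
  proof -
    interpret crep_with_left_inverse AX AY AZ gX gY N F c x0 y0 z0 cx cy cz Ex Ey Ez Jx Jy Jz Q Uy Uz q u A'
    proof
      show "A' * LE.A = 1\<^sub>m (length Ey)" using A' unfolding A inverts_mat_def by simp
    qed (use assms A' in auto)
    show ?thesis using condition_number_eq unfolding B .
  qed
  then show ?thesis using LE.lin_indpt_cols_A unfolding A by blast
qed

end
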